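(* Let $N\ge2$ and $d\ge2$. Consider the Boltzmann–Gibbs gas of $N$ identical balls of radius $\rho>0$ and unit mass in the box $\prod_{k=1}^d[0,L_k]$ with $L_k>2\rho$ for all $k$, and let $\Omega_\gamma$ be a connected component of its collision-free configuration space $\Omega$. If the collision graph $\Gamma_\gamma$ of $\Omega_\gamma$ is connected, then every polynomial-in-momentum first integral $f$ of the Boltzmann–Gibbs gas on $\Omega_\gamma$ is a polynomial in the total kinetic energy $H(p)=\frac12\sum_{i=1}^N\|p_i\|^2$; that is, there is a one-variable real polynomial $P$ with $f(q,p)=P(H(p))$ for all $q\in\Omega_\gamma$, $p\in\mathbb{R}^{dN}$.
   Context: Configuration space. The centers of the balls lie in $D=\prod_{k=1}^d(\rho,L_k-\rho)$, and $$\Omega=\{(q_1,\dots,q_N)\in D^N:\ \|q_i-q_j\|>2\rho\ \text{for } i\ne j\}.$$ Momenta are $p=(p_1,\dots,p_N)$ with $p_i\in\mathbb{R}^d$. $\Omega_\gamma$ is a fixed connected component of $\Omega$, with closure $\overline\Omega_\gamma$. Dynamics. The balls move freely ($\dot q=p$, $\dot p=0$) in $\Omega_\gamma$ and collide elastically with one another and with the walls. A point $x\in\overline\Omega_\gamma$ is a regular collision point if exactly one collision occurs at $x$, i.e. one of the following holds: (a) wall collision: exactly one coordinate $x_{i,k}$ equals $\rho$ or $L_k-\rho$, all other coordinates lie strictly between the corresponding bounds, and $\|x_a-x_b\|>2\rho$ for all $a\neq b$; (b) pair collision: $x\in D^N$, $\|x_i-x_j\|=2\rho$ for exactly one pair $\{i,j\}$,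 and all other pairs have distance $>2\rho$. In case (a), with $n\in\mathbb{R}^d$ the $k$-th coordinate unit vector, the momenta change by $p_i'=p_i-2\langle p_i,n\rangle n$, the others being unchanged. In case (b), with $n=(x_i-x_j)/(2\rho)$, they change by $p_i'=p_i-\langle p_i-p_j,n\rangle n$, $p_j'=p_j+\langle p_i-p_j,n\rangle n$, the others being unchanged. In both cases $p\mapsto p'$ is the orthogonal reflection of $\mathbb{R}^{dN}$ in the tangent hyperplane to the boundary hypersurface at $x$. First integrals. A first integral on $\Omega_\gamma$ is a function $f:\Omega_\gamma\times\mathbb{R}^{dN}\to\mathbb{R}$ constant along trajectories: (i) $f(q+tp,p)=f(q,p)$ whenever the segment from $q$ to $q+tp$ lies in $\Omega_\gamma$; (ii) if $q+sp\in\Omega_\gamma$ for $0\le s<t_1$ ($t_1>0$), $x=q+t_1p$ is a regular collision point, $p$ is transverse to the boundary hypersurface at $x$, $p'$ is the momentum after the collision, and $x+sp'\in\Omega_\gamma$ for $0<s\le t_2$ ($t_2>0$), then $f(x+t_2p',p')=f(q,p)$. It is polynomial-in-momentum if $f(q,p)=\sum_{|\alpha|\le r}a_\alpha(q)p^\alpha$ for some $r$ and some functions $a_\alpha:\Omega_\gamma\to\mathbb{R}$, with no regularity assumption on the $a_\alpha$. Collision graph. $\Gamma_\gamma$ has vertices $1,\dots,N$; $i$ and $j$ are joined if the balls can be continuously moved, while remaining in $\Omega_\gamma$, to a configuration in which balls $i$ and $j$ collide and no other collision occurs. That is, there is a continuous path $c:[0,1]\to\mathbb{R}^{dN}$ with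 $c([0,1))\subset\Omega_\gamma$ such that $c(1)$ is of type (b) for the pair $\{i,j\}$. *)

theory Defs
  imports "HOL-Analysis.Analysis" "HOL-Computational_Algebra.Polynomial"
begin

text \<open>
  Balls are indexed by a finite type \<open>'n\<close>, space directions by a finite type \<open>'d\<close>; configurations
  and momenta are elements of the Euclidean space \<open>real ^ 'd ^ 'n\<close>, with \<open>q $ i\<close> the centre
  (or momentum) of ball \<open>i\<close>.
\<close>

definition center_box :: "real \<Rightarrow> real ^ 'd \<Rightarrow> (real ^ 'd) set" where
  "center_box \<rho> L = {y. \<forall>k. \<rho> < y $ k \<and> y $ k < L $ k - \<rho>}"

definition config_space :: "real \<Rightarrow> real ^ 'd \<Rightarrow> (real ^ 'd ^ 'n) set" where
  "config_space \<rho> L =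
     {q. (\<forall>i. q $ i \<in> center_box \<rho> L) \<and> (\<forall>i j. i \<noteq> j \<longrightarrow> norm (q $ i - q $ j) > 2 * \<rho>)}"

definition wall_collision :: "real \<Rightarrow> real ^ 'd \<Rightarrow> 'n \<Rightarrow> 'd \<Rightarrow> real ^ 'd ^ 'n \<Rightarrow> bool" where
  "wall_collision \<rho> L i k x \<longleftrightarrow>
     (x $ i $ k = \<rho> \<or> x $ i $ k = L $ k - \<rho>) \<and>
     (\<forall>a l. (a, l) \<noteq> (i, k) \<longrightarrow> \<rho> < x $ a $ l \<and> x $ a $ l < L $ l - \<rho>) \<and>
     (\<forall>a b. a \<noteq> b \<longrightarrow> norm (x $ a - x $ b) > 2 * \<rho>)"

definition pair_collision :: "real \<Rightarrow> real ^ 'd \<Rightarrow> 'n \<Rightarrow> 'n \<Rightarrow> real ^ 'd ^ 'n \<Rightarrow> bool" where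
  "pair_collision \<rho> L i j x \<longleftrightarrow>
     i \<noteq> j \<and> (\<forall>a. x $ a \<in> center_box \<rho> L) \<and> norm (x $ i - x $ j) = 2 * \<rho> \<and>
     (\<forall>a b. a \<noteq> b \<and> {a, b} \<noteq> {i, j} \<longrightarrow> norm (x $ a - x $ b) > 2 * \<rho>)"

definition wall_normal :: "'d \<Rightarrow> real ^ 'd" where
  "wall_normal k = axis k 1"

definition pair_normal :: "real \<Rightarrow> 'n \<Rightarrow> 'n \<Rightarrow> real ^ 'd ^ 'n \<Rightarrow> real ^ 'd" where
  "pair_normal \<rho> i j x = (x $ i - x $ j) /\<^sub>R (2 * \<rho>)"

definition wall_reflect :: "'n \<Rightarrow> real ^ 'd \<Rightarrow> real ^ 'd ^ 'n \<Rightarrow> real ^ 'd ^ 'n" where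
  "wall_reflect i n p = (\<chi> a. if a = i then p $ i - (2 * (p $ i \<bullet> n)) *\<^sub>R n else p $ a)"

definition pair_reflect :: "'n \<Rightarrow> 'n \<Rightarrow> real ^ 'd \<Rightarrow> real ^ 'd ^ 'n \<Rightarrow> real ^ 'd ^ 'n" where
  "pair_reflect i j n p =
     (\<chi> a. if a = i then p $ i - ((p $ i - p $ j) \<bullet> n) *\<^sub>R n
          else if a = j then p $ j + ((p $ i - p $ j) \<bullet> n) *\<^sub>R n
          else p $ a)"

text \<open>
  Tangent hyperplanes of the boundary hypersurfaces: the kernels of the derivatives of
  \<open>x \<mapsto> x $ i $ k\<close> and of \<open>x \<mapsto> (norm (x $ i - x $ j))\<^sup>2\<close> (up to a nonzero factor).
\<close>

definition wall_tangent :: "'n \<Rightarrow> real ^ 'd \<Rightarrow> (real ^ 'd ^ 'n) set" where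
  "wall_tangent i n = {v. v $ i \<bullet> n = 0}"

definition pair_tangent :: "'n \<Rightarrow> 'n \<Rightarrow> real ^ 'd \<Rightarrow> (real ^ 'd ^ 'n) set" where
  "pair_tangent i j n = {v. (v $ i - v $ j) \<bullet> n = 0}"

text \<open>
  \<open>regular_collision \<rho> L \<Omega>\<^sub>\<gamma> x p p'\<close>: \<open>x\<close> is a regular collision point in the closure of \<open>\<Omega>\<^sub>\<gamma>\<close>,
  \<open>p\<close> is transverse to the boundary hypersurface at \<open>x\<close>, and \<open>p'\<close> is the momentum after the
  collision.
\<close>

definition regular_collision ::
    "real \<Rightarrow> real ^ 'd \<Rightarrow> (real ^ 'd ^ 'n) set \<Rightarrow>
     real ^ 'd ^ 'n \<Rightarrow> real ^ 'd ^ 'n \<Rightarrow> real ^ 'd ^ 'n \<Rightarrow> bool" where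
  "regular_collision \<rho> L \<Omega>\<^sub>\<gamma> x p p' \<longleftrightarrow>
     x \<in> closure \<Omega>\<^sub>\<gamma> \<and>
     ((\<exists>i k. wall_collision \<rho> L i k x \<and> p \<notin> wall_tangent i (wall_normal k) \<and>
             p' = wall_reflect i (wall_normal k) p) \<or>
      (\<exists>i j. pair_collision \<rho> L i j x \<and> p \<notin> pair_tangent i j (pair_normal \<rho> i j x) \<and>
             p' = pair_reflect i j (pair_normal \<rho> i j x) p))"

text \<open>
  A function on \<open>\<Omega>\<^sub>\<gamma>\<close> times momentum space is represented by a total function whose values at
  configurations outside \<open>\<Omega>\<^sub>\<gamma>\<close> are irrelevant.
\<close>

definition first_integral ::
    "real \<Rightarrow> real ^ 'd \<Rightarrow> (real ^ 'd ^ 'n) set \<Rightarrow>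
     (real ^ 'd ^ 'n \<Rightarrow> real ^ 'd ^ 'n \<Rightarrow> real) \<Rightarrow> bool" where
  "first_integral \<rho> L \<Omega>\<^sub>\<gamma> f \<longleftrightarrow>
     (\<forall>q p t. closed_segment q (q + t *\<^sub>R p) \<subseteq> \<Omega>\<^sub>\<gamma> \<longrightarrow> f (q + t *\<^sub>R p) p = f q p) \<and>
     (\<forall>q p p' t\<^sub>1 t\<^sub>2 x.
        t\<^sub>1 > 0 \<and> (\<forall>s. 0 \<le> s \<and> s < t\<^sub>1 \<longrightarrow> q + s *\<^sub>R p \<in> \<Omega>\<^sub>\<gamma>) \<and>
        x = q + t\<^sub>1 *\<^sub>R p \<and> regular_collision \<rho> L \<Omega>\<^sub>\<gamma> x p p' \<and>
        t\<^sub>2 > 0 \<and> (\<forall>s. 0 < s \<and> s \<le> t\<^sub>2 \<longrightarrow> x + s *\<^sub>R p' \<in> \<Omega>\<^sub>\<gamma>)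
        \<longrightarrow> f (x + t\<^sub>2 *\<^sub>R p') p' = f q p)"

definition multi_indices :: "nat \<Rightarrow> (nat ^ 'd ^ 'n) set" where
  "multi_indices r = {\<alpha>. (\<Sum>i\<in>UNIV. \<Sum>k\<in>UNIV. \<alpha> $ i $ k) \<le> r}"

definition monomial :: "nat ^ 'd ^ 'n \<Rightarrow> real ^ 'd ^ 'n \<Rightarrow> real" where
  "monomial \<alpha> p = (\<Prod>i\<in>UNIV. \<Prod>k\<in>UNIV. (p $ i $ k) ^ (\<alpha> $ i $ k))"

lemma finite_multi_indices: "finite (multi_indices r :: (nat ^ 'd ^ 'n) set)"
proof -
  let ?F = "\<lambda>g :: 'n \<times> 'd \<Rightarrow> nat. (\<chi> i k. g (i, k)) :: nat ^ 'd ^ 'n"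
  have "multi_indices r \<subseteq> ?F ` (PiE UNIV (\<lambda>_. {..r}))"
  proof
    fix \<alpha> :: "nat ^ 'd ^ 'n"
    assume "\<alpha> \<in> multi_indices r"
    then have le: "(\<Sum>i\<in>UNIV. \<Sum>k\<in>UNIV. \<alpha> $ i $ k) \<le> r"
      by (simp add: multi_indices_def)
    have "\<alpha> $ i $ k \<le> r" for i k
    proof -
      have "\<alpha> $ i $ k \<le> (\<Sum>k\<in>UNIV. \<alpha> $ i $ k)"
        by (rule member_le_sum) auto
      also have "\<dots> \<le> (\<Sum>i\<in>UNIV. \<Sum>k\<in>UNIV. \<alpha> $ i $ k)"
        by (rule member_le_sum[where f = "\<lambda>i. \<Sum>k\<in>UNIV. \<alpha> $ i $ k"]) auto
      finally show ?thesis using le by simp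
    qed
    then have "(\<lambda>(i, k). \<alpha> $ i $ k) \<in> PiE UNIV (\<lambda>_. {..r})"
      by auto
    moreover have "\<alpha> = ?F (\<lambda>(i, k). \<alpha> $ i $ k)"
      by (simp add: vec_eq_iff)
    ultimately show "\<alpha> \<in> ?F ` (PiE UNIV (\<lambda>_. {..r}))"
      by (intro image_eqI[where x = "\<lambda>(i, k). \<alpha> $ i $ k"])
  qed
  moreover have "finite (PiE (UNIV :: ('n \<times> 'd) set) (\<lambda>_. {..r}))"
    by (rule finite_PiE) auto
  ultimately show ?thesis
    by (meson finite_imageI finite_subset)
qed

definition polynomial_in_momentum ::
    "(real ^ 'd ^ 'n) set \<Rightarrow> (real ^ 'd ^ 'n \<Rightarrow> real ^ 'd ^ 'n \<Rightarrow> real) \<Rightarrow> bool" where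
  "polynomial_in_momentum \<Omega>\<^sub>\<gamma> f \<longleftrightarrow>
     (\<exists>r. \<exists>a :: nat ^ 'd ^ 'n \<Rightarrow> real ^ 'd ^ 'n \<Rightarrow> real.
        \<forall>q\<in>\<Omega>\<^sub>\<gamma>. \<forall>p. f q p = (\<Sum>\<alpha>\<in>multi_indices r. a \<alpha> q * monomial \<alpha> p))"

definition collision_graph ::
    "real \<Rightarrow> real ^ 'd \<Rightarrow> (real ^ 'd ^ 'n) set \<Rightarrow> ('n \<times> 'n) set" where
  "collision_graph \<rho> L \<Omega>\<^sub>\<gamma> =
     {(i, j). \<exists>c. path c \<and> c ` {0..<1} \<subseteq> \<Omega>\<^sub>\<gamma> \<and> pair_collision \<rho> L i j (c 1)}"

lemma pair_collision_commute: "pair_collision \<rho> L i j x \<longleftrightarrow> pair_collision \<rho> L j i x"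
  by (auto simp: pair_collision_def norm_minus_commute insert_commute)

lemma sym_collision_graph: "sym (collision_graph \<rho> L \<Omega>\<^sub>\<gamma>)"
  by (auto simp: sym_def collision_graph_def pair_collision_commute)

text \<open>Since the edge relation is symmetric, a path of edges may be taken in the directed sense.\<close>

definition graph_connected :: "('n \<times> 'n) set \<Rightarrow> bool" where
  "graph_connected E \<longleftrightarrow> (\<forall>i j. (i, j) \<in> E\<^sup>*)"

definition kinetic_energy :: "real ^ 'd ^ 'n \<Rightarrow> real" where
  "kinetic_energy p = (1 / 2) * (\<Sum>i\<in>UNIV. (norm (p $ i))\<^sup>2)"

end

theory Submission
  imports Defs "HOL-Complex_Analysis.Conformal_Mappings"
begin

text \<open>
  The idea. Since \<open>f(x, y - x) = f(y, y - x)\<close> is polynomial in \<open>y\<close> for fixed \<open>x\<close> and in \<open>x\<close> for fixed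
  \<open>y\<close>, the integral is jointly polynomial, hence extends to a polynomial \<open>G\<close> on the whole phase space
  that is invariant under free motion, and by analyticity under reflection at every point of the
  hyperplane of some wall in each direction, and at every point of the cylinder of each edge of the
  collision graph.

  The extended billiard may be run inside the cylinder \<open>|q\<^sub>i - q\<^sub>j| = 2\<rho>\<close>. Its closed polygonal
  orbits are dense, the other coordinates drift along them, and a periodic polynomial is constant; so \<open>G\<close> is
  invariant under the relative motion of the pair alone, and then under rotations of the plane
  spanned by relative position and relative velocity. Conjugating the relative motion by a wall
  reflection and taking second differences of the infinitesimal rotation invariance shows that \<open>G\<close> does
  not depend on one coordinate of one ball in each direction; the same second difference carries this
  independence along the edges of the graph. So \<open>G\<close> depends on the momentum only, and the reflections
  leaving it invariant turn out to be all reflections of momentum space.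
\<close>

section \<open>Polynomial functions\<close>

text \<open>After a collision a pair outside its cylinder separates freely, so recurrence is missing
  there. Inside, the relative motion is bounded and meets the same cylinder again and again; this is
  a region of overlapping balls, which only the extension \<open>G\<close> can reach. Free motion
  and pair collisions alone would also preserve total momentum and angular momentum. A wall in each
  direction breaks these laws, because it reflects the velocity of only one ball of a pair. The
  rotations enter infinitesimally because the plane of rotation depends on the phase point. Scaled
  suitably, the generator is polynomial: its position part is quadratic in the relative position,
  its momentum part only linear. A second difference in the relative position therefore eliminates
  the momentum part and leaves a translation of positions.\<close>

definition entire_extension :: "(real \<Rightarrow> real) \<Rightarrow> bool" where
  "entire_extension h \<longleftrightarrow>
     (\<exists>g. g holomorphic_on UNIV \<and> (\<forall>t. g (complex_of_real t) = complex_of_real (h t)))"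

text \<open>A line is combined with a circular motion because the contact set of a pair is a
  cylinder: the normal turns while the other coordinates move linearly. Along such a path
  \<open>F\<close> is not a polynomial in \<open>t\<close>, but it is built from entire functions by
  sums and products.\<close>

lemma entire_extension_polynomial_path:
  fixes F :: "'a::real_normed_vector \<Rightarrow> real"
  assumes "real_polynomial_function F"
  shows "entire_extension (\<lambda>t. F (a + t *\<^sub>R b + cos t *\<^sub>R c + sin t *\<^sub>R d))"
  using assms
proof (induction F rule: real_polynomial_function.induct)
  case (linear f)
  interpret bounded_linear f by fact
  let ?g = "\<lambda>z. complex_of_real (f a) + z * of_real (f b) + cos z * of_real (f c) + sin z * of_real (f d)"
  have "?g holomorphic_on UNIV"
    by (intro holomorphic_intros)
  moreover have "?g (of_real t) = of_real (f (a + t *\<^sub>R b + cos t *\<^sub>R c + sin t *\<^sub>R d))" for t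
    by (simp add: add scale cos_of_real sin_of_real)
  ultimately show ?case
    unfolding entire_extension_def by blast
next
  case (const k)
  then show ?case
    unfolding entire_extension_def by (intro exI[of _ "\<lambda>_. of_real k"]) auto
next
  case (add f g)
  then obtain f' g' where "f' holomorphic_on UNIV" "g' holomorphic_on UNIV"
    "\<forall>t. f' (of_real t) = of_real (f (a + t *\<^sub>R b + cos t *\<^sub>R c + sin t *\<^sub>R d))"
    "\<forall>t. g' (of_real t) = of_real (g (a + t *\<^sub>R b + cos t *\<^sub>R c + sin t *\<^sub>R d))"
    unfolding entire_extension_def by blast
  then show ?case
    unfolding entire_extension_def
    by (intro exI[of _ "\<lambda>z. f' z + g' z"]) (auto intro!: holomorphic_intros)
next
  case (mult f g)
  then obtain f' g' where "f' holomorphic_on UNIV" "g' holomorphic_on UNIV"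
    "\<forall>t. f' (of_real t) = of_real (f (a + t *\<^sub>R b + cos t *\<^sub>R c + sin t *\<^sub>R d))"
    "\<forall>t. g' (of_real t) = of_real (g (a + t *\<^sub>R b + cos t *\<^sub>R c + sin t *\<^sub>R d))"
    unfolding entire_extension_def by blast
  then show ?case
    unfolding entire_extension_def
    by (intro exI[of _ "\<lambda>z. f' z * g' z"]) (auto intro!: holomorphic_intros)
qed

text \<open>The identity theorem for the entire extension, whose zeros on a real interval accumulate
  at 0.\<close>

lemma polynomial_zero_path:
  fixes F :: "'a::real_normed_vector \<Rightarrow> real"
  assumes F: "real_polynomial_function F" and e: "e > 0"
    and z: "\<And>t. \<bar>t\<bar> < e \<Longrightarrow> F (a + t *\<^sub>R b + cos t *\<^sub>R c + sin t *\<^sub>R d) = 0"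
  shows "F (a + t *\<^sub>R b + cos t *\<^sub>R c + sin t *\<^sub>R d) = 0"
proof -
  obtain g where g: "g holomorphic_on UNIV"
    "\<And>t. g (of_real t) = of_real (F (a + t *\<^sub>R b + cos t *\<^sub>R c + sin t *\<^sub>R d))"
    using entire_extension_polynomial_path[OF F] unfolding entire_extension_def by metis
  let ?U = "complex_of_real ` ball 0 e"
  have lim: "(0::complex) islimpt ?U"
    unfolding islimpt_approachable
  proof (intro allI impI)
    fix r :: real assume r: "r > 0"
    let ?s = "min r e / 2"
    have "complex_of_real ?s \<in> ?U" "complex_of_real ?s \<noteq> 0" "dist (complex_of_real ?s) 0 < r"
      using r e by (auto simp: dist_norm simp del: of_real_divide)
    then show "\<exists>x'\<in>?U. x' \<noteq> 0 \<and> dist x' 0 < r" by blast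
  qed
  have "g (of_real t) = 0"
    by (rule analytic_continuation[where S = UNIV and U = ?U and \<xi> = 0])
       (use g z lim in \<open>auto simp: dist_norm\<close>)
  then show ?thesis
    using g by simp
qed

lemma polynomial_zero_line:
  fixes F :: "'a::real_normed_vector \<Rightarrow> real"
  assumes "real_polynomial_function F" "e > 0"
    and "\<And>t. \<bar>t\<bar> < e \<Longrightarrow> F (a + t *\<^sub>R b) = 0"
  shows "F (a + t *\<^sub>R b) = 0"
  using polynomial_zero_path[OF assms(1,2), of a b 0 0 t] assms(3) by simp

lemma polynomial_zero_ball:
  fixes F :: "'a::real_normed_vector \<Rightarrow> real"
  assumes F: "real_polynomial_function F" and e: "e > 0" and z: "\<And>x. x \<in> ball a e \<Longrightarrow> F x = 0"
  shows "F x = 0"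
proof -
  let ?e = "e / (norm (x - a) + 1)"
  have pos: "norm (x - a) + 1 > 0" by (simp add: add_nonneg_pos)
  have "F (a + 1 *\<^sub>R (x - a)) = 0"
  proof (rule polynomial_zero_line[OF F, of ?e])
    show "?e > 0" using e pos by simp
    fix t assume t: "\<bar>t\<bar> < ?e"
    have "\<bar>t\<bar> * norm (x - a) \<le> \<bar>t\<bar> * (norm (x - a) + 1)" by (simp add: mult_left_mono)
    also have "\<dots> < e" using t pos by (simp add: field_simps)
    finally show "F (a + t *\<^sub>R (x - a)) = 0" by (intro z) (simp add: dist_norm)
  qed
  then show ?thesis by simp
qed

section \<open>Separation of variables and interpolation\<close>

lemma polynomial_function_Pair:
  fixes f :: "'a::real_normed_vector \<Rightarrow> 'b::real_normed_vector" and g :: "'a \<Rightarrow> 'c::real_normed_vector"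
  assumes "polynomial_function f" "polynomial_function g"
  shows "polynomial_function (\<lambda>x. (f x, g x))"
  unfolding polynomial_function_def
proof (intro allI impI)
  fix h :: "'b \<times> 'c \<Rightarrow> real" assume h: "bounded_linear h"
  then interpret bounded_linear h .
  have 1: "bounded_linear (\<lambda>x. h (x, 0))"
    by (rule bounded_linear_compose[OF h]) (intro bounded_linear_Pair bounded_linear_ident bounded_linear_zero)
  have 2: "bounded_linear (\<lambda>x. h (0, x))"
    by (rule bounded_linear_compose[OF h]) (intro bounded_linear_Pair bounded_linear_ident bounded_linear_zero)
  have "real_polynomial_function (\<lambda>x. h (f x, 0) + h (0, g x))"
    using assms 1 2 unfolding polynomial_function_def o_def
    by (intro real_polynomial_function.intros(3)) blast+
  moreover have "h (f x, g x) = h (f x, 0) + h (0, g x)" for x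
    by (simp flip: add)
  ultimately show "real_polynomial_function (h \<circ> (\<lambda>x. (f x, g x)))"
    by (simp add: o_def)
qed

lemma polynomial_function_linear:
  fixes f :: "'a::euclidean_space \<Rightarrow> 'b::real_normed_vector"
  assumes "linear f" shows "polynomial_function f"
  using assms by (simp add: linear_conv_bounded_linear polynomial_function_bounded_linear)

lemma real_polynomial_function_subst:
  fixes G :: "'b::real_normed_vector \<Rightarrow> real"
  assumes "real_polynomial_function G" "polynomial_function f"
  shows "real_polynomial_function (\<lambda>x. G (f x))"
  using real_polynomial_function_compose[OF assms(2,1)] by (simp add: o_def)

text \<open>Separates the variables, so that a polynomial in \<open>y - x\<close> becomes a
  combination of fixed polynomials in \<open>y\<close> whose coefficients depend on
  \<open>x\<close>.\<close>

lemma real_polynomial_function_times_decomposition: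
  fixes h :: "'a::real_normed_vector \<times> 'b::real_normed_vector \<Rightarrow> real"
  assumes "real_polynomial_function h"
  shows "\<exists>(J :: nat set) u v. finite J \<and>
           (\<forall>j. real_polynomial_function (u j)) \<and> (\<forall>j. real_polynomial_function (v j)) \<and>
           (\<forall>x y. h (x, y) = (\<Sum>j\<in>J. u j x * v j y))"
proof -
  have "\<exists>(n :: nat) u v.
           (\<forall>j. real_polynomial_function (u j)) \<and> (\<forall>j. real_polynomial_function (v j)) \<and>
           (\<forall>x y. h (x, y) = (\<Sum>j<n. u j x * v j y))"
    using assms
  proof (induction h rule: real_polynomial_function.induct)
    case (linear f)
    interpret bounded_linear f by fact
    have 1: "bounded_linear (\<lambda>x. f (x, 0))"
      by (rule bounded_linear_compose[OF \<open>bounded_linear f\<close>]) (intro bounded_linear_Pair bounded_linear_ident bounded_linear_zero)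
    have 2: "bounded_linear (\<lambda>x. f (0, x))"
      by (rule bounded_linear_compose[OF \<open>bounded_linear f\<close>]) (intro bounded_linear_Pair bounded_linear_ident bounded_linear_zero)
    let ?u = "\<lambda>(j::nat) x. if j = 0 then f (x, 0) else 1"
    let ?v = "\<lambda>(j::nat) x. if j = 0 then 1 else f (0, x)"
    have "f (x, y) = (\<Sum>j<2. ?u j x * ?v j y)" for x y
      using add[of "(x, 0)" "(0, y)"] by (simp add: eval_nat_numeral)
    moreover have "real_polynomial_function (?u j)" "real_polynomial_function (?v j)" for j
      using 1 2 by (cases "j = 0"; simp add: real_polynomial_function.intros(1,2))+
    ultimately show ?case by (intro exI[of _ 2] exI[of _ ?u] exI[of _ ?v]) blast
  next
    case (const c)
    show ?case
      by (intro exI[of _ 1] exI[of _ "\<lambda>_ _. c"] exI[of _ "\<lambda>_ _. 1"])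
         (auto intro: real_polynomial_function.intros)
  next
    case (add f g)
    then obtain n u v m u' v' where *:
      "\<And>j. real_polynomial_function (u j)" "\<And>j. real_polynomial_function (v j)"
      "\<And>j. real_polynomial_function (u' j)" "\<And>j. real_polynomial_function (v' j)"
      "\<And>x y. f (x, y) = (\<Sum>j<n::nat. u j x * v j y)"
      "\<And>x y. g (x, y) = (\<Sum>j<m::nat. u' j x * v' j y)"
      by blast
    let ?u = "\<lambda>j. if j < n then u j else u' (j - n)"
    let ?v = "\<lambda>j. if j < n then v j else v' (j - n)"
    have "(\<Sum>j<n+m. ?u j x * ?v j y) = f (x, y) + g (x, y)" for x y
    proof -
      have "(\<Sum>j<n+m. ?u j x * ?v j y) = (\<Sum>j<n. ?u j x * ?v j y) + (\<Sum>j\<in>{n..<n+m}. ?u j x * ?v j y)"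
        by (subst sum.union_disjoint[symmetric]) (auto intro: sum.cong)
      also have "(\<Sum>j\<in>{n..<n+m}. ?u j x * ?v j y) = (\<Sum>j<m. u' j x * v' j y)"
        by (rule sum.reindex_bij_witness[of _ "\<lambda>j. j + n" "\<lambda>j. j - n"]) auto
      finally show ?thesis using * by simp
    qed
    then show ?case
      using * by (intro exI[of _ "n + m"] exI[of _ ?u] exI[of _ ?v]) auto
  next
    case (mult f g)
    then obtain n u v m u' v' where *:
      "\<And>j. real_polynomial_function (u j)" "\<And>j. real_polynomial_function (v j)"
      "\<And>j. real_polynomial_function (u' j)" "\<And>j. real_polynomial_function (v' j)"
      "\<And>x y. f (x, y) = (\<Sum>j<n::nat. u j x * v j y)"
      "\<And>x y. g (x, y) = (\<Sum>j<m::nat. u' j x * v' j y)"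
      by blast
    \<comment> \<open>Remainder and quotient by \<open>n\<close> enumerate all pairs of indices as
      \<open>j\<close> runs below \<open>n * m\<close>.\<close>
    let ?u = "\<lambda>j x. u (j mod n) x * u' (j div n) x"
    let ?v = "\<lambda>j x. v (j mod n) x * v' (j div n) x"
    have "(\<Sum>j<n*m. ?u j x * ?v j y) = f (x, y) * g (x, y)" for x y
    proof -
      have "f (x, y) * g (x, y) = (\<Sum>(i, j)\<in>{..<n} \<times> {..<m}. (u i x * v i y) * (u' j x * v' j y))"
        by (simp add: * sum_product sum.cartesian_product)
      also have "\<dots> = (\<Sum>j<n*m. ?u j x * ?v j y)"
      proof (rule sum.reindex_bij_witness[of _ "\<lambda>j. (j mod n, j div n)" "\<lambda>(i, j). i + n * j"], goal_cases)
        case (2 a)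
        obtain i j where a: "a = (i, j)" by fastforce
        then have "i < n" "j < m" using 2 by auto
        have "i + n * j < n + n * j" using \<open>i < n\<close> by simp
        also have "\<dots> = n * Suc j" by simp
        also have "\<dots> \<le> n * m" using \<open>j < m\<close> by (intro mult_left_mono) auto
        finally show ?case using a by simp
      next
        case (4 b)
        then have "n > 0" by (cases n) auto
        then show ?case using 4 by (auto simp: less_mult_imp_div_less mult.commute)
      qed (auto simp: algebra_simps)
      finally show ?thesis by simp
    qed
    then show ?case
      using * by (intro exI[of _ "n * m"] exI[of _ ?u] exI[of _ ?v]) (auto intro: real_polynomial_function.intros)
  qed
  then show ?thesis by (metis finite_lessThan)
qed

text \<open>Lagrange interpolation on an arbitrary set \<open>B\<close> for the span of the
  \<open>v i\<close>. Nodes and basis polynomials do not depend on the coefficients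
  \<open>c\<close>, which is essential because in the application \<open>c\<close> varies with the
  position without any regularity. In the induction a new function is either already interpolated on
  \<open>B\<close> or supplies one new node.\<close>

lemma polynomial_interpolation:
  fixes v :: "'i \<Rightarrow> 'a::real_normed_vector \<Rightarrow> real"
  assumes "finite A" "\<And>i. i \<in> A \<Longrightarrow> real_polynomial_function (v i)"
  shows "\<exists>Y l. finite Y \<and> Y \<subseteq> B \<and> (\<forall>y. real_polynomial_function (l y)) \<and>
           (\<forall>c. \<forall>x\<in>B. (\<Sum>i\<in>A. c i * v i x) = (\<Sum>y\<in>Y. (\<Sum>i\<in>A. c i * v i y) * l y x))"
  using assms
proof (induction A rule: finite_induct)
  case empty
  show ?case
    by (intro exI[of _ "{}"] exI[of _ "\<lambda>_ _. 0"]) (auto intro: real_polynomial_function.intros)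
next
  case (insert a A)
  have "\<exists>Y l. finite Y \<and> Y \<subseteq> B \<and> (\<forall>y. real_polynomial_function (l y)) \<and>
           (\<forall>c. \<forall>x\<in>B. (\<Sum>i\<in>A. c i * v i x) = (\<Sum>y\<in>Y. (\<Sum>i\<in>A. c i * v i y) * l y x))"
    by (rule insert.IH) (simp add: insert.prems)
  then obtain Y l where Y: "finite Y" "Y \<subseteq> B" "\<forall>y. real_polynomial_function (l y)"
    and eq: "\<forall>c. \<forall>x\<in>B. (\<Sum>i\<in>A. c i * v i x) = (\<Sum>y\<in>Y. (\<Sum>i\<in>A. c i * v i y) * l y x)"
    by (elim exE conjE)
  \<comment> \<open>The interpolation defect of the new function; the defect of every combination is
    a multiple of it.\<close>
  define \<psi> where "\<psi> x = v a x - (\<Sum>y\<in>Y. v a y * l y x)" for x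
  have \<psi>: "real_polynomial_function \<psi>"
    unfolding \<psi>_def[abs_def] using Y insert.prems
    by (intro real_polynomial_function_diff real_polynomial_function_sum real_polynomial_function.intros(2,4)) auto
  have defect: "(\<Sum>i\<in>insert a A. c i * v i x) - (\<Sum>y\<in>Y. (\<Sum>i\<in>insert a A. c i * v i y) * l y x) = c a * \<psi> x"
    if "x \<in> B" for c x
    using eq[rule_format, OF that, of c] insert.hyps
    by (simp add: \<psi>_def algebra_simps sum.distrib sum_distrib_left)
  show ?case
  proof (cases "\<forall>x\<in>B. \<psi> x = 0")
    case True
    have "(\<Sum>i\<in>insert a A. c i * v i x) = (\<Sum>y\<in>Y. (\<Sum>i\<in>insert a A. c i * v i y) * l y x)"
      if x: "x \<in> B" for c x
      using defect[OF x, of c] unfolding bspec[OF True x] by (simp only: mult_zero_right right_minus_eq)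
    then show ?thesis
      using Y by (intro exI[of _ Y] exI[of _ l] conjI allI ballI) auto
  next
    case False
    then obtain z where z: "z \<in> B" "\<psi> z \<noteq> 0" by blast
    \<comment> \<open>The value at \<open>z\<close> determines the coefficient of the defect. The
      two contributions are added rather than separated by cases, so \<open>z\<close> may already
      belong to \<open>Y\<close>.\<close>
    define l' where "l' y x = (if y \<in> Y then l y x - \<psi> x / \<psi> z * l y z else 0) + (if y = z then \<psi> x / \<psi> z else 0)" for y x
    have l': "real_polynomial_function (l' y)" for y
    proof -
      have 1: "real_polynomial_function (\<lambda>x. \<psi> x / \<psi> z)"
        using real_polynomial_function.intros(4)[OF \<psi> real_polynomial_function.intros(2)[of "1 / \<psi> z"]] by simp
      have 2: "real_polynomial_function (\<lambda>x. l y x - \<psi> x / \<psi> z * l y z)"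
        using Y by (intro real_polynomial_function_diff real_polynomial_function.intros(4)[OF 1 real_polynomial_function.intros(2)]) simp
      have "real_polynomial_function (\<lambda>x. if y \<in> Y then l y x - \<psi> x / \<psi> z * l y z else 0)"
        by (cases "y \<in> Y") (simp_all only: if_True if_False 2 real_polynomial_function.intros(2))
      moreover have "real_polynomial_function (\<lambda>x. if y = z then \<psi> x / \<psi> z else 0)"
        by (cases "y = z") (simp_all only: refl if_True if_False 1 real_polynomial_function.intros(2))
      ultimately show ?thesis
        unfolding l'_def[abs_def] by (rule real_polynomial_function.intros(3))
    qed
    have "(\<Sum>i\<in>insert a A. c i * v i x) = (\<Sum>y\<in>insert z Y. (\<Sum>i\<in>insert a A. c i * v i y) * l' y x)"
      if x: "x \<in> B" for c x
    proof -
      define g where "g x = (\<Sum>i\<in>insert a A. c i * v i x)" for x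
      have "c a = (g z - (\<Sum>y\<in>Y. g y * l y z)) / \<psi> z"
        using defect[OF z(1), of c] z(2) by (simp add: g_def)
      then have gx: "g x = (\<Sum>y\<in>Y. g y * l y x) + (g z - (\<Sum>y\<in>Y. g y * l y z)) / \<psi> z * \<psi> x"
        using defect[OF x, of c] by (simp add: g_def)
      have 1: "(\<Sum>y\<in>insert z Y. g y * (if y \<in> Y then l y x - \<psi> x / \<psi> z * l y z else 0)) = (\<Sum>y\<in>Y. g y * (l y x - \<psi> x / \<psi> z * l y z))"
        by (rule sum.mono_neutral_cong_right) (use Y in auto)
      have 2: "(\<Sum>y\<in>insert z Y. g y * (if y = z then \<psi> x / \<psi> z else 0)) = g z * (\<psi> x / \<psi> z)"
        using Y by (simp add: if_distrib[of "\<lambda>t. _ * t"] cong: if_cong)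
      have "(\<Sum>y\<in>insert z Y. g y * l' y x) = (\<Sum>y\<in>Y. g y * (l y x - \<psi> x / \<psi> z * l y z)) + g z * (\<psi> x / \<psi> z)"
        unfolding l'_def distrib_left sum.distrib 1 2 ..
      also have "\<dots> = g x"
        unfolding gx by (simp add: algebra_simps sum_subtractf sum_distrib_left diff_divide_distrib sum_divide_distrib)
      finally show ?thesis unfolding g_def ..
    qed
    then show ?thesis
      using Y z l' by (intro exI[of _ "insert z Y"] exI[of _ l'] conjI allI ballI) (auto simp only: finite_insert insert_subset)
  qed
qed

section \<open>From separate to joint polynomial dependence\<close>

lemmas polynomial_intros =
  real_polynomial_function_sum real_polynomial_function_diff
  real_polynomial_function.intros(2-4) polynomial_function_Pair polynomial_function_add
  polynomial_function_diff polynomial_function_mult polynomial_function_const polynomial_function_id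
  polynomial_function_bounded_linear[OF bounded_linear_fst]
  polynomial_function_bounded_linear[OF bounded_linear_snd]

lemma monomial_polynomial: "real_polynomial_function (monomial \<alpha> :: real ^ 'd ^ 'n \<Rightarrow> real)"
  unfolding monomial_def[abs_def]
  by (intro real_polynomial_function_prod real_polynomial_function_power real_polynomial_function.intros(1)
      bounded_linear_compose[OF bounded_linear_vec_nth] bounded_linear_vec_nth) auto

(* The values f x (y - x) = f y (y - x) depend polynomially on y for fixed x and on x for fixed y,
   with a uniform degree bound, so by interpolation they are jointly polynomial in (x, y). *)
lemma first_integral_locally_polynomial:
  fixes f :: "'v::euclidean_space \<Rightarrow> 'v \<Rightarrow> real" and a :: "'i \<Rightarrow> 'v \<Rightarrow> real"
  assumes e: "e > 0" and A: "finite A" and m: "\<And>\<alpha>. real_polynomial_function (m \<alpha>)"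
    and f: "\<And>q p. q \<in> ball q0 e \<Longrightarrow> f q p = (\<Sum>\<alpha>\<in>A. a \<alpha> q * m \<alpha> p)"
    and free: "\<And>q p. closed_segment q (q + p) \<subseteq> ball q0 e \<Longrightarrow> f (q + p) p = f q p"
  shows "\<exists>G. real_polynomial_function G \<and> (\<forall>q\<in>ball q0 e. \<forall>p. f q p = G (q, p))"
proof -
  let ?B = "ball q0 e"
  have swap: "f x (y - x) = f y (y - x)" if "x \<in> ?B" "y \<in> ?B" for x y
    using free[of x "y - x"] that by (simp add: closed_segment_subset convex_ball)
  have "\<exists>(J :: nat set) u v. finite J \<and>
           (\<forall>j. real_polynomial_function (u j)) \<and> (\<forall>j. real_polynomial_function (v j)) \<and>
           (\<forall>x y. m \<alpha> (y - x) = (\<Sum>j\<in>J. u j x * v j y))" for \<alpha>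
  proof -
    have "real_polynomial_function (\<lambda>z :: 'v \<times> 'v. m \<alpha> (snd z - fst z))"
      by (intro polynomial_intros real_polynomial_function_subst[OF m])
    from real_polynomial_function_times_decomposition[OF this] show ?thesis by simp
  qed
  then obtain J :: "'i \<Rightarrow> nat set" and u v where J: "\<And>\<alpha>. finite (J \<alpha>)"
    and v: "\<And>\<alpha> j. real_polynomial_function (v \<alpha> j)"
    and muv: "\<And>\<alpha> x y. m \<alpha> (y - x) = (\<Sum>j\<in>J \<alpha>. u \<alpha> j x * v \<alpha> j y)"
    by metis
  have "\<exists>Y l. finite Y \<and> Y \<subseteq> ?B \<and> (\<forall>y. real_polynomial_function (l y)) \<and>
       (\<forall>c. \<forall>x\<in>?B. (\<Sum>i\<in>Sigma A J. c i * v (fst i) (snd i) x) =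
         (\<Sum>y\<in>Y. (\<Sum>i\<in>Sigma A J. c i * v (fst i) (snd i) y) * l y x))"
    by (rule polynomial_interpolation) (use A J v in auto)
  then obtain Y l where Y: "finite Y" "Y \<subseteq> ?B" and l: "\<forall>y. real_polynomial_function (l y)"
    and interp: "\<forall>c. \<forall>x\<in>?B. (\<Sum>i\<in>Sigma A J. c i * v (fst i) (snd i) x) =
         (\<Sum>y\<in>Y. (\<Sum>i\<in>Sigma A J. c i * v (fst i) (snd i) y) * l y x)"
    by (elim exE conjE)
  have f_sum: "f x (y - x) = (\<Sum>i\<in>Sigma A J. (a (fst i) x * u (fst i) (snd i) x) * v (fst i) (snd i) y)"
    if "x \<in> ?B" for x y
  proof -
    have "f x (y - x) = (\<Sum>\<alpha>\<in>A. \<Sum>j\<in>J \<alpha>. (a \<alpha> x * u \<alpha> j x) * v \<alpha> j y)"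
      using that by (simp add: f muv sum_distrib_left mult.assoc)
    also have "\<dots> = (\<Sum>i\<in>Sigma A J. (a (fst i) x * u (fst i) (snd i) x) * v (fst i) (snd i) y)"
      using A J by (simp add: sum.Sigma case_prod_unfold)
    finally show ?thesis .
  qed
  \<comment> \<open>Interpolation in the endpoint followed by the exchange of the two points moves
    the irregular coefficients to the finitely many nodes, where they are constants.\<close>
  define G where "G z = (\<Sum>y\<in>Y. (\<Sum>\<alpha>\<in>A. a \<alpha> y * m \<alpha> (y - fst z)) * l y (fst z + snd z))" for z :: "'v \<times> 'v"
  have G: "real_polynomial_function G"
    unfolding G_def[abs_def] by (intro polynomial_intros real_polynomial_function_subst[OF m] real_polynomial_function_subst[OF l[rule_format]] A Y)
  have near: "G (q, p) = f q p" if "q \<in> ?B" "q + p \<in> ?B" for q p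
  proof -
    have "f q p = f q ((q + p) - q)" by simp
    also have "\<dots> = (\<Sum>y\<in>Y. f q (y - q) * l y (q + p))"
      unfolding f_sum[OF that(1)] by (rule interp[rule_format, OF that(2)])
    also have "\<dots> = G (q, p)"
      unfolding G_def fst_conv snd_conv
    proof (rule sum.cong[OF refl])
      fix y assume "y \<in> Y"
      then have "y \<in> ?B" using Y by blast
      then show "f q (y - q) * l y (q + p) = (\<Sum>\<alpha>\<in>A. a \<alpha> y * m \<alpha> (y - q)) * l y (q + p)"
        using swap[OF that(1)] f by simp
    qed
    finally show ?thesis by simp
  qed
  \<comment> \<open>So far \<open>q + p\<close> has to lie in the ball; for fixed \<open>q\<close>
    both sides are polynomials in \<open>p\<close>, which lifts this restriction.\<close>
  have "f q p = G (q, p)" if q: "q \<in> ?B" for q p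
  proof -
    have "real_polynomial_function (\<lambda>p. (\<Sum>\<alpha>\<in>A. a \<alpha> q * m \<alpha> p) - G (q, p))"
      by (intro polynomial_intros real_polynomial_function_subst[OF m] real_polynomial_function_subst[OF G] A m)
    moreover have "(\<Sum>\<alpha>\<in>A. a \<alpha> q * m \<alpha> p) - G (q, p) = 0" if "p \<in> ball 0 (e - dist q0 q)" for p
    proof -
      have "dist q0 (q + p) \<le> dist q0 q + dist q (q + p)" by (rule dist_triangle)
      then have "q + p \<in> ?B" using that by (simp add: dist_norm)
      then show ?thesis using near f q by simp
    qed
    ultimately have "(\<Sum>\<alpha>\<in>A. a \<alpha> q * m \<alpha> p) - G (q, p) = 0"
      using polynomial_zero_ball[of "\<lambda>p. (\<Sum>\<alpha>\<in>A. a \<alpha> q * m \<alpha> p) - G (q, p)" "e - dist q0 q" 0 p] q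
      by (metis diff_gt_0_iff_gt mem_ball)
    then show ?thesis using f q by simp
  qed
  then show ?thesis using G by blast
qed

text \<open>Two polynomials representing \<open>f\<close> near the same position agree on an open
  set of phase space, hence everywhere. The representing polynomial is therefore locally constant in
  the position, and connectedness makes it a single one.\<close>

lemma first_integral_polynomial:
  fixes \<Omega> :: "(real ^ 'd ^ 'n) set"
  assumes \<Omega>: "open \<Omega>" "connected \<Omega>" "\<Omega> \<noteq> {}"
    and "first_integral \<rho> L \<Omega> f" "polynomial_in_momentum \<Omega> f"
  obtains G where "real_polynomial_function G" "\<And>q p. q \<in> \<Omega> \<Longrightarrow> f q p = G (q, p)"
    "\<And>q p t. G (q + t *\<^sub>R p, p) = G (q, p)"
proof -
  obtain r and a :: "nat ^ 'd ^ 'n \<Rightarrow> real ^ 'd ^ 'n \<Rightarrow> real"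
    where f: "\<And>q p. q \<in> \<Omega> \<Longrightarrow> f q p = (\<Sum>\<alpha>\<in>multi_indices r. a \<alpha> q * monomial \<alpha> p)"
    using assms(5) unfolding polynomial_in_momentum_def by blast
  have free: "f (q + t *\<^sub>R p) p = f q p" if "closed_segment q (q + t *\<^sub>R p) \<subseteq> \<Omega>" for q t p
    using assms(4) that unfolding first_integral_def by blast
  define P where "P q G \<longleftrightarrow> real_polynomial_function G \<and> (\<exists>e>0. \<forall>q'\<in>ball q e. \<forall>p. f q' p = G (q', p))" for q G
  have P_ex: "\<exists>G. P q G" if q: "q \<in> \<Omega>" for q
  proof -
    obtain e where e: "e > 0" "ball q e \<subseteq> \<Omega>"
      using \<open>open \<Omega>\<close> q by (meson open_contains_ball)
    have "\<exists>G. real_polynomial_function G \<and> (\<forall>q'\<in>ball q e. \<forall>p. f q' p = G (q', p))"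
    proof (rule first_integral_locally_polynomial[OF e(1) finite_multi_indices monomial_polynomial])
      show "f q' p = (\<Sum>\<alpha>\<in>multi_indices r. a \<alpha> q' * monomial \<alpha> p)" if "q' \<in> ball q e" for q' p
        using f e that by blast
      show "f (q' + p) p = f q' p" if "closed_segment q' (q' + p) \<subseteq> ball q e" for q' p
        using free[of q' 1 p] e that by auto
    qed
    then show ?thesis using e by (auto simp: P_def)
  qed
  have P_unique: "G = H" if PG: "P q G" and PH: "P q H" for q G H
  proof -
    obtain e where e: "e > 0" "\<And>q' p. q' \<in> ball q e \<Longrightarrow> G (q', p) = H (q', p)"
    proof -
      obtain e1 e2 where "e1 > 0" "e2 > 0" "\<forall>q'\<in>ball q e1. \<forall>p. f q' p = G (q', p)"
         "\<forall>q'\<in>ball q e2. \<forall>p. f q' p = H (q', p)"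
        using PG PH unfolding P_def by blast
      note e12 = this
      show thesis
      proof (rule that[of "min e1 e2"])
        fix q' p assume "q' \<in> ball q (min e1 e2)"
        then have "q' \<in> ball q e1" "q' \<in> ball q e2" by auto
        then show "G (q', p) = H (q', p)" using e12(3,4) by metis
      qed (use e12 in simp)
    qed
    have "G z - H z = 0" for z
    proof (rule polynomial_zero_ball[OF _ e(1), where a = "(q, 0 :: real ^ 'd ^ 'n)"])
      show "real_polynomial_function (\<lambda>z. G z - H z)"
        using PG PH unfolding P_def by (intro polynomial_intros) auto
      fix z assume "z \<in> ball (q, 0 :: real ^ 'd ^ 'n) e"
      then have "fst z \<in> ball q e"
        using dist_fst_le[of "(q, 0)" z] by auto
      then show "G z - H z = 0" using e(2)[of "fst z" "snd z"] by simp
    qed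
    then show ?thesis by auto
  qed
  define g where "g q = (SOME G. P q G)" for q
  have g: "P q (g q)" if "q \<in> \<Omega>" for q
    using P_ex[OF that] unfolding g_def by (rule someI_ex)
  have g_const: "g q = g q'" if "q \<in> \<Omega>" "q' \<in> \<Omega>" for q q'
  proof (rule connected_local_const[OF \<open>connected \<Omega>\<close> that], rule ballI)
    fix x assume x: "x \<in> \<Omega>"
    obtain e where e: "e > 0" "\<forall>q'\<in>ball x e. \<forall>p. f q' p = g x (q', p)" and gx: "real_polynomial_function (g x)"
      using g[OF x] unfolding P_def by blast
    have "g x = g y" if y: "y \<in> \<Omega>" "y \<in> ball x e" for y
    proof (rule P_unique)
      have "\<exists>e'>0. ball y e' \<subseteq> ball x e" using y(2) open_ball open_contains_ball by blast
      then show "P y (g x)" using e gx unfolding P_def by (meson subsetD)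
      show "P y (g y)" using g y by blast
    qed
    then show "\<forall>\<^sub>F y in at x within \<Omega>. g x = g y"
      using e(1) by (auto simp: eventually_at dist_commute)
  qed
  obtain q0 where q0: "q0 \<in> \<Omega>" using \<Omega> by blast
  define G where "G = g q0"
  have G: "real_polynomial_function G" using g[OF q0] by (simp add: G_def P_def)
  have fG: "f q p = G (q, p)" if "q \<in> \<Omega>" for q p
  proof -
    have "P q G" using g[OF that] g_const[OF that q0] by (simp add: G_def)
    then show ?thesis unfolding P_def using centre_in_ball by blast
  qed
  \<comment> \<open>Short segments in a ball give the identity for small \<open>t\<close>; it is
    extended in \<open>t\<close> and then in \<open>q\<close>.\<close>
  have "G (q + t *\<^sub>R p, p) = G (q, p)" for q p t
  proof -
    obtain e where e: "e > 0" "ball q0 e \<subseteq> \<Omega>"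
      using \<Omega> q0 by (meson open_contains_ball)
    have near: "G (q + t *\<^sub>R p, p) = G (q, p)" if q: "q \<in> ball q0 e" "q + t *\<^sub>R p \<in> ball q0 e" for q t
    proof -
      have "closed_segment q (q + t *\<^sub>R p) \<subseteq> \<Omega>"
        using e(2) q by (meson closed_segment_subset convex_ball subset_trans)
      then have "f (q + t *\<^sub>R p) p = f q p" by (rule free)
      then show ?thesis using fG q e(2) by (metis subsetD)
    qed
    have 1: "G (q + t *\<^sub>R p, p) - G (q, p) = 0" if "q \<in> ball q0 e" for q t
    proof -
      let ?d = "(e - dist q0 q) / (norm p + 1)"
      have pos: "norm p + 1 > 0" by (simp add: add_nonneg_pos)
      have "real_polynomial_function (\<lambda>t. G (q + t *\<^sub>R p, p) - G (q, p))"
        by (intro polynomial_intros real_polynomial_function_subst[OF G])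
      moreover have "?d > 0" using that pos by simp
      moreover have "G (q + t *\<^sub>R p, p) - G (q, p) = 0" if t: "t \<in> ball 0 ?d" for t
      proof -
        have "\<bar>t\<bar> * norm p \<le> \<bar>t\<bar> * (norm p + 1)" by (simp add: mult_left_mono)
        also have "\<dots> < e - dist q0 q" using t pos by (simp add: field_simps)
        finally have "dist q0 (q + t *\<^sub>R p) < e"
          using dist_triangle[of q0 "q + t *\<^sub>R p" q] by (simp add: dist_norm)
        then show ?thesis using near \<open>q \<in> ball q0 e\<close> by simp
      qed
      ultimately show ?thesis by (rule polynomial_zero_ball)
    qed
    have "real_polynomial_function (\<lambda>q. G (q + t *\<^sub>R p, p) - G (q, p))"
      by (intro polynomial_intros real_polynomial_function_subst[OF G])
    from polynomial_zero_ball[OF this e(1) 1] have "G (q + t *\<^sub>R p, p) - G (q, p) = 0" .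
    then show ?thesis by simp
  qed
  with G fG show thesis by (rule that)
qed

section \<open>Invariance at the boundary\<close>

text \<open>Opposite displacements of two balls: the mass centre of the pair is fixed and the
  relative coordinate is \<open>2 x\<close>, the source of the factors 1/2 and 2 below. For a unit
  vector it is the normal direction of the contact cylinder.\<close>

definition relative :: "'n::finite \<Rightarrow> 'n \<Rightarrow> real ^ 'd \<Rightarrow> real ^ 'd ^ 'n" where
  "relative i j x = axis i x - axis j x"

lemma relative_nth: "relative i j x $ a = (if a = i then x else 0) - (if a = j then x else 0)"
  by (simp add: relative_def axis_def)

lemma inner_relative: "v \<bullet> relative i j x = (v $ i - v $ j) \<bullet> x"
  by (simp add: relative_def inner_diff_right inner_axis inner_diff_left)

lemma linear_relative: "linear (relative i j :: real ^ 'd \<Rightarrow> real ^ 'd ^ 'n::finite)"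
  by (rule linearI) (auto simp: relative_nth vec_eq_iff)

lemmas relative_simps = linear_add[OF linear_relative] linear_diff[OF linear_relative]
  linear_cmul[OF linear_relative] linear_neg[OF linear_relative] linear_0[OF linear_relative]

lemma norm_axis: "norm (axis i x :: 'a::real_inner ^ 'n::finite) = norm x"
  by (simp add: norm_eq_sqrt_inner inner_axis_axis)

lemma norm_relative_le: "norm (relative i j x) \<le> 2 * norm x"
  using norm_triangle_ineq4[of "axis i x" "axis j x"] by (simp add: relative_def norm_axis)

lemma wall_reflect_eq:
  "wall_reflect i (wall_normal k) p = p - (2 * p $ i $ k) *\<^sub>R axis i (axis k 1)"
  by (simp add: wall_reflect_def wall_normal_def vec_eq_iff inner_axis) (simp add: axis_def)

lemma pair_reflect_eq:
  "i \<noteq> j \<Longrightarrow> pair_reflect i j n p = p - ((p $ i - p $ j) \<bullet> n) *\<^sub>R relative i j n"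
  by (auto simp: pair_reflect_def vec_eq_iff relative_nth)

lemma open_Collect_all_finite:
  "(\<And>a::'a::finite. open {x. P a x}) \<Longrightarrow> open {x. \<forall>a. P a x}"
  by (simp add: Collect_all_eq open_INT)

lemma open_config_space: "open (config_space \<rho> L)"
proof -
  have eq: "config_space \<rho> L = {q. (\<forall>i k. \<rho> < q $ i $ k \<and> q $ i $ k < L $ k - \<rho>) \<and>
      (\<forall>i j. i \<noteq> j \<longrightarrow> 2 * \<rho> < norm (q $ i - q $ j))}"
    by (auto simp: config_space_def center_box_def)
  show ?thesis
    unfolding eq by (intro open_Collect_conj open_Collect_all_finite open_Collect_imp open_Collect_less
        closed_Collect_const continuous_intros)
qed

text \<open>The integral \<open>f\<close> is kept beside its extension: the collision law speaks of
  \<open>f\<close> on trajectories in \<Omega>, whereas \<open>G\<close> can be evaluated on the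
  boundary and at overlapping balls.\<close>

locale polynomial_first_integral =
  fixes \<rho> :: real and L :: "real ^ 'd" and \<Omega> :: "(real ^ 'd ^ 'n) set" and f
    and G :: "(real ^ 'd ^ 'n) \<times> (real ^ 'd ^ 'n) \<Rightarrow> real"
  assumes component: "\<Omega> \<in> components (config_space \<rho> L)"
    and first_integral: "first_integral \<rho> L \<Omega> f"
    and G: "real_polynomial_function G"
    and f_eq: "q \<in> \<Omega> \<Longrightarrow> f q p = G (q, p)"
    and free: "G (q + t *\<^sub>R p, p) = G (q, p)"
    and \<rho>: "\<rho> > 0" and d: "CARD('d) \<ge> 2"
begin

lemma subset_component:
  assumes "connected C" "C \<subseteq> config_space \<rho> L" "x \<in> C" "x \<in> \<Omega>"
  shows "C \<subseteq> \<Omega>"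
  using components_maximal[OF component assms(1,2)] assms(3,4) by blast

text \<open>Short flights into and out of \<open>z\<close> stay in the half ball and form a
  trajectory to which the collision law applies. Invariance of \<open>G\<close> under free motion
  then shrinks both flights to the boundary point itself.\<close>

lemma collision_invariance:
  assumes \<delta>: "\<delta> > 0" and half: "\<And>y. y \<in> ball z \<delta> \<Longrightarrow> (y - z) \<bullet> \<nu> > 0 \<Longrightarrow> y \<in> \<Omega>"
    and p: "p \<bullet> \<nu> < 0" "p' \<bullet> \<nu> > 0"
    and coll: "z \<in> closure \<Omega> \<Longrightarrow> regular_collision \<rho> L \<Omega> z p p'"
  shows "G (z, p') = G (z, p)"
proof -
  define t where "t = \<delta> / (norm p + norm p' + 1)"
  have pos: "norm p + norm p' + 1 > 0" by (simp add: add_nonneg_pos)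
  have t: "t > 0" using \<delta> pos by (simp add: t_def)
  have eq: "t * (norm p + norm p' + 1) = \<delta>" using pos by (simp add: t_def)
  have tp: "t * norm p < \<delta>" "t * norm p' < \<delta>"
  proof -
    have "t * norm p < t * (norm p + norm p' + 1)" "t * norm p' < t * (norm p + norm p' + 1)"
      using t by (auto intro!: mult_strict_left_mono add_nonneg_pos)
    then show "t * norm p < \<delta>" "t * norm p' < \<delta>" using eq by auto
  qed
  have before: "z - s *\<^sub>R p \<in> \<Omega>" if "0 < s" "s \<le> t" for s
  proof (rule half)
    have "s * norm p \<le> t * norm p" using that by (intro mult_right_mono) auto
    then show "z - s *\<^sub>R p \<in> ball z \<delta>" using tp that by (simp add: dist_norm)
    show "(z - s *\<^sub>R p - z) \<bullet> \<nu> > 0" using that p by (simp add: mult_pos_neg)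
  qed
  have after: "z + s *\<^sub>R p' \<in> \<Omega>" if "0 < s" "s \<le> t" for s
  proof (rule half)
    have "s * norm p' \<le> t * norm p'" using that by (intro mult_right_mono) auto
    then show "z + s *\<^sub>R p' \<in> ball z \<delta>" using tp that by (simp add: dist_norm)
    show "(z + s *\<^sub>R p' - z) \<bullet> \<nu> > 0" using that p by simp
  qed
  have "((\<lambda>s. z - s *\<^sub>R p) \<longlongrightarrow> z - 0 *\<^sub>R p) (at_right 0)"
    by (intro tendsto_intros)
  moreover have "\<forall>\<^sub>F s in at_right 0. z - s *\<^sub>R p \<in> \<Omega>"
    using eventually_at_right_real[OF t] by eventually_elim (use before in auto)
  ultimately have "z \<in> closure \<Omega>"
    by (intro Lim_in_closed_set[OF closed_closure, of "\<lambda>s. z - s *\<^sub>R p" _ "at_right 0"])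
       (auto elim: eventually_mono intro: closure_subset[THEN subsetD])
  then have r: "regular_collision \<rho> L \<Omega> z p p'" by (rule coll)
  have "z - t *\<^sub>R p + s *\<^sub>R p \<in> \<Omega>" if "0 \<le> s" "s < t" for s
    using before[of "t - s"] that by (simp add: algebra_simps)
  then have "f (z + t *\<^sub>R p') p' = f (z - t *\<^sub>R p) p"
    using first_integral r t after unfolding first_integral_def
    by (metis (no_types, lifting) diff_add_cancel)
  then have "G (z + t *\<^sub>R p', p') = G (z - t *\<^sub>R p, p)"
    using f_eq before after t by simp
  then show ?thesis
    using free[of z t p'] free[of z "- t" p] by simp
qed

text \<open>The collision law covers incoming momenta. An outgoing \<open>p\<close> is the image of
  the incoming \<open>R p\<close> since \<open>R\<close> is an involution, and tangential momenta
  are fixed.\<close>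

lemma reflection_invariance:
  assumes \<delta>: "\<delta> > 0" and half: "\<And>y. y \<in> ball z \<delta> \<Longrightarrow> (y - z) \<bullet> \<nu> > 0 \<Longrightarrow> y \<in> \<Omega>"
    and R: "R (R p) = p" "R p \<bullet> \<nu> = - (p \<bullet> \<nu>)" "p \<bullet> \<nu> = 0 \<Longrightarrow> R p = p"
    and coll: "\<And>p. z \<in> closure \<Omega> \<Longrightarrow> p \<bullet> \<nu> \<noteq> 0 \<Longrightarrow> regular_collision \<rho> L \<Omega> z p (R p)"
  shows "G (z, R p) = G (z, p)"
proof (cases "p \<bullet> \<nu>" "0::real" rule: linorder_cases)
  case less
  then show ?thesis
    using R coll[of p] by (intro collision_invariance[OF \<delta> half]) auto
next
  case equal
  then show ?thesis using R by simp
next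
  case greater
  then have "G (z, R (R p)) = G (z, R p)"
    using R coll[of "R p"] by (intro collision_invariance[OF \<delta> half]) auto
  then show ?thesis using R by simp
qed

(* Push the whole configuration in direction k until its unique rightmost ball hits the wall. *)
lemma wall_invariance:
  obtains i c where "\<And>z p. z $ i $ k = c \<Longrightarrow> G (z, p - (2 * p $ i $ k) *\<^sub>R axis i (axis k 1)) = G (z, p)"
proof -
  have \<Omega>: "\<Omega> \<subseteq> config_space \<rho> L" "open \<Omega>" "\<Omega> \<noteq> {}"
    using component open_config_space in_components_subset open_components in_components_nonempty by blast+
  then obtain q0 where q0: "q0 \<in> \<Omega>" by blast
  obtain i where i: "\<And>a. q0 $ a $ k \<le> q0 $ i $ k"
  proof -
    have "Max (range (\<lambda>a. q0 $ a $ k)) \<in> range (\<lambda>a. q0 $ a $ k)" by (intro Max_in) auto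
    then obtain i where "Max (range (\<lambda>a. q0 $ a $ k)) = q0 $ i $ k" by blast
    then show thesis by (metis Max_ge finite finite_imageI rangeI that)
  qed
  let ?e = "axis i (axis k 1) :: real ^ 'd ^ 'n"
  have e_nth: "?e $ a $ l = (if a = i \<and> l = k then 1 else 0)" for a l
    by (simp add: axis_def)
  have inner_e: "v \<bullet> ?e = v $ i $ k" for v
    by (simp add: inner_axis)
  have norm_e: "norm ?e = 1" by (simp add: norm_axis)
  obtain \<epsilon> where \<epsilon>: "\<epsilon> > 0" "ball q0 \<epsilon> \<subseteq> \<Omega>" using \<Omega> q0 by (meson open_contains_ball)
  \<comment> \<open>Several balls may share the largest coordinate; the extra move makes ball
    \<open>i\<close> the only one in front.\<close>
  define q where "q = q0 + (\<epsilon> / 2) *\<^sub>R ?e"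
  have q: "q \<in> \<Omega>" using \<epsilon> norm_e by (intro subsetD[OF \<epsilon>(2)]) (auto simp: q_def dist_norm)
  have qi: "q $ a $ k < q $ i $ k" if "a \<noteq> i" for a
    using i[of a] that \<epsilon> by (simp add: q_def e_nth)
  have q_conf: "\<rho> < q $ a $ l" "q $ a $ l < L $ l - \<rho>" "a \<noteq> b \<Longrightarrow> 2 * \<rho> < norm (q $ a - q $ b)" for a b l
    using \<Omega> q unfolding config_space_def center_box_def by auto
  \<comment> \<open>A common translation keeps all differences of positions, so balls cannot
    collide, and ball \<open>i\<close> alone reaches the wall at time \<open>T\<close>.\<close>
  define E :: "real ^ 'd ^ 'n" where "E = (\<chi> a. axis k 1)"
  have E_nth: "E $ a $ l = (if l = k then 1 else 0)" "E $ a - E $ b = 0" for a b l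
    by (simp_all add: E_def axis_def)
  define T where "T = L $ k - \<rho> - q $ i $ k"
  have T: "T > 0" using q_conf by (simp add: T_def)
  define z0 where "z0 = q + T *\<^sub>R E"
  have qt: "q + t *\<^sub>R E \<in> config_space \<rho> L" if "t \<ge> 0" "t < T" for t
  proof -
    have "q $ a $ k \<le> q $ i $ k" for a using qi[of a] by (cases "a = i") auto
    then have "q $ a $ k + t < L $ k - \<rho>" for a
      using that unfolding T_def by (smt (verit))
    moreover have "\<rho> < q $ a $ k + t" for a using q_conf(1)[of a k] that by simp
    moreover have "(q + t *\<^sub>R E) $ a - (q + t *\<^sub>R E) $ b = q $ a - q $ b" for a b
      using E_nth(2)[of a b] by (simp add: E_def)
    ultimately show ?thesis
      unfolding config_space_def center_box_def mem_Collect_eq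
      by (intro conjI allI impI) (use q_conf in \<open>simp_all add: E_nth del: vector_add_component\<close>, (simp_all add: E_nth q_conf)?)
  qed
  have "(\<lambda>t. q + t *\<^sub>R E) ` {0..<T} \<subseteq> \<Omega>"
  proof (rule subset_component)
    show "connected ((\<lambda>t. q + t *\<^sub>R E) ` {0..<T})"
      by (intro connected_continuous_image continuous_intros) auto
    show "q \<in> (\<lambda>t. q + t *\<^sub>R E) ` {0..<T}" using T by (intro image_eqI[of _ _ 0]) auto
  qed (use qt q in auto)
  then have in_\<Omega>: "q + t *\<^sub>R E \<in> \<Omega>" if "t \<ge> 0" "t < T" for t
    using that by (simp add: image_subset_iff)
  \<comment> \<open>All conditions of the configuration space except the upper bound that is about
    to become an equality.\<close>
  define U where "U = {y :: real ^ 'd ^ 'n. (\<forall>a l. (a, l) \<noteq> (i, k) \<longrightarrow> \<rho> < y $ a $ l \<and> y $ a $ l < L $ l - \<rho>) \<and>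
     \<rho> < y $ i $ k \<and> (\<forall>a b. a \<noteq> b \<longrightarrow> 2 * \<rho> < norm (y $ a - y $ b))}"
  have "open U" unfolding U_def
    by (intro open_Collect_conj open_Collect_all_finite open_Collect_imp open_Collect_less
        closed_Collect_const continuous_intros)
  have "z0 \<in> U"
  proof -
    have "q $ a $ k + T < L $ k - \<rho>" if "a \<noteq> i" for a using qi[OF that] by (simp add: T_def)
    moreover have "\<rho> < q $ a $ k + T" for a using q_conf(1)[of a k] T by simp
    moreover have "2 * \<rho> < norm (z0 $ a - z0 $ b)" if "a \<noteq> b" for a b
    proof -
      have "z0 $ a - z0 $ b = q $ a - q $ b" by (simp add: E_def z0_def)
      then show ?thesis using q_conf(3)[OF that] by simp
    qed
    ultimately show ?thesis
      using q_conf(1,2) unfolding U_def mem_Collect_eq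
      by (intro conjI allI impI) (assumption | auto simp: z0_def E_nth)+
  qed
  then obtain \<delta> where \<delta>: "\<delta> > 0" "ball z0 \<delta> \<subseteq> U" using \<open>open U\<close> by (meson open_contains_ball)
  \<comment> \<open>The half ball in front of the wall is convex, hence connected, so one late point
    of the push places all of it in \<Omega>.\<close>
  define H where "H = ball z0 \<delta> \<inter> {y. y $ i $ k < L $ k - \<rho>}"
  have "H \<subseteq> config_space \<rho> L"
    using \<delta>(2) unfolding H_def U_def config_space_def center_box_def by fast
  have "convex H"
  proof -
    have "{y. y $ i $ k < L $ k - \<rho>} = {y. ?e \<bullet> y < L $ k - \<rho>}"
      by (simp add: inner_e inner_commute[of ?e])
    then show ?thesis unfolding H_def by (simp add: convex_Int convex_halfspace_lt)
  qed
  obtain t where t: "0 \<le> t" "t < T" "(T - t) * norm E < \<delta>"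
  proof -
    let ?s = "min T (\<delta> / (norm E + 1))"
    have pos: "norm E + 1 > 0" by (simp add: add_nonneg_pos)
    then have s: "?s > 0" "?s \<le> T" using \<delta> T by auto
    have "?s * norm E < ?s * (norm E + 1)" using s by simp
    also have "\<dots> \<le> \<delta> / (norm E + 1) * (norm E + 1)" using pos by (intro mult_right_mono) auto
    also have "\<dots> = \<delta>" using pos by simp
    finally show thesis using s by (intro that[of "T - ?s"]) auto
  qed
  have "q + t *\<^sub>R E \<in> H"
  proof -
    have "z0 - (q + t *\<^sub>R E) = (T - t) *\<^sub>R E" by (simp add: z0_def algebra_simps)
    then have "dist z0 (q + t *\<^sub>R E) < \<delta>" using t by (simp add: dist_norm)
    moreover have "(q + t *\<^sub>R E) $ i $ k < L $ k - \<rho>" using t by (simp add: E_nth T_def)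
    ultimately show ?thesis by (simp add: H_def)
  qed
  then have H: "H \<subseteq> \<Omega>"
    using subset_component[OF convex_connected[OF \<open>convex H\<close>] \<open>H \<subseteq> config_space \<rho> L\<close>] in_\<Omega> t by blast
  let ?R = "\<lambda>p. p - (2 * p $ i $ k) *\<^sub>R ?e"
  have z0_ik: "z0 $ i $ k = L $ k - \<rho>" by (simp add: z0_def E_nth T_def)
  have local: "G (z, ?R p) = G (z, p)" if z: "z \<in> ball z0 \<delta>" "z $ i $ k = L $ k - \<rho>" for z p
  proof (rule reflection_invariance[where \<delta> = "\<delta> - dist z0 z" and \<nu> = "- ?e"])
    show "0 < \<delta> - dist z0 z" using z by simp
    show "y \<in> \<Omega>" if "y \<in> ball z (\<delta> - dist z0 z)" "(y - z) \<bullet> (- ?e) > 0" for y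
    proof -
      have "dist z0 y < \<delta>" using that(1) dist_triangle[of z0 y z] by auto
      then show ?thesis using that(2) z H by (auto simp: H_def inner_e)
    qed
    show "?R (?R p) = p" "?R p \<bullet> (- ?e) = - (p \<bullet> (- ?e))" "p \<bullet> (- ?e) = 0 \<Longrightarrow> ?R p = p"
      by (auto simp: inner_e e_nth)
    show "regular_collision \<rho> L \<Omega> z p' (?R p')" if "z \<in> closure \<Omega>" "p' \<bullet> (- ?e) \<noteq> 0" for p'
    proof -
      have "wall_collision \<rho> L i k z"
        using z \<delta>(2) unfolding wall_collision_def U_def by fast
      moreover have "p' \<notin> wall_tangent i (wall_normal k)"
        using that(2) by (simp add: wall_tangent_def wall_normal_def inner_e inner_axis)
      ultimately show ?thesis
        unfolding regular_collision_def wall_reflect_eq[symmetric] using that(1) by blast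
    qed
  qed
  \<comment> \<open>The line through \<open>z0\<close> and \<open>z\<close> stays in the hyperplane
    of the wall, so the local identity spreads along it.\<close>
  have "G (z, ?R p) = G (z, p)" if z: "z $ i $ k = L $ k - \<rho>" for z p
  proof -
    let ?F = "\<lambda>z. G (z, ?R p) - G (z, p)"
    let ?d = "\<delta> / (norm (z - z0) + 1)"
    have pos: "norm (z - z0) + 1 > 0" by (simp add: add_nonneg_pos)
    have "?F (z0 + 1 *\<^sub>R (z - z0)) = 0"
    proof (rule polynomial_zero_line[where e = ?d])
      show "real_polynomial_function ?F" by (intro polynomial_intros real_polynomial_function_subst[OF G])
      show "?d > 0" using \<delta> pos by simp
      fix t assume t: "\<bar>t\<bar> < ?d"
      have "\<bar>t\<bar> * norm (z - z0) \<le> \<bar>t\<bar> * (norm (z - z0) + 1)" by (simp add: mult_left_mono)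
      also have "\<dots> < \<delta>" using t pos by (simp add: field_simps)
      finally have "z0 + t *\<^sub>R (z - z0) \<in> ball z0 \<delta>" by (simp add: dist_norm)
      moreover have "(z0 + t *\<^sub>R (z - z0)) $ i $ k = L $ k - \<rho>" using z z0_ik by simp
      ultimately show "?F (z0 + t *\<^sub>R (z - z0)) = 0" using local by simp
    qed
    then show ?thesis by simp
  qed
  then show thesis by (rule that)
qed

end

section \<open>Pair collisions and the contact cylinder\<close>

text \<open>Polar coordinates in a plane containing \<open>u\<close> and \<open>w\<close>; if
  \<open>w\<close> is parallel to \<open>u\<close>, the dimension bound still provides an orthogonal
  \<open>v\<close>. Full turns are added to make the angle positive, because it later serves as the
  final time of a path and as a divisor.\<close>

lemma polar_form:
  fixes u w :: "'a::euclidean_space"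
  assumes "DIM('a) \<ge> 2" "u \<noteq> 0"
  obtains v r \<beta> where "v \<bullet> u = 0" "norm v = norm u" "norm w = r * norm u" "r \<ge> 0"
     "w = r *\<^sub>R (cos \<beta> *\<^sub>R u + sin \<beta> *\<^sub>R v)" "\<beta> > 0"
proof -
  define a where "a = (w \<bullet> u) / (u \<bullet> u)"
  define w' where "w' = w - a *\<^sub>R u"
  have w'u: "w' \<bullet> u = 0" using assms by (simp add: w'_def a_def inner_diff_left)
  obtain y where y: "y \<noteq> 0" "y \<bullet> u = 0" "w' = 0 \<or> y = w'"
  proof (cases "w' = 0")
    case True
    then show thesis
      using that orthogonal_to_vector_exists[OF assms(1), of u] by (auto simp: orthogonal_def inner_commute)
  next
    case False
    then show thesis using w'u by (intro that[of w']) auto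
  qed
  define v where "v = (norm u / norm y) *\<^sub>R y"
  have v: "v \<bullet> u = 0" "norm v = norm u" using y by (simp_all add: v_def)
  obtain b where b: "w' = b *\<^sub>R v"
  proof (cases "w' = 0")
    case False
    then have "w' = (norm y / norm u) *\<^sub>R v" using y assms by (simp add: v_def)
    then show thesis by (rule that)
  qed (use that[of 0] in auto)
  have w: "w = a *\<^sub>R u + b *\<^sub>R v" using b by (simp add: w'_def algebra_simps)
  define r where "r = norm w / norm u"
  have r: "norm w = r * norm u" "r \<ge> 0" using assms by (simp_all add: r_def)
  have "(norm w)\<^sup>2 = a\<^sup>2 * (norm u)\<^sup>2 + b\<^sup>2 * (norm v)\<^sup>2"
    unfolding w power2_norm_eq_inner using v(1)
    by (simp add: inner_add_left inner_add_right inner_commute[of u v] power2_eq_square)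
  then have "(norm w)\<^sup>2 = (a\<^sup>2 + b\<^sup>2) * (norm u)\<^sup>2"
    unfolding v(2) by (simp add: algebra_simps)
  then have ab: "a\<^sup>2 + b\<^sup>2 = r\<^sup>2" using assms by (simp add: r(1) power_mult_distrib)
  obtain \<beta> where \<beta>: "a = r * cos \<beta>" "b = r * sin \<beta>"
  proof (cases "r = 0")
    case True
    then show thesis using ab that by (simp add: sum_power2_eq_zero_iff)
  next
    case False
    then have "(a / r)\<^sup>2 + (b / r)\<^sup>2 = 1" using ab by (simp add: power_divide flip: add_divide_distrib)
    then obtain t where "a / r = cos t" "b / r = sin t" using sincos_total_2pi by metis
    then show thesis using False that[of t] by (simp add: field_simps)
  qed
  obtain n :: nat where n: "- \<beta> < real n" using reals_Archimedean2 by blast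
  have "real n * 1 \<le> real n * (2 * pi)" using pi_ge_two by (intro mult_left_mono) auto
  then have "\<beta> + 2 * pi * real n > 0" using n by (simp add: algebra_simps)
  moreover have "cos (\<beta> + 2 * pi * real n) = cos \<beta>" "sin (\<beta> + 2 * pi * real n) = sin \<beta>"
    by (simp_all add: cos_add sin_add cos_int_2pin[of "int n", simplified] sin_int_2pin[of "int n", simplified])
  ultimately show thesis
    using v r w \<beta> by (intro that[of v r "\<beta> + 2 * pi * real n"]) (auto simp: algebra_simps)
qed

lemma relative_difference:
  assumes "i \<noteq> j"
  shows "relative i j x $ i - relative i j x $ j = 2 *\<^sub>R x"
  using assms by (simp add: relative_nth scaleR_2)

context polynomial_first_integral
begin

(* Near a pair collision point the accessible side of the cylinder |y_i - y_j| = 2 rho is not convex, but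
   each point z of an open piece of the cylinder sees a convex cap of it that meets the component. *)
lemma pair_invariance_local:
  assumes "(i, j) \<in> collision_graph \<rho> L \<Omega>"
  obtains \<delta> z0 where "\<delta> > 0" "norm (z0 $ i - z0 $ j) = 2 * \<rho>"
    "\<And>z p n. z \<in> ball z0 \<delta> \<Longrightarrow> norm n = 1 \<Longrightarrow> z $ i - z $ j = (2 * \<rho>) *\<^sub>R n \<Longrightarrow>
       G (z, p - ((p $ i - p $ j) \<bullet> n) *\<^sub>R relative i j n) = G (z, p)"
proof -
  obtain c where c: "path c" "c ` {0..<1} \<subseteq> \<Omega>" and x: "pair_collision \<rho> L i j (c 1)"
    using assms unfolding collision_graph_def by blast
  have ij: "i \<noteq> j" using x by (simp add: pair_collision_def)
  define x where "x = c 1"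
  define U where "U = {y :: real ^ 'd ^ 'n. (\<forall>a k. \<rho> < y $ a $ k \<and> y $ a $ k < L $ k - \<rho>) \<and>
     (\<forall>a b. a \<noteq> b \<and> {a, b} \<noteq> {i, j} \<longrightarrow> 2 * \<rho> < norm (y $ a - y $ b))}"
  have "open U"
    unfolding U_def by (intro open_Collect_conj open_Collect_all_finite open_Collect_imp open_Collect_less
        closed_Collect_const continuous_intros)
  have "x \<in> U"
    using x by (simp add: pair_collision_def x_def U_def center_box_def)
  then obtain \<epsilon> where \<epsilon>: "\<epsilon> > 0" "ball x \<epsilon> \<subseteq> U"
    using \<open>open U\<close> by (meson open_contains_ball)
  have conf: "y \<in> config_space \<rho> L" if y: "y \<in> U" "norm (y $ i - y $ j) > 2 * \<rho>" for y
  proof -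
    have "2 * \<rho> < norm (y $ a - y $ b)" if "a \<noteq> b" for a b
    proof (cases "{a, b} = {i, j}")
      case True
      then show ?thesis using y by (auto simp: doubleton_eq_iff norm_minus_commute)
    next
      case False
      then show ?thesis using y that by (simp add: U_def)
    qed
    then show ?thesis using y by (simp add: U_def config_space_def center_box_def)
  qed
  obtain y0 where y0: "y0 \<in> \<Omega>" "dist x y0 < \<epsilon> / 4"
  proof -
    have "continuous_on {0..1} c" using c(1) by (simp add: path_def)
    then obtain d where d: "d > 0" "\<And>t. t \<in> {0..1} \<Longrightarrow> dist t 1 < d \<Longrightarrow> dist (c t) (c 1) < \<epsilon> / 4"
      unfolding continuous_on_iff using \<epsilon>(1) by (metis atLeastAtMost_iff divide_pos_pos order_refl zero_le_one zero_less_numeral)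
    let ?t = "max 0 (1 - d / 2)"
    have "?t \<in> {0..<1}" "dist ?t 1 < d" using d(1) by (auto simp: dist_real_def)
    then have "c ?t \<in> \<Omega>" "dist (c ?t) x < \<epsilon> / 4"
      using c(2) d(2)[of ?t] by (auto simp: x_def image_subset_iff)
    then show thesis by (intro that[of "c ?t"]) (auto simp: dist_commute)
  qed
  define u0 where "u0 = y0 $ i - y0 $ j"
  have u0: "norm u0 > 2 * \<rho>"
    using y0(1) ij in_components_subset[OF component] by (auto simp: u0_def config_space_def)
  then have u0_pos: "norm u0 > 0" using \<rho> by linarith
  define n0 where "n0 = u0 /\<^sub>R norm u0"
  have n0: "norm n0 = 1" "u0 = norm u0 *\<^sub>R n0" using u0_pos by (simp_all add: n0_def)
  \<comment> \<open>The two balls are pushed towards each other until they touch. The displacement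
    is at most the gap between them, which is small because \<open>y0\<close> is close to
    \<open>x\<close>.\<close>
  define z0 where "z0 = y0 - relative i j (((norm u0 - 2 * \<rho>) / 2) *\<^sub>R n0)"
  have uz0: "z0 $ i - z0 $ j = (2 * \<rho>) *\<^sub>R n0"
  proof -
    have "z0 $ i - z0 $ j = u0 - (norm u0 - 2 * \<rho>) *\<^sub>R n0"
    proof -
      have "z0 $ i - z0 $ j = u0 - (relative i j (((norm u0 - 2 * \<rho>) / 2) *\<^sub>R n0) $ i
          - relative i j (((norm u0 - 2 * \<rho>) / 2) *\<^sub>R n0) $ j)"
        by (simp add: z0_def u0_def)
      then show ?thesis by (simp add: relative_difference[OF ij])
    qed
    also have "\<dots> = norm u0 *\<^sub>R n0 - (norm u0 - 2 * \<rho>) *\<^sub>R n0"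
      by (rule arg_cong[OF n0(2), of "\<lambda>v. v - (norm u0 - 2 * \<rho>) *\<^sub>R n0"])
    also have "\<dots> = (2 * \<rho>) *\<^sub>R n0" by (simp flip: scaleR_diff_left)
    finally show ?thesis .
  qed
  have "dist x z0 < \<epsilon>"
  proof -
    have "norm u0 - norm (x $ i - x $ j) \<le> norm (u0 - (x $ i - x $ j))" by (rule norm_triangle_ineq2)
    also have "\<dots> = norm ((y0 - x) $ i - (y0 - x) $ j)" by (simp add: u0_def algebra_simps)
    also have "\<dots> \<le> norm ((y0 - x) $ i) + norm ((y0 - x) $ j)" by (rule norm_triangle_ineq4)
    also have "\<dots> \<le> norm (y0 - x) + norm (y0 - x)" by (intro add_mono Finite_Cartesian_Product.norm_nth_le)
    finally have "norm u0 - 2 * \<rho> < \<epsilon> / 2"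
      using y0(2) x by (simp add: x_def pair_collision_def dist_norm norm_minus_commute)
    moreover have "dist y0 z0 \<le> norm u0 - 2 * \<rho>"
      using norm_relative_le[of i j "((norm u0 - 2 * \<rho>) / 2) *\<^sub>R n0"] u0 n0(1)
      by (simp add: z0_def dist_norm)
    ultimately show ?thesis using dist_triangle[of x z0 y0] y0(2) \<epsilon>(1) by linarith
  qed
  \<comment> \<open>An open condition saying that \<open>y0\<close> lies beyond the tangent
    hyperplane at the contact point; being open, it lets the same \<open>y0\<close> serve all nearby
    \<open>z\<close>.\<close>
  moreover have "(z0 $ i - z0 $ j) \<bullet> u0 > 4 * \<rho>\<^sup>2"
  proof -
    have "(z0 $ i - z0 $ j) \<bullet> u0 = (2 * \<rho>) * norm u0"
      unfolding uz0 by (subst n0(2)) (simp add: n0(1) flip: power2_norm_eq_inner)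
    then show ?thesis using u0 \<rho> by (simp add: power2_eq_square)
  qed
  ultimately have "z0 \<in> {z. dist x z < \<epsilon> \<and> (z $ i - z $ j) \<bullet> u0 > 4 * \<rho>\<^sup>2}" by simp
  moreover have "open {z. dist x z < \<epsilon> \<and> (z $ i - z $ j) \<bullet> u0 > 4 * \<rho>\<^sup>2}"
    by (intro open_Collect_conj open_Collect_less continuous_intros)
  ultimately obtain \<delta> where \<delta>: "\<delta> > 0"
    "ball z0 \<delta> \<subseteq> {z. dist x z < \<epsilon> \<and> (z $ i - z $ j) \<bullet> u0 > 4 * \<rho>\<^sup>2}"
    by (meson open_contains_ball)
  have inv: "G (z, p - ((p $ i - p $ j) \<bullet> n) *\<^sub>R relative i j n) = G (z, p)"
    if z: "z \<in> ball z0 \<delta>" and n: "norm n = 1" and zn: "z $ i - z $ j = (2 * \<rho>) *\<^sub>R n" for z p n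
  proof -
    have zx: "dist x z < \<epsilon>" "(2 * \<rho>) * (n \<bullet> u0) > 4 * \<rho>\<^sup>2"
      using z \<delta>(2) zn by auto
    then have zu: "n \<bullet> u0 > 2 * \<rho>" using \<rho> by (simp add: power2_eq_square)
    \<comment> \<open>The cap beyond the tangent hyperplane at \<open>z\<close>. By Cauchy-Schwarz
      it lies outside the cylinder.\<close>
    define H where "H = ball x \<epsilon> \<inter> {y. relative i j n \<bullet> y > 2 * \<rho>}"
    have H_conf: "H \<subseteq> config_space \<rho> L"
    proof
      fix y assume y: "y \<in> H"
      have "2 * \<rho> < (y $ i - y $ j) \<bullet> n"
        using y by (simp add: H_def inner_commute[of "relative i j n"] inner_relative)
      also have "\<dots> \<le> norm (y $ i - y $ j)"
        using norm_cauchy_schwarz[of "y $ i - y $ j" n] n by simp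
      finally show "y \<in> config_space \<rho> L" using conf y \<epsilon>(2) by (auto simp: H_def)
    qed
    have "convex H"
      unfolding H_def by (intro convex_Int convex_ball convex_halfspace_gt)
    moreover have "y0 \<in> H"
      using y0(2) zu \<epsilon>(1) by (simp add: H_def inner_commute[of "relative i j n"] inner_relative u0_def inner_commute[of n])
    ultimately have H: "H \<subseteq> \<Omega>"
      using subset_component[OF convex_connected H_conf] y0(1) by blast
    let ?R = "\<lambda>p :: real ^ 'd ^ 'n. p - ((p $ i - p $ j) \<bullet> n) *\<^sub>R relative i j n"
    have nn: "n \<bullet> n = 1" using n by (simp flip: power2_norm_eq_inner)
    have uR: "(?R p $ i - ?R p $ j) = (p $ i - p $ j) - (2 * ((p $ i - p $ j) \<bullet> n)) *\<^sub>R n" for p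
    proof -
      have "?R p $ i - ?R p $ j = (p $ i - p $ j)
          - ((p $ i - p $ j) \<bullet> n) *\<^sub>R (relative i j n $ i - relative i j n $ j)"
        by (simp add: scaleR_diff_right)
      then show ?thesis by (simp add: relative_difference[OF ij])
    qed
    have uRn: "(?R p $ i - ?R p $ j) \<bullet> n = - ((p $ i - p $ j) \<bullet> n)" for p
      unfolding uR by (simp add: inner_diff_left nn)
    show "G (z, ?R p) = G (z, p)"
    proof (rule reflection_invariance[where \<delta> = "\<epsilon> - dist x z" and \<nu> = "relative i j n"])
      show "0 < \<epsilon> - dist x z" using zx by simp
      show "y \<in> \<Omega>" if "y \<in> ball z (\<epsilon> - dist x z)" "(y - z) \<bullet> relative i j n > 0" for y
      proof -
        have "dist x y < \<epsilon>" using that(1) dist_triangle[of x y z] by auto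
        moreover have "z \<bullet> relative i j n = 2 * \<rho>" by (simp add: inner_relative zn nn)
        ultimately show ?thesis
          using that(2) H by (auto simp: H_def inner_diff_left inner_commute[of "relative i j n"])
      qed
      show "?R (?R p) = p"
        unfolding uRn by simp
      show "?R p \<bullet> relative i j n = - (p \<bullet> relative i j n)"
        unfolding inner_relative by (rule uRn)
      show "?R p = p" if "p \<bullet> relative i j n = 0"
        using that by (simp add: inner_relative)
      show "regular_collision \<rho> L \<Omega> z p' (?R p')" if "z \<in> closure \<Omega>" "p' \<bullet> relative i j n \<noteq> 0" for p'
      proof -
        have "z \<in> U" using zx \<epsilon>(2) by auto
        then have "pair_collision \<rho> L i j z"
          using ij n \<rho> by (simp add: pair_collision_def U_def center_box_def zn)
        moreover have pn: "pair_normal \<rho> i j z = n" using \<rho> by (simp add: pair_normal_def zn)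
        moreover have "p' \<notin> pair_tangent i j n"
          using that(2) by (simp add: pair_tangent_def inner_relative)
        moreover have "?R p' = pair_reflect i j n p'" using ij by (simp add: pair_reflect_eq)
        ultimately show ?thesis
          unfolding regular_collision_def using that(1) by metis
      qed
    qed
  qed
  show thesis
    by (rule that[OF \<delta>(1) _ inv]) (use uz0 n0 \<rho> in auto)
qed

text \<open>The local identity travels along a helical path on the cylinder: the normal turns to
  \<open>n\<close> while the remaining part moves linearly. The second space dimension makes room
  for the turn, so the cylinder is connected.\<close>

lemma pair_invariance:
  assumes edge: "(i, j) \<in> collision_graph \<rho> L \<Omega>"
    and n: "norm n = 1" and zn: "z $ i - z $ j = (2 * \<rho>) *\<^sub>R n"
  shows "G (z, p - ((p $ i - p $ j) \<bullet> n) *\<^sub>R relative i j n) = G (z, p)"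
proof -
  have ij: "i \<noteq> j" using edge by (auto simp: collision_graph_def pair_collision_def)
  obtain z0 \<delta> where \<delta>: "\<delta> > 0" "norm (z0 $ i - z0 $ j) = 2 * \<rho>"
    and loc: "\<And>z p n. z \<in> ball z0 \<delta> \<Longrightarrow> norm n = 1 \<Longrightarrow> z $ i - z $ j = (2 * \<rho>) *\<^sub>R n \<Longrightarrow>
       G (z, p - ((p $ i - p $ j) \<bullet> n) *\<^sub>R relative i j n) = G (z, p)"
    by (fact pair_invariance_local[OF edge])
  define m where "m = (z0 $ i - z0 $ j) /\<^sub>R (2 * \<rho>)"
  have m: "norm m = 1" "z0 $ i - z0 $ j = (2 * \<rho>) *\<^sub>R m"
    using \<delta>(2) \<rho> by (simp_all add: m_def)
  obtain v r \<beta> where v: "v \<bullet> m = 0" "norm v = norm m" "norm n = r * norm m"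
    "n = r *\<^sub>R (cos \<beta> *\<^sub>R m + sin \<beta> *\<^sub>R v)" "\<beta> > 0"
  proof (rule polar_form)
    show "2 \<le> DIM(real ^ 'd)" using d by simp
    show "m \<noteq> 0" using m(1) by auto
  qed
  have r: "r = 1" using v m n by simp
  define N where "N t = cos t *\<^sub>R m + sin t *\<^sub>R v" for t
  have N\<beta>: "N \<beta> = n" using v(4) r by (simp add: N_def)
  have norm_N: "norm (N t) = 1" for t
  proof -
    have "(norm (N t))\<^sup>2 = (cos t)\<^sup>2 * (norm m)\<^sup>2 + (sin t)\<^sup>2 * (norm v)\<^sup>2"
      unfolding N_def power2_norm_eq_inner using v(1)
      by (simp add: inner_add_left inner_add_right inner_commute[of m v] power2_eq_square)
    also have "\<dots> = 1" using v(2) m(1) by simp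
    finally show ?thesis using power2_eq_imp_eq[of "norm (N t)" 1] by simp
  qed
  define a where "a = z0 - relative i j (\<rho> *\<^sub>R m)"
  \<comment> \<open>The velocity that brings the non-rotating part to that of \<open>z\<close> at
    time \<beta>. Both \<open>a\<close> and \<open>b\<close> agree at balls \<open>i\<close> and
    \<open>j\<close>, which keeps the path on the cylinder.\<close>
  define b where "b = ((z - relative i j (\<rho> *\<^sub>R n)) - a) /\<^sub>R \<beta>"
  define \<gamma> where "\<gamma> t = a + t *\<^sub>R b + cos t *\<^sub>R relative i j (\<rho> *\<^sub>R m) + sin t *\<^sub>R relative i j (\<rho> *\<^sub>R v)" for t
  have \<gamma>_N: "\<gamma> t = a + t *\<^sub>R b + relative i j (\<rho> *\<^sub>R N t)" for t
    by (simp add: \<gamma>_def N_def relative_simps algebra_simps)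
  have \<gamma>0: "\<gamma> 0 = z0" by (simp add: \<gamma>_def a_def)
  have \<gamma>\<beta>: "\<gamma> \<beta> = z" using v(5) by (simp add: \<gamma>_N N\<beta> b_def)
  note u_rel = relative_difference[OF ij]
  have ua: "a $ i - a $ j = 0"
    using u_rel[of "\<rho> *\<^sub>R m"] m(2) unfolding a_def by (simp add: algebra_simps)
  have "(z - relative i j (\<rho> *\<^sub>R n)) $ i - (z - relative i j (\<rho> *\<^sub>R n)) $ j = 0"
    using u_rel[of "\<rho> *\<^sub>R n"] zn by (simp add: algebra_simps)
  then have ub: "b $ i - b $ j = 0"
    using ua by (simp add: b_def algebra_simps) (metis scaleR_right_distrib)
  have u\<gamma>: "\<gamma> t $ i - \<gamma> t $ j = (2 * \<rho>) *\<^sub>R N t" for t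
  proof -
    have "\<gamma> t $ i - \<gamma> t $ j = (a $ i - a $ j) + t *\<^sub>R (b $ i - b $ j)
        + (relative i j (\<rho> *\<^sub>R N t) $ i - relative i j (\<rho> *\<^sub>R N t) $ j)"
      by (simp add: \<gamma>_N algebra_simps)
    then show ?thesis by (simp add: ua ub u_rel)
  qed
  \<comment> \<open>With the normal written as a linear function of the position, the reflection law
    becomes polynomial in \<open>z\<close>.\<close>
  let ?n = "\<lambda>z :: real ^ 'd ^ 'n. (z $ i - z $ j) /\<^sub>R (2 * \<rho>)"
  let ?F = "\<lambda>z. G (z, p - ((p $ i - p $ j) \<bullet> ?n z) *\<^sub>R relative i j (?n z)) - G (z, p)"
  have n\<gamma>: "?n (\<gamma> t) = N t" for t using u\<gamma>[of t] \<rho> by simp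
  have n_lin: "linear ?n"
    by (rule linearI) (simp_all add: algebra_simps)
  have F: "real_polynomial_function ?F"
  proof -
    have 1: "polynomial_function ?n" by (rule polynomial_function_linear[OF n_lin])
    have 2: "polynomial_function (\<lambda>z. relative i j (?n z))"
      by (rule polynomial_function_linear[OF linear_compose[OF n_lin linear_relative, unfolded o_def]])
    have 3: "polynomial_function (\<lambda>z. (p $ i - p $ j) \<bullet> ?n z)"
    proof (rule polynomial_function_linear[OF linearI])
    qed (simp_all add: algebra_simps inner_add_right inner_diff_right)
    show ?thesis
      by (intro polynomial_intros real_polynomial_function_subst[OF G] 2 3)
  qed
  have cont: "continuous (at 0) \<gamma>"
    unfolding \<gamma>_def by (intro continuous_intros)
  obtain e where e: "e > 0" "\<And>t. \<bar>t\<bar> < e \<Longrightarrow> dist (\<gamma> t) z0 < \<delta>"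
    using cont \<delta>(1) unfolding continuous_at_eps_delta \<gamma>0 by (auto simp: dist_real_def)
  have "?F (\<gamma> \<beta>) = 0"
    unfolding \<gamma>_def
  proof (rule polynomial_zero_path[OF F e(1)], fold \<gamma>_def)
    fix t assume "\<bar>t\<bar> < e"
    then have "\<gamma> t \<in> ball z0 \<delta>" using e(2) by (simp add: dist_commute)
    then show "?F (\<gamma> t) = 0"
      using loc[of "\<gamma> t" "N t" p] norm_N u\<gamma> unfolding n\<gamma> by simp
  qed
  then show ?thesis unfolding n\<gamma> unfolding N\<beta> \<gamma>\<beta> by simp
qed

end

section \<open>Billiards inside a cylinder\<close>

lemma real_polynomial_function_periodic:
  fixes h :: "real \<Rightarrow> real"
  assumes "real_polynomial_function h" "T \<noteq> 0" "\<And>x. h (x + T) = h x"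
  shows "h x = h 0"
proof -
  obtain a n where h: "h = (\<lambda>x. \<Sum>i\<le>n. a i * x ^ i)"
    using real_polynomial_function_imp_sum[OF assms(1)] by blast
  define P where "P = (\<Sum>i\<le>n. monom (a i) i) - [:h 0:]"
  have P: "poly P x = h x - h 0" for x
    by (simp add: P_def h poly_sum poly_monom)
  have "h (real k * T) = h 0" for k
  proof (induction k)
    case (Suc k)
    then show ?case using assms(3)[of "real k * T"] by (simp add: algebra_simps)
  qed simp
  then have "range (\<lambda>k::nat. real k * T) \<subseteq> {x. poly P x = 0}"
    by (auto simp: P)
  moreover have "infinite (range (\<lambda>k::nat. real k * T))"
    using assms(2) by (intro range_inj_infinite) (simp add: inj_def)
  ultimately have "P = 0" using poly_roots_finite finite_subset by blast
  then show ?thesis using P[of x] by simp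
qed

definition circle :: "'a::real_vector \<Rightarrow> 'a \<Rightarrow> real \<Rightarrow> 'a" where
  "circle m v t = cos t *\<^sub>R m + sin t *\<^sub>R v"

text \<open>For orthonormal \<open>m\<close> and \<open>v\<close> this is the second intersection of
  a line with the unit circle: starting at angle \<open>x\<close> in the direction of angle
  \<open>x + b\<close>, the line returns at angle \<open>x + 2 * b + pi\<close>.\<close>

lemma circle_chord: "circle m v x - (2 * cos b) *\<^sub>R circle m v (x + b) = circle m v (x + (2 * b + pi))"
proof -
  have c: "cos (x + (2 * b + pi)) = cos x - 2 * cos b * cos (x + b)"
  proof -
    have "cos (x + (2 * b + pi)) = - cos (x + b + b)"
      using cos_periodic_pi[of "x + b + b"] by (simp add: algebra_simps)
    then show ?thesis using cos_add[of "x + b" b] cos_diff[of "x + b" b] by simp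
  qed
  have s: "sin (x + (2 * b + pi)) = sin x - 2 * cos b * sin (x + b)"
  proof -
    have "sin (x + (2 * b + pi)) = - sin (x + b + b)"
      using sin_periodic_pi[of "x + b + b"] by (simp add: algebra_simps)
    then show ?thesis using sin_add[of "x + b" b] sin_diff[of "x + b" b] by simp
  qed
  show ?thesis
    unfolding circle_def c s by (simp add: algebra_simps)
qed

lemma circle_periodic: "circle m v (x + of_int l * (2 * pi)) = circle m v x"
  by (simp add: circle_def cos_add sin_add mult.commute[of "of_int l"])

lemma circle_pi: "circle m v (x + pi) = - circle m v x"
  by (simp add: circle_def)

lemma inner_circle:
  assumes "norm m = 1" "norm v = 1" "v \<bullet> m = 0"
  shows "circle m v x \<bullet> circle m v y = cos (x - y)"
proof -
  have "m \<bullet> m = 1" "v \<bullet> v = 1" using assms by (simp_all flip: power2_norm_eq_inner)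
  then show ?thesis
    using assms(3) by (simp add: circle_def inner_add_left inner_add_right inner_commute[of m v] cos_diff)
qed

lemma isCont_circle:
  fixes m v :: "'a::real_normed_vector"
  shows "isCont (circle m v) x"
  unfolding circle_def[abs_def] by (intro continuous_intros)

(* Perturbing the angle by O(1/k) makes k chords turn by a prescribed total angle. *)
lemma chord_angle_approximation:
  obtains b :: "nat \<Rightarrow> real" where "b \<longlonglongrightarrow> \<beta>"
    "\<And>k. \<exists>l::int. real (Suc k) * (2 * b k + pi) = \<phi> + of_int l * (2 * pi)"
proof -
  \<comment> \<open>The number of full turns by which \<open>Suc k\<close> chords of angle \<beta>
    exceed \<phi>. Rounding it costs at most one turn, hence at most \<open>pi / Suc k\<close> in
    the angle of a single chord.\<close>
  define x where "x k = (real (Suc k) * (2 * \<beta> + pi) - \<phi>) / (2 * pi)" for k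
  define b where "b k = ((\<phi> + of_int \<lfloor>x k\<rfloor> * (2 * pi)) / real (Suc k) - pi) / 2" for k
  have eq: "real (Suc k) * (2 * b k + pi) = \<phi> + of_int \<lfloor>x k\<rfloor> * (2 * pi)" for k
  proof -
    have "2 * b k + pi = (\<phi> + of_int \<lfloor>x k\<rfloor> * (2 * pi)) / real (Suc k)"
    proof -
      have "2 * ((B - pi) / 2) + pi = B" for B :: real by (simp add: field_simps)
      then show ?thesis unfolding b_def .
    qed
    then show ?thesis by simp
  qed
  have x: "real (Suc k) * (2 * \<beta> + pi) = \<phi> + x k * (2 * pi)" for k
    by (simp add: x_def)
  have bound: "norm (b k - \<beta>) \<le> pi / real (Suc k)" for k
  proof -
    have "real (Suc k) * (2 * (b k - \<beta>)) = (of_int \<lfloor>x k\<rfloor> - x k) * (2 * pi)"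
      using eq[of k] x[of k] by (simp add: algebra_simps)
    then have 1: "real (Suc k) * (b k - \<beta>) = (of_int \<lfloor>x k\<rfloor> - x k) * pi"
      unfolding mult.left_commute[of _ 2] by linarith
    have "\<bar>of_int \<lfloor>x k\<rfloor> - x k\<bar> \<le> 1" by linarith
    then have "\<bar>of_int \<lfloor>x k\<rfloor> - x k\<bar> * pi \<le> 1 * pi" by (intro mult_right_mono) auto
    then have "\<bar>real (Suc k) * (b k - \<beta>)\<bar> \<le> pi"
      unfolding 1 abs_mult by simp
    then have "\<bar>b k - \<beta>\<bar> * real (Suc k) \<le> pi"
      by (simp only: abs_mult abs_of_nat mult.commute)
    then show ?thesis by (simp add: pos_le_divide_eq del: of_nat_Suc)
  qed
  have "(\<lambda>k. pi / real (Suc k)) \<longlonglongrightarrow> 0"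
    using LIMSEQ_Suc[OF lim_const_over_n[of pi]] by simp
  then have "(\<lambda>k. b k - \<beta>) \<longlonglongrightarrow> 0"
    by (rule Lim_null_comparison[rotated]) (intro always_eventually allI bound)
  then have "b \<longlonglongrightarrow> \<beta>" by (simp add: LIM_zero_iff)
  with eq show thesis by (intro that) blast+
qed

section \<open>Invariant translations and closed billiard orbits\<close>

context polynomial_first_integral
begin

text \<open>The momentum is a parameter because the directions found at the beginning depend on it,
  as \<open>p\<close> itself does. Independence of the position means that every constant vector
  belongs to the set for all \<open>p\<close>.\<close>

definition invariant_shifts :: "real ^ 'd ^ 'n \<Rightarrow> (real ^ 'd ^ 'n) set" where
  "invariant_shifts p = {v. \<forall>q t. G (q + t *\<^sub>R v, p) = G (q, p)}"

lemma invariant_shiftsD: "v \<in> invariant_shifts p \<Longrightarrow> G (q + t *\<^sub>R v, p) = G (q, p)"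
  by (simp add: invariant_shifts_def)

lemma subspace_invariant_shifts: "subspace (invariant_shifts p)"
  unfolding subspace_def
proof (intro conjI ballI allI)
  show "0 \<in> invariant_shifts p" by (simp add: invariant_shifts_def)
  show "v + w \<in> invariant_shifts p" if vw: "v \<in> invariant_shifts p" "w \<in> invariant_shifts p" for v w
    unfolding invariant_shifts_def mem_Collect_eq scaleR_add_right add.assoc[symmetric]
    by (simp only: invariant_shiftsD[OF vw(1)] invariant_shiftsD[OF vw(2)] simp_thms)
  show "c *\<^sub>R v \<in> invariant_shifts p" if v: "v \<in> invariant_shifts p" for c v
    unfolding invariant_shifts_def mem_Collect_eq scaleR_scaleR
    by (simp only: invariant_shiftsD[OF v] simp_thms)
qed

lemma momentum_shift: "p \<in> invariant_shifts p"
  by (simp add: invariant_shifts_def free)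

lemma invariant_shifts_from_ball:
  assumes e: "e > 0" and "\<And>q t. q \<in> ball q0 e \<Longrightarrow> \<bar>t\<bar> < e \<Longrightarrow> G (q + t *\<^sub>R v, p) = G (q, p)"
  shows "v \<in> invariant_shifts p"
proof -
  have 1: "G (q + t *\<^sub>R v, p) - G (q, p) = 0" if "q \<in> ball q0 e" for q t
  proof (rule polynomial_zero_ball[where F = "\<lambda>t. G (q + t *\<^sub>R v, p) - G (q, p)" and a = 0, OF _ e])
    show "real_polynomial_function (\<lambda>t. G (q + t *\<^sub>R v, p) - G (q, p))"
      by (intro polynomial_intros real_polynomial_function_subst[OF G])
    show "G (q + t *\<^sub>R v, p) - G (q, p) = 0" if "t \<in> ball 0 e" for t
      using assms(2)[OF \<open>q \<in> ball q0 e\<close>] that by simp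
  qed
  have "G (q + t *\<^sub>R v, p) - G (q, p) = 0" for q t
  proof (rule polynomial_zero_ball[where F = "\<lambda>q. G (q + t *\<^sub>R v, p) - G (q, p)", OF _ e 1])
    show "real_polynomial_function (\<lambda>q. G (q + t *\<^sub>R v, p) - G (q, p))"
      by (intro polynomial_intros real_polynomial_function_subst[OF G])
  qed
  then show ?thesis by (simp add: invariant_shifts_def)
qed

text \<open>Removes genericity conditions on the momentum from shift directions that depend on it
  polynomially.\<close>

lemma invariant_shifts_extend:
  assumes A: "polynomial_function A" and e: "e > 0" and "\<And>p. p \<in> ball p0 e \<Longrightarrow> A p \<in> invariant_shifts p"
  shows "A p \<in> invariant_shifts p"
proof -
  have "G (q + t *\<^sub>R A p, p) - G (q, p) = 0" for q t
  proof (rule polynomial_zero_ball[where F = "\<lambda>p. G (q + t *\<^sub>R A p, p) - G (q, p)", OF _ e])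
    show "real_polynomial_function (\<lambda>p. G (q + t *\<^sub>R A p, p) - G (q, p))"
      by (intro polynomial_intros real_polynomial_function_subst[OF G] A)
    show "G (q + t *\<^sub>R A p, p) - G (q, p) = 0" if "p \<in> ball p0 e" for p
      using invariant_shiftsD[OF assms(3)[OF that]] by simp
  qed
  then show ?thesis by (simp add: invariant_shifts_def)
qed

lemma isCont_G: "isCont G x"
  by (rule continuous_real_polymonial_function[OF G])

text \<open>One flight across the cylinder and the reflection at its end. The contact angle is
  \<theta>, and \<beta> is the angle from the contact direction to the velocity: a chord advances
  \<theta> by \<open>2 * \<beta> + pi\<close> and restores \<beta>, while the other coordinates move
  along \<open>s\<close>. The flight time may have either sign, as \<open>G\<close> is invariant
  under free motion in both time directions.\<close>

lemma chord:
  fixes m v :: "real ^ 'd"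
  assumes edge: "(i, j) \<in> collision_graph \<rho> L \<Omega>"
    and mv: "norm m = 1" "norm v = 1" "v \<bullet> m = 0"
    and y: "y $ i = y $ j" and s: "s $ i = s $ j" and r: "r \<noteq> 0"
  shows "G (y + relative i j (\<rho> *\<^sub>R circle m v \<theta>), s + relative i j (r *\<^sub>R circle m v (\<theta> + \<beta>))) =
    G (y + (- 2 * \<rho> * cos \<beta> / r) *\<^sub>R s + relative i j (\<rho> *\<^sub>R circle m v (\<theta> + (2 * \<beta> + pi))),
       s + relative i j (r *\<^sub>R circle m v (\<theta> + (2 * \<beta> + pi) + \<beta>)))"
proof -
  have ij: "i \<noteq> j" using edge by (auto simp: collision_graph_def pair_collision_def)
  let ?e = "circle m v" and ?t = "- 2 * \<rho> * cos \<beta> / r"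
  let ?q = "y + relative i j (\<rho> *\<^sub>R ?e \<theta>)" and ?p = "s + relative i j (r *\<^sub>R ?e (\<theta> + \<beta>))"
  let ?n = "?e (\<theta> + (2 * \<beta> + pi))"
  have q': "?q + ?t *\<^sub>R ?p = y + ?t *\<^sub>R s + relative i j (\<rho> *\<^sub>R ?n)"
  proof -
    have "\<rho> *\<^sub>R ?e \<theta> + ?t *\<^sub>R (r *\<^sub>R ?e (\<theta> + \<beta>)) = \<rho> *\<^sub>R ?n"
      unfolding circle_chord[symmetric] using r by (simp add: algebra_simps)
    then have "relative i j (\<rho> *\<^sub>R ?n) = relative i j (\<rho> *\<^sub>R ?e \<theta>) + ?t *\<^sub>R relative i j (r *\<^sub>R ?e (\<theta> + \<beta>))"
      by (simp flip: relative_simps)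
    then show ?thesis by (simp add: scaleR_add_right)
  qed
  have n: "norm ?n = 1"
    using inner_circle[OF mv, of "\<theta> + (2 * \<beta> + pi)" "\<theta> + (2 * \<beta> + pi)"] by (simp add: norm_eq_sqrt_inner)
  have "(?p $ i - ?p $ j) = (2 * r) *\<^sub>R ?e (\<theta> + \<beta>)"
  proof -
    have "?p $ i - ?p $ j = (s $ i - s $ j) + (relative i j (r *\<^sub>R ?e (\<theta> + \<beta>)) $ i - relative i j (r *\<^sub>R ?e (\<theta> + \<beta>)) $ j)"
      by simp
    then show ?thesis by (simp add: relative_difference[OF ij] s)
  qed
  then have "(?p $ i - ?p $ j) \<bullet> ?n = 2 * r * cos ((\<theta> + \<beta>) - (\<theta> + (2 * \<beta> + pi)))"
    by (simp add: inner_circle[OF mv])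
  also have "(\<theta> + \<beta>) - (\<theta> + (2 * \<beta> + pi)) = - (\<beta> + pi)" by simp
  finally have pn: "(?p $ i - ?p $ j) \<bullet> ?n = - 2 * r * cos \<beta>" by (simp add: cos_add)
  have p': "?p - (- 2 * r * cos \<beta>) *\<^sub>R relative i j ?n = s + relative i j (r *\<^sub>R ?e (\<theta> + (2 * \<beta> + pi) + \<beta>))"
  proof -
    have "\<theta> + (2 * \<beta> + pi) = (\<theta> + \<beta> + \<beta>) + pi" by simp
    then have n_eq: "?n = - ?e (\<theta> + \<beta> + \<beta>)" by (simp only: circle_pi)
    have "\<theta> + \<beta> + (2 * \<beta> + pi) = \<theta> + (2 * \<beta> + pi) + \<beta>" by simp
    then have "?e (\<theta> + (2 * \<beta> + pi) + \<beta>) = ?e (\<theta> + \<beta>) - (2 * cos \<beta>) *\<^sub>R ?e (\<theta> + \<beta> + \<beta>)"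
      using circle_chord[of m v "\<theta> + \<beta>" \<beta>] by (simp only:)
    then have "?e (\<theta> + (2 * \<beta> + pi) + \<beta>) = ?e (\<theta> + \<beta>) + (2 * cos \<beta>) *\<^sub>R ?n"
      unfolding n_eq by (simp only: scaleR_minus_right diff_conv_add_uminus)
    then have "relative i j (r *\<^sub>R ?e (\<theta> + (2 * \<beta> + pi) + \<beta>)) =
        relative i j (r *\<^sub>R ?e (\<theta> + \<beta>)) + (r * (2 * cos \<beta>)) *\<^sub>R relative i j ?n"
      by (simp only: relative_simps scaleR_add_right scaleR_scaleR)
    moreover have "a + b - (- 2 * r * cos \<beta>) *\<^sub>R c = a + (b + (r * (2 * cos \<beta>)) *\<^sub>R c)" for a b c :: "real ^ 'd ^ 'n"
      by (simp add: mult.commute mult.left_commute)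
    ultimately show ?thesis by (simp only:)
  qed
  have "G (?q, ?p) = G (?q + ?t *\<^sub>R ?p, ?p)" by (rule free[symmetric])
  also have "\<dots> = G (?q + ?t *\<^sub>R ?p, ?p - ((?p $ i - ?p $ j) \<bullet> ?n) *\<^sub>R relative i j ?n)"
  proof (rule pair_invariance[OF edge n, symmetric])
    have "(y + ?t *\<^sub>R s + relative i j (\<rho> *\<^sub>R ?n)) $ i - (y + ?t *\<^sub>R s + relative i j (\<rho> *\<^sub>R ?n)) $ j =
      (y $ i - y $ j) + ?t *\<^sub>R (s $ i - s $ j) + (relative i j (\<rho> *\<^sub>R ?n) $ i - relative i j (\<rho> *\<^sub>R ?n) $ j)"
      by (simp add: scaleR_diff_right)
    then show "(?q + ?t *\<^sub>R ?p) $ i - (?q + ?t *\<^sub>R ?p) $ j = (2 * \<rho>) *\<^sub>R ?n"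
      unfolding q' by (simp add: relative_difference[OF ij] y s)
  qed
  finally show ?thesis unfolding q' pn p' .
qed

lemma chord_iterate:
  fixes m v :: "real ^ 'd"
  assumes edge: "(i, j) \<in> collision_graph \<rho> L \<Omega>"
    and mv: "norm m = 1" "norm v = 1" "v \<bullet> m = 0"
    and y: "y $ i = y $ j" and s: "s $ i = s $ j" and r: "r \<noteq> 0"
  shows "G (y + relative i j (\<rho> *\<^sub>R circle m v \<theta>), s + relative i j (r *\<^sub>R circle m v (\<theta> + \<beta>))) =
    G (y + (real k * (- 2 * \<rho> * cos \<beta> / r)) *\<^sub>R s + relative i j (\<rho> *\<^sub>R circle m v (\<theta> + real k * (2 * \<beta> + pi))),
       s + relative i j (r *\<^sub>R circle m v (\<theta> + real k * (2 * \<beta> + pi) + \<beta>)))"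
proof (induction k)
  case (Suc k)
  let ?t = "- 2 * \<rho> * cos \<beta> / r"
  have "real (Suc k) * x = real k * x + x" for x by (simp add: algebra_simps)
  moreover have "(y + (real k * ?t) *\<^sub>R s) $ i = (y + (real k * ?t) *\<^sub>R s) $ j" by (simp add: y s)
  ultimately show ?case
    unfolding Suc.IH using chord[OF edge mv _ s r, of "y + (real k * ?t) *\<^sub>R s" "\<theta> + real k * (2 * \<beta> + pi)" \<beta>]
    by (simp only: scaleR_add_left add.assoc)
qed simp

text \<open>When the chords add up to full turns, the pair returns to its phase while
  \<open>y\<close> has advanced by a nonzero multiple of \<open>s\<close>, so \<open>G\<close> is
  periodic along \<open>s\<close> and hence constant. Such angles converge to \<beta>, and
  continuity concludes. The condition on the cosine excludes tangential velocities, whose chords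
  have length zero.\<close>

lemma chord_drift:
  fixes m v :: "real ^ 'd"
  assumes edge: "(i, j) \<in> collision_graph \<rho> L \<Omega>"
    and mv: "norm m = 1" "norm v = 1" "v \<bullet> m = 0"
    and y: "y $ i = y $ j" and s: "s $ i = s $ j" and r: "r \<noteq> 0" and c: "cos \<beta> \<noteq> 0"
  shows "G (y + \<sigma> *\<^sub>R s + relative i j (\<rho> *\<^sub>R m), s + relative i j (r *\<^sub>R circle m v \<beta>)) =
    G (y + relative i j (\<rho> *\<^sub>R m), s + relative i j (r *\<^sub>R circle m v \<beta>))"
proof -
  obtain b where b: "b \<longlonglongrightarrow> \<beta>" and turn: "\<And>k. \<exists>l::int. real (Suc k) * (2 * b k + pi) = 0 + of_int l * (2 * pi)"
    by (fact chord_angle_approximation[of \<beta> 0])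
  define h where "h x \<tau> = G (y + \<tau> *\<^sub>R s + relative i j (\<rho> *\<^sub>R m), s + relative i j (r *\<^sub>R circle m v x))" for x \<tau>
  have eq: "h (b k) \<sigma> = h (b k) 0" if "cos (b k) \<noteq> 0" for k
  proof (rule real_polynomial_function_periodic)
    let ?T = "real (Suc k) * (- 2 * \<rho> * cos (b k) / r)"
    show "real_polynomial_function (h (b k))"
      unfolding h_def[abs_def] by (intro polynomial_intros real_polynomial_function_subst[OF G])
    show "?T \<noteq> 0" using that \<rho> r by simp
    show "h (b k) (\<tau> + ?T) = h (b k) \<tau>" for \<tau>
    proof -
      have "(y + \<tau> *\<^sub>R s) $ i = (y + \<tau> *\<^sub>R s) $ j" by (simp add: y s)
      note iter = chord_iterate[OF edge mv this s r, of 0 "b k" "Suc k"]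
      obtain l :: int where l: "real (Suc k) * (2 * b k + pi) = 0 + of_int l * (2 * pi)"
        using turn by blast
      have c1: "circle m v (0 + real (Suc k) * (2 * b k + pi)) = circle m v 0"
        unfolding l add_0_left using circle_periodic[of m v 0 l] by simp
      have c2: "circle m v (0 + real (Suc k) * (2 * b k + pi) + b k) = circle m v (b k)"
        unfolding l add_0_left using circle_periodic[of m v "b k" l] by (simp add: add.commute)
      have c0: "circle m v 0 = m" by (simp add: circle_def)
      have "y + (\<tau> + ?T) *\<^sub>R s = y + \<tau> *\<^sub>R s + ?T *\<^sub>R s" by (simp only: scaleR_add_left add.assoc)
      then show ?thesis
        using iter[symmetric] unfolding c1 c2 c0 h_def by (simp only: add_0_left)
    qed
  qed
  have lim: "(\<lambda>k. h (b k) \<tau>) \<longlonglongrightarrow> h \<beta> \<tau>" for \<tau>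
  proof -
    have "(\<lambda>k. circle m v (b k)) \<longlonglongrightarrow> circle m v \<beta>"
      by (rule isCont_tendsto_compose[OF isCont_circle b])
    then have "(\<lambda>k. relative i j (r *\<^sub>R circle m v (b k))) \<longlonglongrightarrow> relative i j (r *\<^sub>R circle m v \<beta>)"
      by (intro bounded_linear.tendsto[OF linear_relative[unfolded linear_conv_bounded_linear]] tendsto_scaleR tendsto_const)
    then show ?thesis
      unfolding h_def by (intro isCont_tendsto_compose[OF isCont_G] tendsto_Pair tendsto_add tendsto_const)
  qed
  have "\<forall>\<^sub>F k in sequentially. cos (b k) \<noteq> 0"
    using tendsto_cos[OF b] c by (rule tendsto_imp_eventually_ne)
  then have "\<forall>\<^sub>F k in sequentially. h (b k) \<sigma> = h (b k) 0"
    by eventually_elim (rule eq)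
  then have "(\<lambda>k. h (b k) \<sigma>) \<longlonglongrightarrow> h \<beta> 0"
    using lim[of 0] by (simp only: tendsto_cong)
  then have "h \<beta> \<sigma> = h \<beta> 0"
    using lim by (rule LIMSEQ_unique[rotated])
  then show ?thesis by (simp add: h_def)
qed

end

section \<open>Translation and rotation of the relative motion\<close>

lemma exists_line_sphere_intersection:
  fixes u w :: "'a::euclidean_space"
  assumes "norm u < R" "w \<noteq> 0"
  obtains t where "norm (u + t *\<^sub>R w) = R"
proof -
  let ?T = "(R + norm u) / norm w"
  have R: "R > 0" using assms(1) norm_ge_zero[of u] by linarith
  have T: "?T \<ge> 0" using R by simp
  have "norm (?T *\<^sub>R w) - norm u \<le> norm (?T *\<^sub>R w + u)" by (rule norm_diff_ineq)
  moreover have "norm (?T *\<^sub>R w) = R + norm u" using assms(2) R by simp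
  ultimately have "R \<le> norm (u + ?T *\<^sub>R w)" by (simp add: add.commute)
  then have "\<exists>t. 0 \<le> t \<and> t \<le> ?T \<and> norm (u + t *\<^sub>R w) = R"
    using assms(1) T by (intro IVT) (auto intro!: continuous_intros)
  then show thesis using that by blast
qed

text \<open>Let X be the infinitesimal rotation that maps z to
  \<open>(u \<bullet> z) *\<^sub>R w - (w \<bullet> z) *\<^sub>R u\<close>. Then
  \<open>rotation u w\<close> is X u, and \<open>- rotation w u\<close> is X w. Without
  normalisation it is polynomial in both vectors, quadratic in the first and linear in the
  second.\<close>

definition rotation :: "'a::real_inner \<Rightarrow> 'a \<Rightarrow> 'a" where
  "rotation u w = (u \<bullet> u) *\<^sub>R w - (u \<bullet> w) *\<^sub>R u"

lemma rotation_second_difference: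
  "rotation (u + t *\<^sub>R x) w + rotation (u - t *\<^sub>R x) w - 2 *\<^sub>R rotation u w = (2 * t\<^sup>2) *\<^sub>R rotation x w"
  by (subst vector_eq_rdot[symmetric])
     (simp add: rotation_def inner_add_left inner_add_right inner_diff_left inner_diff_right
       inner_commute[of x u] power2_eq_square algebra_simps)

lemma rotation_linear: "linear (rotation w)"
  by (rule linearI) (simp_all add: rotation_def inner_add_right algebra_simps)

text \<open>The infinitesimal rotation depends only on the exterior product of \<open>u\<close> and
  \<open>w\<close>, which free relative motion leaves unchanged.\<close>

lemma rotation_shift: "rotation (u + t *\<^sub>R w) w = rotation u w - t *\<^sub>R rotation w u"
  by (subst vector_eq_rdot[symmetric])
     (simp add: rotation_def inner_add_left inner_add_right inner_diff_left inner_diff_right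
       inner_commute[of w u] power2_eq_square algebra_simps)

lemma rotation_self: "rotation w w = 0"
  by (simp add: rotation_def)

context polynomial_first_integral
begin

text \<open>Near the origin all balls overlap, so this one ball of positions is inside the cylinder
  of every pair; analyticity extends what is proved there.\<close>

lemma near_origin:
  assumes "q \<in> ball (0 :: real ^ 'd ^ 'n) \<rho>"
  shows "norm (q $ i - q $ j) < 2 * \<rho>"
  using assms Finite_Cartesian_Product.norm_nth_le[of q i] Finite_Cartesian_Product.norm_nth_le[of q j]
    norm_triangle_ineq4[of "q $ i" "q $ j"] by simp

text \<open>The momentum splits into the relative motion of the pair and the rest \<open>s\<close>,
  in which both balls have their mean velocity. From inside the cylinder a free orbit reaches
  contact, where \<open>chord_drift\<close> makes \<open>s\<close> a shift; subtracting it from free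
  motion leaves the relative motion.\<close>

lemma drift_shift:
  assumes edge: "(i, j) \<in> collision_graph \<rho> L \<Omega>"
  shows "relative i j (p $ i - p $ j) \<in> invariant_shifts p"
proof (cases "p $ i = p $ j")
  case True
  then show ?thesis using subspace_0[OF subspace_invariant_shifts] by (simp add: relative_simps)
next
  case False
  have ij: "i \<noteq> j" using edge by (auto simp: collision_graph_def pair_collision_def)
  define w where "w = p $ i - p $ j"
  have w: "w \<noteq> 0" using False by (simp add: w_def)
  define s where "s = p - relative i j ((1 / 2) *\<^sub>R w)"
  have s: "s $ i = s $ j"
  proof -
    have "s $ i - s $ j = w - (relative i j ((1 / 2) *\<^sub>R w) $ i - relative i j ((1 / 2) *\<^sub>R w) $ j)"
      by (simp add: s_def w_def)
    then show ?thesis by (simp add: relative_difference[OF ij])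
  qed
  have drift: "G (q + \<sigma> *\<^sub>R s, p) = G (q, p)" if q: "norm (q $ i - q $ j) < 2 * \<rho>" for q \<sigma>
  proof -
    define u where "u = q $ i - q $ j"
    obtain t where t: "norm (u + t *\<^sub>R w) = 2 * \<rho>"
      using exists_line_sphere_intersection[of u "2 * \<rho>" w] q w by (auto simp: u_def)
    define q' where "q' = q + t *\<^sub>R p"
    have uq': "q' $ i - q' $ j = u + t *\<^sub>R w"
      by (simp add: q'_def u_def w_def algebra_simps)
    define m where "m = (u + t *\<^sub>R w) /\<^sub>R (2 * \<rho>)"
    have m: "norm m = 1" "u + t *\<^sub>R w = (2 * \<rho>) *\<^sub>R m" using t \<rho> by (simp_all add: m_def)
    obtain v r \<beta> where v: "v \<bullet> m = 0" "norm v = norm m" "norm w = r * norm m" "r \<ge> 0"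
      "w = r *\<^sub>R (cos \<beta> *\<^sub>R m + sin \<beta> *\<^sub>R v)" "\<beta> > 0"
    proof (rule polar_form)
      show "2 \<le> DIM(real ^ 'd)" using d by simp
      show "m \<noteq> 0" using m(1) by auto
    qed
    have r: "r \<noteq> 0" using v(3) w m(1) by auto
    \<comment> \<open>If the line were tangent to the sphere at the contact point, none of its
      points would be interior, but \<open>u\<close> is.\<close>
    have "cos \<beta> \<noteq> 0"
    proof
      assume "cos \<beta> = 0"
      then have "m \<bullet> w = 0" using v(1,5) by (simp add: inner_commute)
      then have "(u + t *\<^sub>R w) \<bullet> w = 0" unfolding m(2) by simp
      then have uw: "u \<bullet> w = - t * (w \<bullet> w)" by (simp add: inner_add_left)
      have "norm u ^ 2 = (2 * \<rho>)\<^sup>2 + t\<^sup>2 * (norm w)\<^sup>2"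
        unfolding t[symmetric] power2_norm_eq_inner
        by (simp add: inner_add_left inner_add_right inner_commute[of w u] uw power2_eq_square)
      then have "(2 * \<rho>)\<^sup>2 \<le> (norm u)\<^sup>2" by simp
      then have "2 * \<rho> \<le> norm u" by (rule power2_le_imp_le) simp
      then show False using q by (simp add: u_def)
    qed
    define y where "y = q' - relative i j (\<rho> *\<^sub>R m)"
    have y: "y $ i = y $ j"
    proof -
      have "y $ i - y $ j = (q' $ i - q' $ j) - (relative i j (\<rho> *\<^sub>R m) $ i - relative i j (\<rho> *\<^sub>R m) $ j)"
        by (simp add: y_def)
      then show ?thesis by (simp add: relative_difference[OF ij] uq' m(2))
    qed
    have p: "p = s + relative i j ((r / 2) *\<^sub>R circle m v \<beta>)"
    proof -
      have "(r / 2) *\<^sub>R circle m v \<beta> = (1 / 2) *\<^sub>R w" by (subst v(5)) (simp add: circle_def)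
      then show ?thesis by (simp add: s_def)
    qed
    have "norm v = 1" "r / 2 \<noteq> 0" using v(2) m(1) r by simp_all
    from chord_drift[OF edge m(1) this(1) v(1) y s this(2) \<open>cos \<beta> \<noteq> 0\<close>, of \<sigma>]
    have "G (q' + \<sigma> *\<^sub>R s, p) = G (q', p)"
      unfolding p[symmetric] by (simp add: y_def algebra_simps)
    then show ?thesis
      using free[of "q + \<sigma> *\<^sub>R s" t p] free[of q t p] by (simp add: q'_def algebra_simps)
  qed
  have "s \<in> invariant_shifts p"
  proof (rule invariant_shifts_from_ball[OF \<rho>])
    fix q :: "real ^ 'd ^ 'n" and t assume "q \<in> ball 0 \<rho>"
    then have "norm (q $ i - q $ j) < 2 * \<rho>" by (rule near_origin)
    then show "G (q + t *\<^sub>R s, p) = G (q, p)" by (rule drift)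
  qed
  then have "2 *\<^sub>R (p - s) \<in> invariant_shifts p"
    using subspace_invariant_shifts momentum_shift by (intro subspace_mul subspace_diff) auto
  then show ?thesis by (simp add: s_def relative_simps w_def)
qed

lemma center_shift:
  assumes edge: "(i, j) \<in> collision_graph \<rho> L \<Omega>" and s: "s $ i = s $ j"
  shows "s \<in> invariant_shifts (s + relative i j x)"
proof -
  have ij: "i \<noteq> j" using edge by (auto simp: collision_graph_def pair_collision_def)
  let ?p = "s + relative i j x"
  have "?p $ i - ?p $ j = (s $ i - s $ j) + (relative i j x $ i - relative i j x $ j)" by simp
  also have "\<dots> = 2 *\<^sub>R x" by (simp add: relative_difference[OF ij] s)
  finally have "2 *\<^sub>R relative i j x \<in> invariant_shifts ?p"
    using drift_shift[OF edge, of ?p] by (simp add: relative_simps)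
  then have "(1 / 2) *\<^sub>R (2 *\<^sub>R relative i j x) \<in> invariant_shifts ?p"
    by (rule subspace_mul[OF subspace_invariant_shifts])
  then have "?p - relative i j x \<in> invariant_shifts ?p"
    by (intro subspace_diff[OF subspace_invariant_shifts] momentum_shift) simp
  then show ?thesis by simp
qed

text \<open>Here the chords are tuned to add up to \<phi> modulo full turns, so relative position
  and velocity both turn by \<phi>. The accompanying drift along \<open>s\<close> is discarded by
  \<open>center_shift\<close>.\<close>

lemma chord_rotation:
  fixes m v :: "real ^ 'd"
  assumes edge: "(i, j) \<in> collision_graph \<rho> L \<Omega>"
    and mv: "norm m = 1" "norm v = 1" "v \<bullet> m = 0"
    and y: "y $ i = y $ j" and s: "s $ i = s $ j" and r: "r \<noteq> 0"
  shows "G (y + relative i j (\<rho> *\<^sub>R circle m v \<phi>), s + relative i j (r *\<^sub>R circle m v (\<phi> + \<beta>))) =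
    G (y + relative i j (\<rho> *\<^sub>R m), s + relative i j (r *\<^sub>R circle m v \<beta>))"
proof -
  obtain b where b: "b \<longlonglongrightarrow> \<beta>" and turn: "\<And>k. \<exists>l::int. real (Suc k) * (2 * b k + pi) = \<phi> + of_int l * (2 * pi)"
    by (fact chord_angle_approximation[of \<beta> \<phi>])
  define h where "h \<theta> x = G (y + relative i j (\<rho> *\<^sub>R circle m v \<theta>), s + relative i j (r *\<^sub>R circle m v (\<theta> + x)))" for \<theta> x
  have eq: "h 0 (b k) = h \<phi> (b k)" for k
  proof -
    obtain l :: int where l: "real (Suc k) * (2 * b k + pi) = \<phi> + of_int l * (2 * pi)"
      using turn by blast
    have c1: "circle m v (0 + real (Suc k) * (2 * b k + pi)) = circle m v \<phi>"
      unfolding l add_0_left by (rule circle_periodic)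
    have "\<phi> + of_int l * (2 * pi) + b k = \<phi> + b k + of_int l * (2 * pi)" by simp
    then have c2: "circle m v (0 + real (Suc k) * (2 * b k + pi) + b k) = circle m v (\<phi> + b k)"
      unfolding l add_0_left by (simp only: circle_periodic)
    have assoc: "y + T *\<^sub>R s + z = y + z + T *\<^sub>R s" for T z by simp
    show ?thesis
      unfolding h_def chord_iterate[OF edge mv y s r, of 0 "b k" "Suc k"] c1 c2 assoc
      by (rule invariant_shiftsD[OF center_shift[OF edge s]])
  qed
  have lim: "(\<lambda>k. h \<theta> (b k)) \<longlonglongrightarrow> h \<theta> \<beta>" for \<theta>
  proof -
    have "(\<lambda>k. circle m v (\<theta> + b k)) \<longlonglongrightarrow> circle m v (\<theta> + \<beta>)"
      by (rule isCont_tendsto_compose[OF isCont_circle]) (intro tendsto_add tendsto_const b)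
    then have "(\<lambda>k. relative i j (r *\<^sub>R circle m v (\<theta> + b k))) \<longlonglongrightarrow> relative i j (r *\<^sub>R circle m v (\<theta> + \<beta>))"
      by (intro bounded_linear.tendsto[OF linear_relative[unfolded linear_conv_bounded_linear]] tendsto_scaleR tendsto_const)
    then show ?thesis
      unfolding h_def by (intro isCont_tendsto_compose[OF isCont_G] tendsto_Pair tendsto_add tendsto_const)
  qed
  have "h 0 \<beta> = h \<phi> \<beta>"
    using lim[of 0] lim[of \<phi>] unfolding eq by (rule LIMSEQ_unique)
  moreover have "circle m v 0 = m" by (simp add: circle_def)
  ultimately show ?thesis by (simp add: h_def)
qed

section \<open>Infinitesimal symmetries\<close>

definition DG where "DG x = frechet_derivative G (at x)"

lemma has_derivative_G: "(G has_derivative DG x) (at x)"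
  unfolding DG_def
  using differentiable_at_real_polynomial_function[OF G] frechet_derivative_works by blast

lemma linear_DG: "linear (DG x)"
  using has_derivative_G has_derivative_linear by blast

lemma DG_transform:
  assumes "(h has_derivative h') (at x)" "\<And>z. G (h z) = G z"
  shows "DG (h x) (h' v) = DG x v"
proof -
  have "(G \<circ> h has_derivative DG (h x) \<circ> h') (at x)"
    by (rule diff_chain_at[OF assms(1) has_derivative_G])
  moreover have "G \<circ> h = G" using assms(2) by (simp add: fun_eq_iff)
  ultimately have "DG (h x) \<circ> h' = DG x"
    using has_derivative_G has_derivative_unique by metis
  from fun_cong[OF this, of v] show ?thesis by simp
qed

lemma DG_along_curve:
  assumes "(c has_vector_derivative c') (at t)" "\<And>t. G (c t) = a"
  shows "DG (c t) c' = 0"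
proof -
  have "(G \<circ> c has_derivative DG (c t) \<circ> (\<lambda>h. h *\<^sub>R c')) (at t)"
    using assms(1) unfolding has_vector_derivative_def by (rule diff_chain_at[OF _ has_derivative_G])
  moreover have "G \<circ> c = (\<lambda>_. a)" using assms(2) by (simp add: fun_eq_iff)
  ultimately have "DG (c t) \<circ> (\<lambda>h. h *\<^sub>R c') = (\<lambda>_. 0)"
    using has_derivative_unique has_derivative_const by metis
  from fun_cong[OF this, of 1] show ?thesis by simp
qed

lemma DG_shift:
  assumes "v \<in> invariant_shifts p"
  shows "DG (q, p) (v, 0) = 0"
proof -
  have "((\<lambda>t. (q + t *\<^sub>R v, p)) has_derivative (\<lambda>h. (h *\<^sub>R v, 0))) (at 0)"
    by (auto intro!: derivative_eq_intros)
  then have "((\<lambda>t. (q + t *\<^sub>R v, p)) has_vector_derivative (v, 0)) (at 0)"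
    by (simp add: has_vector_derivative_def)
  from DG_along_curve[OF this invariant_shiftsD[OF assms]] show ?thesis by simp
qed

lemma shift_from_DG:
  assumes e: "e > 0" and D: "\<And>q. q \<in> ball 0 e \<Longrightarrow> DG (q, p) (v, 0) = 0"
  shows "v \<in> invariant_shifts p"
proof -
  let ?e = "e / (norm v + 1)"
  have pos: "norm v + 1 > 0" by (simp add: add_nonneg_pos)
  have e': "?e > 0" using e pos by simp
  show ?thesis
  proof (rule invariant_shifts_from_ball[OF e'])
    fix q :: "real ^ 'd ^ 'n" and t assume q: "q \<in> ball 0 ?e" and t: "\<bar>t\<bar> < ?e"
    have "((\<lambda>t. G (q + t *\<^sub>R v, p)) has_derivative (\<lambda>h. 0)) (at x within {- ?e<..<?e})" if x: "x \<in> {- ?e<..<?e}" for x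
    proof -
      have "((\<lambda>t. (q + t *\<^sub>R v, p)) has_derivative (\<lambda>h. (h *\<^sub>R v, 0))) (at x)"
        by (auto intro!: derivative_eq_intros)
      from diff_chain_at[OF this has_derivative_G]
      have 1: "((\<lambda>t. G (q + t *\<^sub>R v, p)) has_derivative (\<lambda>h. DG (q + x *\<^sub>R v, p) (h *\<^sub>R v, 0))) (at x)"
        by (simp add: o_def)
      have "norm (q + x *\<^sub>R v) \<le> norm q + \<bar>x\<bar> * norm v" using norm_triangle_ineq[of q "x *\<^sub>R v"] by simp
      also have "\<dots> < ?e + ?e * norm v"
        using q x by (intro add_less_le_mono mult_right_mono) auto
      also have "\<dots> = ?e * (norm v + 1)" by (simp only: distrib_left mult_1_right add.commute)
      also have "\<dots> = e" using pos by simp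
      finally have "DG (q + x *\<^sub>R v, p) (v, 0) = 0" by (intro D) simp
      then have "DG (q + x *\<^sub>R v, p) (h *\<^sub>R v, 0) = 0" for h
        using linear_cmul[OF linear_DG, of "(q + x *\<^sub>R v, p)" h "(v, 0)"] by simp
      then show ?thesis using 1 by (simp add: has_derivative_at_withinI)
    qed
    then obtain a where "\<forall>x\<in>{- ?e<..<?e}. G (q + x *\<^sub>R v, p) = a"
      using has_derivative_zero_constant[of "{- ?e<..<?e}" "\<lambda>t. G (q + t *\<^sub>R v, p)"] convex_real_interval by blast
    moreover have "t \<in> {- ?e<..<?e}"
      using t unfolding greaterThanLessThan_iff abs_less_iff by linarith
    moreover have "0 \<in> {- ?e<..<?e}"
      using e' unfolding greaterThanLessThan_iff by linarith
    ultimately have "G (q + t *\<^sub>R v, p) = a" "G (q + 0 *\<^sub>R v, p) = a" by blast+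
    then show "G (q + t *\<^sub>R v, p) = G (q, p)" by simp
  qed
qed

end

lemma second_difference_zero:
  fixes F :: "'a::real_vector \<Rightarrow> 'b::real_vector"
  assumes "linear F" "F a = 0" "F b = 0" "F c = 0" "a + b - 2 *\<^sub>R c = r *\<^sub>R v" "r \<noteq> 0"
  shows "F v = 0"
proof -
  have "r *\<^sub>R F v = F (a + b - 2 *\<^sub>R c)"
    unfolding assms(5) linear_cmul[OF assms(1)] ..
  also have "\<dots> = 0"
    using assms(2-4) by (simp add: linear_add[OF assms(1)] linear_diff[OF assms(1)] linear_cmul[OF assms(1)])
  finally show ?thesis using assms(6) by simp
qed

context polynomial_first_integral
begin

lemma rotation_derivative_contact:
  assumes edge: "(i, j) \<in> collision_graph \<rho> L \<Omega>"
    and u: "q $ i - q $ j = u" "norm u = 2 * \<rho>" and w: "p $ i - p $ j = w"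
  shows "DG (q, p) (relative i j (rotation u w), - relative i j (rotation w u)) = 0"
proof (cases "w = 0")
  case True
  then show ?thesis using linear_0[OF linear_DG, of "(q, p)"] by (simp add: rotation_def relative_simps zero_prod_def)
next
  case False
  have ij: "i \<noteq> j" using edge by (auto simp: collision_graph_def pair_collision_def)
  define m where "m = u /\<^sub>R (2 * \<rho>)"
  have m: "norm m = 1" "u = (2 * \<rho>) *\<^sub>R m" using u(2) \<rho> by (simp_all add: m_def)
  obtain v r' \<beta> where v: "v \<bullet> m = 0" "norm v = norm m" "norm w = r' * norm m" "r' \<ge> 0"
    "w = r' *\<^sub>R (cos \<beta> *\<^sub>R m + sin \<beta> *\<^sub>R v)" "\<beta> > 0"
  proof (rule polar_form)
    show "2 \<le> DIM(real ^ 'd)" using d by simp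
    show "m \<noteq> 0" using m(1) by auto
  qed
  have v1: "norm v = 1" using v(2) m(1) by simp
  define r where "r = r' / 2"
  have r: "r \<noteq> 0" using v(3) False m(1) by (auto simp: r_def)
  have wr: "w = (2 * r) *\<^sub>R circle m v \<beta>" using v(5) by (simp add: r_def circle_def)
  define y where "y = q - relative i j (\<rho> *\<^sub>R m)"
  define s where "s = p - relative i j (r *\<^sub>R circle m v \<beta>)"
  have y: "y $ i = y $ j"
  proof -
    have "y $ i - y $ j = (q $ i - q $ j) - (relative i j (\<rho> *\<^sub>R m) $ i - relative i j (\<rho> *\<^sub>R m) $ j)"
      by (simp add: y_def)
    then show ?thesis by (simp add: relative_difference[OF ij] u(1) m(2))
  qed
  have s: "s $ i = s $ j"
  proof -
    have "s $ i - s $ j = (p $ i - p $ j) - (relative i j (r *\<^sub>R circle m v \<beta>) $ i - relative i j (r *\<^sub>R circle m v \<beta>) $ j)"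
      by (simp add: s_def)
    then show ?thesis by (simp add: relative_difference[OF ij] w wr)
  qed
  define c where "c \<phi> = (y + relative i j (\<rho> *\<^sub>R circle m v \<phi>), s + relative i j (r *\<^sub>R circle m v (\<phi> + \<beta>)))" for \<phi>
  let ?c' = "(relative i j (\<rho> *\<^sub>R v), relative i j (r *\<^sub>R (cos \<beta> *\<^sub>R v - sin \<beta> *\<^sub>R m)))"
  have c0: "c 0 = (q, p)" by (simp add: c_def y_def s_def circle_def)
  have "(c has_vector_derivative ?c') (at 0)"
  proof -
    have lin: "bounded_linear (relative i j :: real ^ 'd \<Rightarrow> real ^ 'd ^ 'n)"
      using linear_relative linear_conv_bounded_linear by blast
    have c: "c \<phi> = (y + (cos \<phi> *\<^sub>R relative i j (\<rho> *\<^sub>R m) + sin \<phi> *\<^sub>R relative i j (\<rho> *\<^sub>R v)),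
        s + (cos (\<phi> + \<beta>) *\<^sub>R relative i j (r *\<^sub>R m) + sin (\<phi> + \<beta>) *\<^sub>R relative i j (r *\<^sub>R v)))" for \<phi>
      by (simp add: c_def circle_def relative_simps scaleR_add_right mult.commute)
    show ?thesis
      unfolding c has_vector_derivative_def
      by (auto intro!: derivative_eq_intros simp: relative_simps algebra_simps)
  qed
  then have "DG (c 0) ?c' = 0"
  proof (rule DG_along_curve)
    show "G (c \<phi>) = G (q, p)" for \<phi>
      unfolding c_def chord_rotation[OF edge m(1) v1 v(1) y s r] by (simp add: y_def s_def)
  qed
  then have D: "DG (q, p) ?c' = 0" unfolding c0 .
  \<comment> \<open>The factor is twice the signed area \<open>4 * \<rho> * r * sin \<beta>\<close>
    of the parallelogram of \<open>u\<close> and \<open>w\<close>; the doubling comes from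
    \<open>relative\<close>, which carries half of the relative coordinate. It turns rotation at
    unit speed into the polynomial generator.\<close>
  have "DG (q, p) ((8 * \<rho> * r * sin \<beta>) *\<^sub>R ?c') = 0"
    unfolding linear_cmul[OF linear_DG] D by simp
  moreover have "rotation u w = (8 * \<rho> * r * sin \<beta>) *\<^sub>R (\<rho> *\<^sub>R v)"
    and "rotation w u = - ((8 * \<rho> * r * sin \<beta>) *\<^sub>R (r *\<^sub>R (cos \<beta> *\<^sub>R v - sin \<beta> *\<^sub>R m)))"
  proof -
    have mm: "m \<bullet> m = 1" "v \<bullet> v = 1" using m(1) v1 by (simp_all flip: power2_norm_eq_inner)
    have uw: "w \<bullet> u = 4 * \<rho> * r * cos \<beta>"
      using v(1) by (simp add: m(2) wr circle_def inner_add_left mm)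
    have ww: "w \<bullet> w = 4 * r\<^sup>2"
      using inner_circle[OF m(1) v1 v(1), of \<beta> \<beta>] by (simp add: wr power2_eq_square)
    have uu: "u \<bullet> u = 4 * \<rho>\<^sup>2"
      by (simp add: m(2) mm power2_eq_square)
    show "rotation u w = (8 * \<rho> * r * sin \<beta>) *\<^sub>R (\<rho> *\<^sub>R v)"
    proof (subst vector_eq_rdot[symmetric], rule allI)
      fix z
      have "rotation u w \<bullet> z = 4 * \<rho>\<^sup>2 * (2 * r * (cos \<beta> * (m \<bullet> z) + sin \<beta> * (v \<bullet> z))) - 4 * \<rho> * r * cos \<beta> * (2 * \<rho> * (m \<bullet> z))"
        unfolding rotation_def uu inner_commute[of u w] uw by (simp add: m(2) wr circle_def inner_diff_left inner_add_left)
      also have "\<dots> = (8 * \<rho> * r * sin \<beta>) *\<^sub>R (\<rho> *\<^sub>R v) \<bullet> z"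
        by (simp add: power2_eq_square algebra_simps)
      finally show "rotation u w \<bullet> z = (8 * \<rho> * r * sin \<beta>) *\<^sub>R (\<rho> *\<^sub>R v) \<bullet> z" .
    qed
    show "rotation w u = - ((8 * \<rho> * r * sin \<beta>) *\<^sub>R (r *\<^sub>R (cos \<beta> *\<^sub>R v - sin \<beta> *\<^sub>R m)))"
    proof (subst vector_eq_rdot[symmetric], rule allI)
      fix z
      have "rotation w u \<bullet> z = 4 * r\<^sup>2 * (2 * \<rho> * (m \<bullet> z)) - 4 * \<rho> * r * cos \<beta> * (2 * r * (cos \<beta> * (m \<bullet> z) + sin \<beta> * (v \<bullet> z)))"
        unfolding rotation_def uw ww by (simp add: m(2) wr circle_def inner_diff_left inner_add_left)
      also have "\<dots> = 8 * r\<^sup>2 * \<rho> * ((m \<bullet> z) * (1 - (cos \<beta>)\<^sup>2) - cos \<beta> * sin \<beta> * (v \<bullet> z))"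
        by (simp add: power2_eq_square algebra_simps)
      also have "1 - (cos \<beta>)\<^sup>2 = (sin \<beta>)\<^sup>2" by (simp add: cos_squared_eq)
      also have "8 * r\<^sup>2 * \<rho> * ((m \<bullet> z) * (sin \<beta>)\<^sup>2 - cos \<beta> * sin \<beta> * (v \<bullet> z)) =
          - ((8 * \<rho> * r * sin \<beta>) *\<^sub>R (r *\<^sub>R (cos \<beta> *\<^sub>R v - sin \<beta> *\<^sub>R m))) \<bullet> z"
        by (simp add: inner_diff_left power2_eq_square algebra_simps)
      finally show "rotation w u \<bullet> z = - ((8 * \<rho> * r * sin \<beta>) *\<^sub>R (r *\<^sub>R (cos \<beta> *\<^sub>R v - sin \<beta> *\<^sub>R m))) \<bullet> z" .
    qed
  qed
  ultimately show ?thesis by (simp only: relative_simps scaleR_Pair minus_minus)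
qed

lemma relative_velocity_linear: "linear (\<lambda>p :: real ^ 'd ^ 'n. relative i j (p $ i - p $ j))"
  by (rule linearI) (simp_all add: relative_simps algebra_simps)

lemma has_derivative_drift:
  assumes "linear A"
  shows "((\<lambda>z :: (real ^ 'd ^ 'n) \<times> (real ^ 'd ^ 'n). (fst z + t *\<^sub>R A (snd z), snd z))
    has_derivative (\<lambda>z. (fst z + t *\<^sub>R A (snd z), snd z))) (at x)"
proof -
  have "linear (\<lambda>z :: (real ^ 'd ^ 'n) \<times> (real ^ 'd ^ 'n). (fst z + t *\<^sub>R A (snd z), snd z))"
    by (rule linearI) (simp_all add: linear_add[OF assms] linear_cmul[OF assms] algebra_simps)
  then show ?thesis by (rule linear_imp_has_derivative)
qed

text \<open>The shear that adds \<open>t *\<^sub>R A p\<close> to the position is a symmetry of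
  \<open>G\<close>. As \<open>A\<close> depends on the momentum, its differential also moves the
  position when the momentum varies.\<close>

lemma DG_drift:
  assumes "linear A" "\<And>p. A p \<in> invariant_shifts p"
  shows "DG (q + t *\<^sub>R A p, p) (v + t *\<^sub>R A w, w) = DG (q, p) (v, w)"
  using DG_transform[OF has_derivative_drift[OF assms(1), of t "(q, p)"], of "(v, w)"]
    invariant_shiftsD[OF assms(2)] by simp

text \<open>The shear along the relative velocity carries an interior point to contact, and by
  \<open>rotation_shift\<close> it carries the generator to the generator there.\<close>

lemma rotation_derivative:
  assumes edge: "(i, j) \<in> collision_graph \<rho> L \<Omega>"
    and u: "q $ i - q $ j = u" "norm u < 2 * \<rho>" and w: "p $ i - p $ j = w"
  shows "DG (q, p) (relative i j (rotation u w), - relative i j (rotation w u)) = 0"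
proof (cases "w = 0")
  case True
  then show ?thesis using linear_0[OF linear_DG, of "(q, p)"] by (simp add: rotation_def relative_simps zero_prod_def)
next
  case False
  have ij: "i \<noteq> j" using edge by (auto simp: collision_graph_def pair_collision_def)
  obtain t where t: "norm (u + t *\<^sub>R w) = 2 * \<rho>"
    using exists_line_sphere_intersection[OF u(2) False] by blast
  let ?A = "\<lambda>p. relative i j (p $ i - p $ j)"
  \<comment> \<open>Half the time, because the opposite displacements of the two balls add up in the
    relative position.\<close>
  let ?q = "q + (t / 2) *\<^sub>R ?A p"
  have "?q $ i - ?q $ j = (q $ i - q $ j) + (t / 2) *\<^sub>R (?A p $ i - ?A p $ j)"
    by (simp add: algebra_simps)
  then have uq: "?q $ i - ?q $ j = u + t *\<^sub>R w"
    by (simp add: relative_difference[OF ij] u w)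
  have rot_w: "rotation w (u + t *\<^sub>R w) = rotation w u"
    by (simp add: linear_add[OF rotation_linear] linear_cmul[OF rotation_linear] rotation_self)
  have A: "?A (- relative i j x) = - (2 *\<^sub>R relative i j x)" for x
  proof -
    have "(- relative i j x) $ i - (- relative i j x) $ j = - (relative i j x $ i - relative i j x $ j)" by simp
    then show ?thesis by (simp only: relative_difference[OF ij] relative_simps)
  qed
  have "DG (?q, p) (relative i j (rotation u w) + (t / 2) *\<^sub>R ?A (- relative i j (rotation w u)), - relative i j (rotation w u)) = 0"
    using rotation_derivative_contact[OF edge uq t w]
    unfolding rot_w rotation_shift A by (simp add: relative_simps)
  moreover have "DG (?q, p) (relative i j (rotation u w) + (t / 2) *\<^sub>R ?A (- relative i j (rotation w u)), - relative i j (rotation w u)) =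
      DG (q, p) (relative i j (rotation u w), - relative i j (rotation w u))"
    by (rule DG_drift[OF relative_velocity_linear drift_shift[OF edge]])
  ultimately show ?thesis by (simp only:)
qed

(* The reflected relative velocity is the relative velocity plus twice this vector. *)
lemma wall_shift:
  assumes edge: "(i, j) \<in> collision_graph \<rho> L \<Omega>"
    and wall: "\<And>z p. z $ i $ k = c \<Longrightarrow> G (z, p - (2 * p $ i $ k) *\<^sub>R axis i (axis k 1)) = G (z, p)"
  shows "(p $ j $ k) *\<^sub>R axis i (axis k 1) + (p $ i $ k) *\<^sub>R axis j (axis k 1) \<in> invariant_shifts p"
proof -
  have ij: "i \<noteq> j" using edge by (auto simp: collision_graph_def pair_collision_def)
  let ?e = "\<lambda>a. axis a (axis k 1) :: real ^ 'd ^ 'n"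
  let ?A = "\<lambda>p. (p $ j $ k) *\<^sub>R ?e i + (p $ i $ k) *\<^sub>R ?e j"
  let ?R = "\<lambda>p. p - (2 * p $ i $ k) *\<^sub>R ?e i"
  let ?S = "\<lambda>q. q + (2 * (c - q $ i $ k)) *\<^sub>R ?e i"
  have ei: "?e i $ i $ k = 1" by (simp add: axis_def)
  \<comment> \<open>Fly to the hyperplane of the wall, reflect, and fly for the opposite time: the
    position is then mirrored in the wall. The flight time has the normal velocity as its
    denominator, a restriction removed at the end by \<open>invariant_shifts_extend\<close>.\<close>
  have reflect: "G (?S q, ?R p) = G (q, p)" if "p $ i $ k \<noteq> 0" for q p
  proof -
    define t where "t = (c - q $ i $ k) / p $ i $ k"
    have "(q + t *\<^sub>R p) $ i $ k = c" using that by (simp add: t_def)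
    from wall[OF this, of p] have 1: "G (q + t *\<^sub>R p, ?R p) = G (q, p)" by (simp add: free)
    have "t * p $ i $ k = c - q $ i $ k" using that by (simp add: t_def)
    moreover have "q + t *\<^sub>R p + (- t) *\<^sub>R ?R p = q + (2 * (t * p $ i $ k)) *\<^sub>R ?e i"
      by (simp add: scaleR_diff_right mult.left_commute)
    ultimately have 2: "q + t *\<^sub>R p + (- t) *\<^sub>R ?R p = ?S q" by (simp only:)
    have "G (q + t *\<^sub>R p + (- t) *\<^sub>R ?R p, ?R p) = G (q + t *\<^sub>R p, ?R p)" by (rule free)
    then show ?thesis unfolding 1 2 .
  qed
  have main: "?A p \<in> invariant_shifts p" if p: "p $ i $ k \<noteq> 0" for p
  proof -
    let ?V = "relative i j (?R p $ i - ?R p $ j)"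
    have V: "?V \<in> invariant_shifts (?R p)" by (rule drift_shift[OF edge])
    \<comment> \<open>The affine mirror map has linear part \<open>?R\<close>, so it converts a
      shift at the reflected momentum into its mirror image at \<open>p\<close>.\<close>
    have "?R ?V \<in> invariant_shifts p"
      unfolding invariant_shifts_def mem_Collect_eq
    proof (intro allI)
      fix q t
      have "G (q + t *\<^sub>R ?R ?V, p) = G (?S (q + t *\<^sub>R ?R ?V), ?R p)"
        by (rule reflect[OF p, symmetric])
      also have "?S (q + t *\<^sub>R ?R ?V) = ?S q + t *\<^sub>R ?V"
      proof -
        have "?S (q + t *\<^sub>R (V - (2 * V $ i $ k) *\<^sub>R ?e i)) = ?S q + t *\<^sub>R V" for V
          using ei by (simp add: algebra_simps)
        then show ?thesis .
      qed
      also have "G (?S q + t *\<^sub>R ?V, ?R p) = G (?S q, ?R p)" by (rule invariant_shiftsD[OF V])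
      also have "\<dots> = G (q, p)" by (rule reflect[OF p])
      finally show "G (q + t *\<^sub>R ?R ?V, p) = G (q, p)" .
    qed
    then have "(1 / 2) *\<^sub>R (?R ?V - relative i j (p $ i - p $ j)) \<in> invariant_shifts p"
      using drift_shift[OF edge, of p]
      by (rule subspace_mul[OF subspace_invariant_shifts subspace_diff[OF subspace_invariant_shifts]])
    also have "(1 / 2) *\<^sub>R (?R ?V - relative i j (p $ i - p $ j)) = ?A p"
      using ij by (simp add: vec_eq_iff relative_nth) (auto simp: axis_def)
    finally show ?thesis .
  qed
  show ?thesis
  proof (rule invariant_shifts_extend[of ?A 1 "?e i"])
    have "linear ?A" by (rule linearI) (simp_all add: algebra_simps)
    then show "polynomial_function ?A" by (rule polynomial_function_linear)
    show "?A p \<in> invariant_shifts p" if "p \<in> ball (?e i) 1" for p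
    proof (rule main)
      have "\<bar>(?e i - p) $ i $ k\<bar> \<le> norm ((?e i - p) $ i)" using component_le_norm_cart by blast
      also have "\<dots> \<le> norm (?e i - p)" by (rule Finite_Cartesian_Product.norm_nth_le)
      also have "\<dots> < 1" using that by (simp add: dist_norm)
      finally show "p $ i $ k \<noteq> 0" using ei by auto
    qed
  qed simp
qed

end

section \<open>Independence of the position\<close>

lemma second_difference_combination:
  fixes a :: "'a::real_inner"
  shows "(a - t *\<^sub>R (b + t *\<^sub>R c)) + (a' - (- t) *\<^sub>R (b + (- t) *\<^sub>R c)) - 2 *\<^sub>R a0
        = (a + a' - 2 *\<^sub>R a0) - (2 * t\<^sup>2) *\<^sub>R c"
  by (subst vector_eq_rdot[symmetric])
     (simp add: inner_add_left inner_diff_left power2_eq_square algebra_simps)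

lemma wall_combination:
  fixes x y :: "'a::real_inner"
  shows "a\<^sup>2 *\<^sub>R x - a\<^sup>2 *\<^sub>R (a *\<^sub>R y) - (a\<^sup>2 * a - c * a) *\<^sub>R y = a\<^sup>2 *\<^sub>R x + (a * (c - 2 * a\<^sup>2)) *\<^sub>R y"
  by (subst vector_eq_rdot[symmetric])
     (simp add: inner_add_left inner_diff_left power2_eq_square algebra_simps)

context polynomial_first_integral
begin

lemma invariant_shifts_generic:
  assumes "continuous_on UNIV c" "c p0 \<noteq> (0::real)" "\<And>p. c p \<noteq> 0 \<Longrightarrow> v \<in> invariant_shifts p"
  shows "v \<in> invariant_shifts p"
proof -
  have "open {p. c p \<noteq> 0}"
    using assms(1) by (intro open_Collect_neq continuous_on_const)
  moreover have "p0 \<in> {p. c p \<noteq> 0}"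
    using assms(2) by simp
  ultimately obtain e where e: "e > 0" "ball p0 e \<subseteq> {p. c p \<noteq> 0}"
    by (rule openE)
  show ?thesis
    by (rule invariant_shifts_extend[OF polynomial_function_const e(1)]) (use e(2) in \<open>auto intro: assms(3)\<close>)
qed

text \<open>As the relative position moves by \<open>t *\<^sub>R x\<close>, the momentum part of the
  transported generator is affine in \<open>t\<close> and the position part quadratic. The second
  difference thus removes the momentum part and the base point \<open>u\<close> together. The map
  \<open>B\<close> accounts for the differential of a velocity-dependent shear and leaves a
  second-order contribution.\<close>

lemma DG_second_difference:
  assumes u: "norm u < 2 * \<rho>" and B: "linear B"
    and D: "\<And>t. norm (u + t *\<^sub>R x) < 2 * \<rho> \<Longrightarrow>
      DG (q, p) (relative i j (rotation (u + t *\<^sub>R x) w) - t *\<^sub>R B (rotation w (u + t *\<^sub>R x)),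
        - relative i j (rotation w (u + t *\<^sub>R x))) = 0"
  shows "DG (q, p) (relative i j (rotation x w) - B (rotation w x), 0) = 0"
proof -
  \<comment> \<open>A step for which both displaced relative positions stay inside the
    cylinder.\<close>
  define \<tau> where "\<tau> = (2 * \<rho> - norm u) / (norm x + 1)"
  have pos: "norm x + 1 > 0" by (simp add: add_nonneg_pos)
  have \<tau>: "\<tau> > 0" using u pos by (simp add: \<tau>_def)
  have "\<tau> * norm x < \<tau> * (norm x + 1)" using \<tau> by simp
  also have "\<dots> = 2 * \<rho> - norm u" using pos by (simp add: \<tau>_def)
  finally have near: "norm (u + t *\<^sub>R x) < 2 * \<rho>" if "\<bar>t\<bar> \<le> \<tau>" for t
    using norm_triangle_ineq[of u "t *\<^sub>R x"] mult_right_mono[OF that, of "norm x"] by simp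
  let ?V = "\<lambda>t. (relative i j (rotation (u + t *\<^sub>R x) w) - t *\<^sub>R B (rotation w (u + t *\<^sub>R x)),
        - relative i j (rotation w (u + t *\<^sub>R x)))"
  have lin: "rotation w (u + t *\<^sub>R x) = rotation w u + t *\<^sub>R rotation w x" for t
    by (simp add: linear_add[OF rotation_linear] linear_cmul[OF rotation_linear])
  have rel2: "relative i j (rotation (u + \<tau> *\<^sub>R x) w) + relative i j (rotation (u - \<tau> *\<^sub>R x) w)
      - 2 *\<^sub>R relative i j (rotation u w) = (2 * \<tau>\<^sup>2) *\<^sub>R relative i j (rotation x w)"
    using arg_cong[OF rotation_second_difference[of u \<tau> x w], of "relative i j"] by (simp only: relative_simps)
  have B: "B (rotation w u + t *\<^sub>R rotation w x) = B (rotation w u) + t *\<^sub>R B (rotation w x)" for t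
    by (simp add: linear_add[OF B] linear_cmul[OF B])
  show ?thesis
  proof (rule second_difference_zero[OF linear_DG, of _ "?V \<tau>" "?V (- \<tau>)" "?V 0" "2 * \<tau>\<^sup>2"])
    show "DG (q, p) (?V \<tau>) = 0" "DG (q, p) (?V (- \<tau>)) = 0" "DG (q, p) (?V 0) = 0"
    proof -
      have "DG (q, p) (?V t) = 0" if "\<bar>t\<bar> \<le> \<tau>" for t by (rule D[OF near[OF that]])
      then show "DG (q, p) (?V \<tau>) = 0" "DG (q, p) (?V (- \<tau>)) = 0" "DG (q, p) (?V 0) = 0"
        using \<tau> by (simp_all only: abs_minus_cancel abs_of_pos abs_zero order_refl order_less_imp_le)
    qed
    show "2 * \<tau>\<^sup>2 \<noteq> 0" using \<tau> by simp
    from second_difference_combination[of "relative i j (rotation (u + \<tau> *\<^sub>R x) w)" \<tau> "B (rotation w u)" "B (rotation w x)"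
        "relative i j (rotation (u - \<tau> *\<^sub>R x) w)" "relative i j (rotation u w)"]
    have 1: "fst (?V \<tau>) + fst (?V (- \<tau>)) - 2 *\<^sub>R fst (?V 0) = (2 * \<tau>\<^sup>2) *\<^sub>R (relative i j (rotation x w) - B (rotation w x))"
      unfolding lin B rel2 by (simp add: scaleR_diff_right)
    have 2: "snd (?V \<tau>) + snd (?V (- \<tau>)) - 2 *\<^sub>R snd (?V 0) = 0"
      unfolding lin by (simp add: relative_simps scaleR_2)
    show "?V \<tau> + ?V (- \<tau>) - 2 *\<^sub>R ?V 0 = (2 * \<tau>\<^sup>2) *\<^sub>R (relative i j (rotation x w) - B (rotation w x), 0)"
    proof (rule prod_eqI)
      show "fst (?V \<tau> + ?V (- \<tau>) - 2 *\<^sub>R ?V 0) = fst ((2 * \<tau>\<^sup>2) *\<^sub>R (relative i j (rotation x w) - B (rotation w x), 0))"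
        unfolding fst_add fst_diff fst_scaleR 1 by (simp only: fst_conv)
      show "snd (?V \<tau> + ?V (- \<tau>) - 2 *\<^sub>R ?V 0) = snd ((2 * \<tau>\<^sup>2) *\<^sub>R (relative i j (rotation x w) - B (rotation w x), 0))"
        unfolding snd_add snd_diff snd_scaleR 2 by (simp only: snd_conv scaleR_zero_right)
    qed
  qed
qed

text \<open>The shear of \<open>wall_shift\<close> changes the relative position in direction
  \<open>k\<close> only. The second difference along it gives a combination of the relative
  velocity, already known to be a shift, and of \<open>relative i j (axis k 1)\<close>. Generically
  this makes the latter a shift, and combining it with \<open>wall_shift\<close> isolates ball
  \<open>i\<close>.\<close>

lemma wall_independence:
  assumes edge: "(i, j) \<in> collision_graph \<rho> L \<Omega>"
    and wall: "\<And>z p. z $ i $ k = c \<Longrightarrow> G (z, p - (2 * p $ i $ k) *\<^sub>R axis i (axis k 1)) = G (z, p)"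
  shows "axis i (axis k 1) \<in> invariant_shifts p"
proof -
  have ij: "i \<noteq> j" using edge by (auto simp: collision_graph_def pair_collision_def)
  let ?e = "\<lambda>a. axis a (axis k 1) :: real ^ 'd ^ 'n" and ?ek = "axis k 1 :: real ^ 'd"
  let ?A = "\<lambda>p. (p $ j $ k) *\<^sub>R ?e i + (p $ i $ k) *\<^sub>R ?e j"
  have linA: "linear ?A" by (rule linearI) (simp_all add: algebra_simps)
  note A = wall_shift[OF edge wall]
  have e_nth: "?e a $ b = (if a = b then ?ek else 0)" for a b by (simp add: axis_def)
  have ek: "?ek $ k = 1" "v \<bullet> ?ek = v $ k" "?ek \<bullet> v = v $ k" for v by (simp_all add: inner_axis inner_axis')
  have rel_k: "relative i j ?ek = ?e i - ?e j" by (simp add: relative_def)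
  have rel: "relative i j ?ek \<in> invariant_shifts p"
    if generic: "(p $ i - p $ j) $ k * ((p $ i - p $ j) \<bullet> (p $ i - p $ j) - 2 * ((p $ i - p $ j) $ k)\<^sup>2) \<noteq> 0" for p
  proof (rule shift_from_DG[OF \<rho>])
    fix q assume "q \<in> ball (0 :: real ^ 'd ^ 'n) \<rho>"
    then have near: "norm (q $ i - q $ j) < 2 * \<rho>" by (rule near_origin)
    define u where "u = q $ i - q $ j"
    define w where "w = p $ i - p $ j"
    \<comment> \<open>The rate \<open>p $ j $ k - p $ i $ k\<close> at which the shear changes the
      relative position in direction \<open>k\<close>. The map \<open>B\<close> below is the shear
      direction evaluated at \<open>- relative i j y\<close>, the momentum part of the
      generator.\<close>
    define x where "x = (- (w $ k)) *\<^sub>R ?ek"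
    define B :: "real ^ 'd \<Rightarrow> real ^ 'd ^ 'n" where "B y = (y $ k) *\<^sub>R relative i j ?ek" for y
    have "linear B" by (rule linearI) (simp_all add: B_def algebra_simps)
    have main: "DG (q, p) (relative i j (rotation x w) - B (rotation w x), 0) = 0"
    proof (rule DG_second_difference[OF near[folded u_def] \<open>linear B\<close>])
      fix t assume t: "norm (u + t *\<^sub>R x) < 2 * \<rho>"
      have uq: "(q + t *\<^sub>R ?A p) $ i - (q + t *\<^sub>R ?A p) $ j = u + t *\<^sub>R x"
        using ij by (simp add: e_nth u_def x_def w_def algebra_simps)
      have AB: "?A (- relative i j y) = B y" for y
        using ij unfolding B_def rel_k by (simp add: relative_nth scaleR_diff_right)
      let ?W = "- relative i j (rotation w (u + t *\<^sub>R x))"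
      have "DG (q + t *\<^sub>R ?A p, p) ((relative i j (rotation (u + t *\<^sub>R x) w) - t *\<^sub>R B (rotation w (u + t *\<^sub>R x)))
          + t *\<^sub>R ?A ?W, ?W) = 0"
        unfolding AB using rotation_derivative[OF edge uq t w_def[symmetric]] by simp
      moreover have "DG (q + t *\<^sub>R ?A p, p) ((relative i j (rotation (u + t *\<^sub>R x) w) - t *\<^sub>R B (rotation w (u + t *\<^sub>R x)))
          + t *\<^sub>R ?A ?W, ?W) = DG (q, p) (relative i j (rotation (u + t *\<^sub>R x) w) - t *\<^sub>R B (rotation w (u + t *\<^sub>R x)), ?W)"
        by (rule DG_drift[OF linA A])
      ultimately show "DG (q, p) (relative i j (rotation (u + t *\<^sub>R x) w) - t *\<^sub>R B (rotation w (u + t *\<^sub>R x)), ?W) = 0"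
        by (simp only:)
    qed
    have V: "relative i j (rotation x w) - B (rotation w x) =
        (w $ k)\<^sup>2 *\<^sub>R relative i j w + (w $ k * (w \<bullet> w - 2 * (w $ k)\<^sup>2)) *\<^sub>R relative i j ?ek"
    proof -
      have r: "rotation x w = (w $ k)\<^sup>2 *\<^sub>R w - (w $ k)\<^sup>2 *\<^sub>R (w $ k *\<^sub>R ?ek)"
        by (simp add: rotation_def x_def ek power2_eq_square)
      have "rotation w x $ k = (w $ k)\<^sup>2 * w $ k - (w \<bullet> w) * w $ k"
        by (simp add: rotation_def x_def ek power2_eq_square)
      then have Bx: "B (rotation w x) = ((w $ k)\<^sup>2 * w $ k - (w \<bullet> w) * w $ k) *\<^sub>R relative i j ?ek"
        by (simp add: B_def)
      show ?thesis
        unfolding r relative_simps Bx by (rule wall_combination)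
    qed
    have comb: "DG (q, p) (a *\<^sub>R v + b *\<^sub>R v', 0) = a * DG (q, p) (v, 0) + b * DG (q, p) (v', 0)" for a b v v'
    proof -
      have "(a *\<^sub>R v + b *\<^sub>R v', 0) = a *\<^sub>R (v, 0 :: real ^ 'd ^ 'n) + b *\<^sub>R (v', 0)" by simp
      then show ?thesis by (simp only: linear_add[OF linear_DG] linear_cmul[OF linear_DG] real_scaleR_def)
    qed
    have w0: "DG (q, p) (relative i j w, 0) = 0"
      unfolding w_def by (rule DG_shift[OF drift_shift[OF edge]])
    from main have "(w $ k * (w \<bullet> w - 2 * (w $ k)\<^sup>2)) * DG (q, p) (relative i j ?ek, 0) = 0"
      unfolding V comb w0 by (simp only: mult_zero_right add_0_left)
    then show "DG (q, p) (relative i j ?ek, 0) = 0"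
      using generic[folded w_def] unfolding mult_eq_0_iff by blast
  qed
  have p0: "(?e i) $ i - (?e i) $ j = ?ek" using ij by (simp add: e_nth)
  have rel_all: "relative i j ?ek \<in> invariant_shifts p" for p
  proof (rule invariant_shifts_generic[OF _ _ rel])
    show "continuous_on UNIV (\<lambda>p. (p $ i - p $ j) $ k * ((p $ i - p $ j) \<bullet> (p $ i - p $ j) - 2 * ((p $ i - p $ j) $ k)\<^sup>2))"
      by (intro continuous_intros)
    \<comment> \<open>At the momentum \<open>?e i\<close> the relative velocity is
      \<open>?ek\<close>, and the factor takes the value 1 * (1 - 2).\<close>
    show "(?e i $ i - ?e i $ j) $ k * ((?e i $ i - ?e i $ j) \<bullet> (?e i $ i - ?e i $ j) - 2 * ((?e i $ i - ?e i $ j) $ k)\<^sup>2) \<noteq> 0"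
      unfolding p0 by (simp add: ek)
  qed
  show ?thesis
  proof (rule invariant_shifts_generic[where c = "\<lambda>p. p $ i $ k + p $ j $ k" and ?p0.0 = "?e i"])
    show "continuous_on UNIV (\<lambda>p :: real ^ 'd ^ 'n. p $ i $ k + p $ j $ k)" by (intro continuous_intros)
    show "?e i $ i $ k + ?e i $ j $ k \<noteq> 0" using ij by (simp add: e_nth ek)
    fix p :: "real ^ 'd ^ 'n" assume p: "p $ i $ k + p $ j $ k \<noteq> 0"
    let ?s = "p $ i $ k + p $ j $ k"
    have "(1 / ?s) *\<^sub>R (?A p + (p $ i $ k) *\<^sub>R relative i j ?ek) \<in> invariant_shifts p"
      by (intro subspace_mul[OF subspace_invariant_shifts] subspace_add[OF subspace_invariant_shifts] A rel_all)
    also have "?A p + (p $ i $ k) *\<^sub>R relative i j ?ek = ?s *\<^sub>R ?e i"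
      unfolding rel_k by (simp add: algebra_simps)
    finally show "?e i \<in> invariant_shifts p" using p by simp
  qed
qed

text \<open>Moving ball \<open>i\<close> alone changes the relative position by a shift independent
  of the momentum, so the second difference works without a correction \<open>B\<close>. It yields
  the relative velocity with its component in direction \<open>k\<close> removed; comparison with
  the full relative velocity leaves direction \<open>k\<close>.\<close>

lemma independence_propagates:
  assumes edge: "(i, j) \<in> collision_graph \<rho> L \<Omega>"
    and i: "\<And>p. axis i (axis k 1) \<in> invariant_shifts p"
  shows "axis j (axis k 1) \<in> invariant_shifts p"
proof -
  have ij: "i \<noteq> j" using edge by (auto simp: collision_graph_def pair_collision_def)
  let ?e = "\<lambda>a. axis a (axis k 1) :: real ^ 'd ^ 'n" and ?ek = "axis k 1 :: real ^ 'd"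
  have e_nth: "?e a $ b = (if a = b then ?ek else 0)" for a b by (simp add: axis_def)
  have ek: "?ek $ k = 1" "v \<bullet> ?ek = v $ k" "?ek \<bullet> v = v $ k" for v by (simp_all add: inner_axis inner_axis')
  have rel_k: "relative i j ?ek = ?e i - ?e j" by (simp add: relative_def)
  have rel: "relative i j ?ek \<in> invariant_shifts p" if generic: "(p $ i - p $ j) $ k \<noteq> 0" for p
  proof (rule shift_from_DG[OF \<rho>])
    fix q assume "q \<in> ball (0 :: real ^ 'd ^ 'n) \<rho>"
    then have near: "norm (q $ i - q $ j) < 2 * \<rho>" by (rule near_origin)
    define u where "u = q $ i - q $ j"
    define w where "w = p $ i - p $ j"
    have "DG (q, p) (relative i j (rotation ?ek w) - 0, 0) = 0"
    proof (rule DG_second_difference[OF near[folded u_def], where B = "\<lambda>_. 0"])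
      show "linear (\<lambda>_ :: real ^ 'd. 0 :: real ^ 'd ^ 'n)" by (rule linear_zero)
      fix t assume t: "norm (u + t *\<^sub>R ?ek) < 2 * \<rho>"
      have uq: "(q + t *\<^sub>R ?e i) $ i - (q + t *\<^sub>R ?e i) $ j = u + t *\<^sub>R ?ek"
        using ij by (simp add: e_nth u_def)
      let ?h = "\<lambda>z. (fst z + t *\<^sub>R ?e i, snd z)"
      have "(?h has_derivative (\<lambda>z. z)) (at (q, p))"
        by (auto intro!: derivative_eq_intros)
      from DG_transform[OF this, of "(relative i j (rotation (u + t *\<^sub>R ?ek) w), - relative i j (rotation w (u + t *\<^sub>R ?ek)))"]
      show "DG (q, p) (relative i j (rotation (u + t *\<^sub>R ?ek) w) - t *\<^sub>R 0, - relative i j (rotation w (u + t *\<^sub>R ?ek))) = 0"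
        using rotation_derivative[OF edge uq t w_def[symmetric]] invariant_shiftsD[OF i] by simp
    qed
    then have main: "DG (q, p) (relative i j w - (w $ k) *\<^sub>R relative i j ?ek, 0) = 0"
      by (simp add: rotation_def ek relative_simps)
    have comb: "DG (q, p) (v - b *\<^sub>R v', 0) = DG (q, p) (v, 0) - b * DG (q, p) (v', 0)" for b v v'
    proof -
      have "(v - b *\<^sub>R v', 0) = (v, 0 :: real ^ 'd ^ 'n) - b *\<^sub>R (v', 0)" by simp
      then show ?thesis by (simp only: linear_diff[OF linear_DG] linear_cmul[OF linear_DG] real_scaleR_def)
    qed
    have w0: "DG (q, p) (relative i j w, 0) = 0"
      unfolding w_def by (rule DG_shift[OF drift_shift[OF edge]])
    from main have "w $ k * DG (q, p) (relative i j ?ek, 0) = 0"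
      unfolding comb w0 by simp
    then show "DG (q, p) (relative i j ?ek, 0) = 0"
      using generic[folded w_def] unfolding mult_eq_0_iff by blast
  qed
  have "relative i j ?ek \<in> invariant_shifts p"
  proof (rule invariant_shifts_generic[OF _ _ rel, where ?p0.0 = "?e i"])
    show "continuous_on UNIV (\<lambda>p :: real ^ 'd ^ 'n. (p $ i - p $ j) $ k)" by (intro continuous_intros)
    show "(?e i $ i - ?e i $ j) $ k \<noteq> 0" using ij by (simp add: e_nth ek)
  qed
  then have "?e i - relative i j ?ek \<in> invariant_shifts p"
    by (rule subspace_diff[OF subspace_invariant_shifts i])
  then show ?thesis by (simp add: rel_k)
qed

text \<open>Each direction has a ball that reaches a wall. With at least two balls, connectedness
  provides an edge there for \<open>wall_independence\<close> and then paths to all other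
  balls.\<close>

lemma position_independence:
  assumes conn: "graph_connected (collision_graph \<rho> L \<Omega>)" and n: "CARD('n) \<ge> 2"
  shows "G (q, p) = G (0, p)"
proof -
  have e: "axis a (axis k 1) \<in> invariant_shifts p" for a k p
  proof -
    obtain i c where wall: "\<And>z p. z $ i $ k = c \<Longrightarrow> G (z, p - (2 * p $ i $ k) *\<^sub>R axis i (axis k 1)) = G (z, p)"
      by (fact wall_invariance[of k])
    obtain b :: 'n where "b \<noteq> i"
    proof (rule ccontr)
      assume "\<not> thesis"
      then have "UNIV = {i}" using that by blast
      then have "CARD('n) = card {i}" by simp
      then show False using n by simp
    qed
    moreover have "(i, b) \<in> (collision_graph \<rho> L \<Omega>)\<^sup>*" using conn by (simp add: graph_connected_def)
    ultimately obtain j where edge: "(i, j) \<in> collision_graph \<rho> L \<Omega>" by (metis converse_rtranclE)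
    have "(i, a) \<in> (collision_graph \<rho> L \<Omega>)\<^sup>*" using conn by (simp add: graph_connected_def)
    then have "\<forall>p. axis a (axis k 1) \<in> invariant_shifts p"
    proof (induction rule: rtrancl_induct)
      case base
      show ?case using wall_independence[OF edge wall] by simp
    next
      case (step a b)
      then show ?case using independence_propagates[of a b k] by simp
    qed
    then show ?thesis by blast
  qed
  have "(Basis :: (real ^ 'd ^ 'n) set) \<subseteq> invariant_shifts p"
  proof
    fix v :: "real ^ 'd ^ 'n" assume "v \<in> Basis"
    then obtain a k where "v = axis a (axis k 1)" by (auto simp: Basis_vec_def)
    then show "v \<in> invariant_shifts p" using e by simp
  qed
  then have "span (Basis :: (real ^ 'd ^ 'n) set) \<subseteq> invariant_shifts p"
    using span_minimal subspace_invariant_shifts by blast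
  then have "q \<in> invariant_shifts p" by auto
  from invariant_shiftsD[OF this, of 0 1] show ?thesis by simp
qed

end

section \<open>Reflection symmetries of a polynomial\<close>

text \<open>For \<open>v = 0\<close> the quotient is 0 and the reflection is the identity, so sets
  of reflecting vectors can contain whole subspaces.\<close>

definition reflection :: "'a::real_inner \<Rightarrow> 'a \<Rightarrow> 'a" where
  "reflection v p = p - (2 * (p \<bullet> v) / (v \<bullet> v)) *\<^sub>R v"

lemma reflection_linear: "linear (reflection v)"
  by (rule linearI) (simp_all add: reflection_def inner_add_left algebra_simps add_divide_distrib)

lemma reflection_scaleR: "c \<noteq> 0 \<Longrightarrow> reflection (c *\<^sub>R v) = reflection v"
  by (rule ext) (simp add: reflection_def)

lemma reflection_zero: "reflection 0 p = p"
  by (simp add: reflection_def)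

lemma reflection_orthogonal: "p \<bullet> v = 0 \<Longrightarrow> reflection v p = p"
  by (simp add: reflection_def)

lemma reflection_unit: "norm v = 1 \<Longrightarrow> reflection v p = p - (2 * (p \<bullet> v)) *\<^sub>R v"
  by (simp add: reflection_def flip: power2_norm_eq_inner)

lemma reflection_involution: "reflection v (reflection v p) = p"
proof (cases "v = 0")
  case False
  then have "reflection v p \<bullet> v = - (p \<bullet> v)"
    by (simp add: reflection_def inner_diff_left)
  then have "reflection v (reflection v p) = reflection v p + (2 * (p \<bullet> v) / (v \<bullet> v)) *\<^sub>R v"
    by (simp add: reflection_def[of v "reflection v p"])
  then show ?thesis by (simp add: reflection_def)
qed (simp add: reflection_zero)

lemma reflection_inner: "reflection v x \<bullet> reflection v y = x \<bullet> y"
  by (cases "v = 0")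
    (simp_all add: reflection_def inner_diff_left inner_diff_right inner_commute[of v x] inner_commute[of v y] field_simps)

lemma norm_reflection: "norm (reflection v x) = norm x"
  by (simp add: norm_eq_sqrt_inner reflection_inner)

lemma reflection_conjugate: "reflection (reflection v w) p = reflection v (reflection w (reflection v p))"
proof -
  have "p \<bullet> reflection v w = reflection v p \<bullet> w"
    using reflection_inner[of v "reflection v p" w] by (simp add: reflection_involution)
  then show ?thesis
    by (simp add: reflection_def[of "reflection v w"] reflection_def[of w "reflection v p"] reflection_inner
        linear_diff[OF reflection_linear] linear_cmul[OF reflection_linear] reflection_involution)
qed

lemma reflection_swap:
  assumes "norm a = norm b"
  shows "reflection (a - b) a = b"
proof (cases "a = b")
  case False
  have "b \<bullet> b = a \<bullet> a" using assms by (simp flip: power2_norm_eq_inner)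
  then have "2 * (a \<bullet> (a - b)) = (a - b) \<bullet> (a - b)"
    by (simp add: inner_diff_left inner_diff_right inner_commute[of b a])
  moreover have "(a - b) \<bullet> (a - b) \<noteq> 0" using False by simp
  ultimately show ?thesis by (simp add: reflection_def)
qed (simp add: reflection_zero)

text \<open>Records vectors instead of maps, so that the symmetries can be organised in linear
  subspaces. Conjugation makes the set closed under its own reflections.\<close>

definition reflection_symmetries :: "('a::real_inner \<Rightarrow> real) \<Rightarrow> 'a set" where
  "reflection_symmetries g = {v. \<forall>p. g (reflection v p) = g p}"

lemma reflection_symmetries_reflection:
  "v \<in> reflection_symmetries g \<Longrightarrow> w \<in> reflection_symmetries g \<Longrightarrow> reflection v w \<in> reflection_symmetries g"
  by (simp add: reflection_symmetries_def reflection_conjugate)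

lemma reflection_symmetries_scaleR:
  assumes "v \<in> reflection_symmetries g"
  shows "c *\<^sub>R v \<in> reflection_symmetries g"
  using assms by (cases "c = 0") (simp_all add: reflection_symmetries_def reflection_zero reflection_scaleR)

lemma norm_circle:
  assumes "norm m = 1" "norm v = 1" "v \<bullet> m = 0"
  shows "norm (circle m v t) = 1"
  using inner_circle[OF assms, of t t] by (simp add: norm_eq_sqrt_inner)

text \<open>On unit vectors the denominator of \<open>reflection\<close> is 1, so the invariance is
  a polynomial identity in the vector and continues along the circle.\<close>

lemma reflection_symmetries_circle:
  fixes g :: "'a::euclidean_space \<Rightarrow> real"
  assumes g: "real_polynomial_function g"
    and mv: "norm m = 1" "norm v = 1" "v \<bullet> m = 0"
    and e: "e > 0" "\<And>t. \<bar>t\<bar> < e \<Longrightarrow> circle m v t \<in> reflection_symmetries g"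
  shows "circle m v t \<in> reflection_symmetries g"
proof -
  have "g (p - (2 * (p \<bullet> circle m v t)) *\<^sub>R circle m v t) - g p = 0" for p
  proof -
    let ?F = "\<lambda>x. g (p - (2 * (p \<bullet> x)) *\<^sub>R x) - g p"
    have lin: "polynomial_function (\<lambda>x. 2 * (p \<bullet> x))"
      by (rule polynomial_function_linear) (rule linearI, simp_all add: inner_add_right algebra_simps)
    have "?F (0 + t *\<^sub>R 0 + cos t *\<^sub>R m + sin t *\<^sub>R v) = 0"
    proof (rule polynomial_zero_path[where F = ?F, OF _ e(1)])
      show "real_polynomial_function ?F"
        by (intro polynomial_intros real_polynomial_function_subst[OF g] lin)
      fix t assume "\<bar>t\<bar> < e"
      then have "g (reflection (circle m v t) p) = g p"
        using e(2) by (simp add: reflection_symmetries_def)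
      then show "?F (0 + t *\<^sub>R 0 + cos t *\<^sub>R m + sin t *\<^sub>R v) = 0"
        unfolding reflection_unit[OF norm_circle[OF mv]] by (simp add: circle_def)
    qed
    then show ?thesis by (simp add: circle_def)
  qed
  then show ?thesis
    by (simp add: reflection_symmetries_def reflection_unit[OF norm_circle[OF mv]])
qed

lemma exists_unit_orthogonal:
  fixes U :: "'a::euclidean_space set"
  assumes "subspace U" "dim U \<ge> 2"
  obtains m where "m \<in> U" "norm m = 1" "m \<bullet> x = 0"
proof -
  have spanU: "span U = U" using assms(1) span_eq_iff by blast
  obtain z w where zw: "z \<in> span U" "\<And>v. v \<in> span U \<Longrightarrow> orthogonal w v" "x = z + w"
    using orthogonal_subspace_decomp_exists[of U x] by blast
  have "span {z} \<subseteq> span U" using zw(1) by (simp add: span_minimal)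
  moreover have "span {z} \<noteq> span U"
  proof
    assume "span {z} = span U"
    then have "dim U = dim {z}" by (metis dim_span)
    also have "\<dots> \<le> card {z}" by (rule dim_le_card) (auto intro: span_base)
    finally show False using assms(2) by simp
  qed
  ultimately obtain y where y: "y \<noteq> 0" "y \<in> U" "\<And>v. v \<in> span {z} \<Longrightarrow> orthogonal y v"
    using orthogonal_to_subspace_exists_gen[of "{z}" U] unfolding spanU by blast
  have "y \<bullet> z = 0" using y(3)[of z] by (simp add: orthogonal_def span_base)
  moreover have "y \<bullet> w = 0" using zw(2)[of y] y(2) by (simp add: orthogonal_def spanU inner_commute)
  ultimately have "y \<bullet> x = 0" by (simp add: zw(3) inner_add_right)
  then show thesis
    using assms(1) y(1,2) by (intro that[of "y /\<^sub>R norm y"]) (auto intro: subspace_mul)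
qed

(* The reflection of U in v meets every small angle to U, and O(U) acts transitively on directions;
   analyticity in the angle does the rest. *)
lemma reflection_symmetries_subspace_insert:
  fixes g :: "'a::euclidean_space \<Rightarrow> real"
  assumes g: "real_polynomial_function g"
    and U: "subspace U" "U \<subseteq> reflection_symmetries g" "dim U \<ge> 2"
    and v: "v \<in> reflection_symmetries g" "v \<notin> U" and nonorth: "u \<in> U" "v \<bullet> u \<noteq> 0"
  shows "span (insert v U) \<subseteq> reflection_symmetries g"
proof -
  have spanU: "span U = U" using U(1) by (simp add: span_eq_iff)
  obtain u0 e' where dec: "u0 \<in> U" "\<And>w. w \<in> U \<Longrightarrow> e' \<bullet> w = 0" "v = u0 + e'"
    using orthogonal_subspace_decomp_exists[of U v] unfolding spanU orthogonal_def by blast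
  have e'0: "e' \<noteq> 0" using dec v(2) by auto
  have u00: "u0 \<noteq> 0" using dec(2)[OF nonorth(1)] dec(3) nonorth(2) by auto
  define c where "c = norm e'"
  define e where "e = e' /\<^sub>R c"
  have c: "c > 0" using e'0 by (simp add: c_def)
  have e: "norm e = 1" "e' = c *\<^sub>R e" using e'0 by (simp_all add: e_def c_def)
  have eU: "e \<bullet> w = 0" "w \<bullet> e = 0" if "w \<in> U" for w using dec(2)[OF that] by (simp_all add: e_def inner_commute)
  have v0: "v \<bullet> v > 0" using v(2) U(1) subspace_0 by (metis inner_gt_zero_iff)
  \<comment> \<open>A unit vector of \<open>U\<close> has inner product with \<open>v\<close> at
    most \<open>norm u0\<close> in absolute value. Hence \<open>A\<close> bounds the component along
    \<open>e\<close> that its reflection in \<open>v\<close> can attain.\<close>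
  define A where "A = 2 * c * norm u0 / (v \<bullet> v)"
  have A: "A > 0" using c u00 v0 by (simp add: A_def)
  have small: "circle x e t \<in> reflection_symmetries g"
    if x: "x \<in> U" "norm x = 1" and t: "\<bar>t\<bar> < min A 1" for x t
  proof -
    have cos: "cos t > 0" using t pi_gt3 by (intro cos_gt_zero_pi) auto
    \<comment> \<open>The inner product of \<open>y\<close> with \<open>v\<close> for which the
      reflection of \<open>y\<close> in \<open>v\<close> has component \<open>sin t\<close> along
      \<open>e\<close>.\<close>
    define \<tau> where "\<tau> = - sin t * (v \<bullet> v) / (2 * c)"
    define r where "r = \<tau> / norm u0"
    have "\<bar>sin t\<bar> \<le> A" using abs_sin_x_le_abs_x[of t] t by simp
    then have "\<bar>sin t\<bar> * (v \<bullet> v) \<le> 2 * c * norm u0" using v0 by (simp add: A_def pos_le_divide_eq)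
    then have "\<bar>\<tau>\<bar> \<le> norm u0" using c v0 by (simp add: \<tau>_def abs_mult pos_divide_le_eq mult.commute)
    then have r: "r\<^sup>2 \<le> 1" using u00 by (simp add: r_def abs_square_le_1)
    obtain m where m: "m \<in> U" "norm m = 1" "m \<bullet> u0 = 0"
      using exists_unit_orthogonal[OF U(1,3)] by blast
    define b where "b = u0 /\<^sub>R norm u0"
    have b: "b \<in> U" "norm b = 1" "u0 = norm u0 *\<^sub>R b"
      using dec(1) U(1) u00 by (simp_all add: b_def subspace_mul)
    have mb: "m \<bullet> b = 0" using m(3) by (simp add: b_def)
    have mm: "m \<bullet> m = 1" "b \<bullet> b = 1" using m(2) b(2) by (simp_all flip: power2_norm_eq_inner)
    define y where "y = r *\<^sub>R b + sqrt (1 - r\<^sup>2) *\<^sub>R m"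
    have yU: "y \<in> U" unfolding y_def using b(1) m(1) U(1) by (intro subspace_add subspace_mul)
    have "y \<bullet> y = r\<^sup>2 + (sqrt (1 - r\<^sup>2))\<^sup>2"
      by (simp add: y_def inner_add_left inner_add_right inner_commute[of b m] mb mm power2_eq_square)
    then have "y \<bullet> y = 1" using r by simp
    then have y: "norm y = 1" by (simp add: norm_eq_sqrt_inner)
    have "y \<bullet> (norm u0 *\<^sub>R b) = \<tau>"
      using u00 by (simp add: y_def r_def inner_add_left mb mm)
    then have "y \<bullet> u0 = \<tau>" using b(3) by metis
    moreover have "y \<bullet> e' = 0" using dec(2)[OF yU] by (simp add: inner_commute)
    ultimately have yv: "y \<bullet> v = \<tau>" by (simp add: dec(3) inner_add_right)
    define z where "z = y - (2 * \<tau> / (v \<bullet> v)) *\<^sub>R u0"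
    have zU: "z \<in> U" unfolding z_def using yU dec(1) U(1) by (intro subspace_diff subspace_mul)
    have "2 * \<tau> / (v \<bullet> v) * c = - sin t" using v0 c by (simp add: \<tau>_def)
    then have "(2 * \<tau> / (v \<bullet> v)) *\<^sub>R e' = (- sin t) *\<^sub>R e" by (simp add: e(2))
    moreover have "reflection v y = z - (2 * \<tau> / (v \<bullet> v)) *\<^sub>R e'"
      unfolding reflection_def yv z_def by (simp add: dec(3) scaleR_add_right)
    ultimately have Rz: "reflection v y = z + sin t *\<^sub>R e" by simp
    have "e \<bullet> e = 1" using e(1) by (simp flip: power2_norm_eq_inner)
    then have "(norm (reflection v y))\<^sup>2 = (norm z)\<^sup>2 + (sin t)\<^sup>2"
      unfolding Rz power2_norm_eq_inner using eU[OF zU] by (simp add: inner_add_left inner_add_right power2_eq_square)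
    then have "(norm z)\<^sup>2 = (cos t)\<^sup>2" using y by (simp add: norm_reflection cos_squared_eq)
    then have "norm z = cos t" using cos by (simp add: power2_eq_iff_nonneg)
    then have "norm z = norm (cos t *\<^sub>R x)" using cos x(2) by simp
    \<comment> \<open>A reflection in a vector of \<open>U\<close> fixes \<open>e\<close> and can
      send the part in \<open>U\<close> to any vector of equal norm, here to the prescribed
      direction \<open>x\<close>.\<close>
    then have sw: "reflection (z - cos t *\<^sub>R x) z = cos t *\<^sub>R x" by (rule reflection_swap)
    have dU: "z - cos t *\<^sub>R x \<in> U" using zU x(1) U(1) by (intro subspace_diff subspace_mul)
    have "reflection (z - cos t *\<^sub>R x) (reflection v y) = circle x e t"
      unfolding Rz using sw reflection_orthogonal[OF eU(1)[OF dU]]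
      by (simp add: linear_add[OF reflection_linear] linear_cmul[OF reflection_linear] circle_def)
    moreover have "reflection (z - cos t *\<^sub>R x) (reflection v y) \<in> reflection_symmetries g"
      using dU yU U(2) v(1) by (intro reflection_symmetries_reflection) auto
    ultimately show ?thesis by simp
  qed
  have all: "circle x e t \<in> reflection_symmetries g" if x: "x \<in> U" "norm x = 1" for x t
    by (rule reflection_symmetries_circle[OF g x(2) e(1) eU(1)[OF x(1)], of "min A 1"]) (use A small[OF x] in auto)
  show ?thesis
  proof
    fix x assume "x \<in> span (insert v U)"
    then obtain k where k: "x - k *\<^sub>R v \<in> U" unfolding span_insert spanU by blast
    define a where "a = (x - k *\<^sub>R v) + k *\<^sub>R u0"
    have a: "a \<in> U" unfolding a_def using k dec(1) U(1) by (intro subspace_add subspace_mul)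
    have x: "x = a + (k * c) *\<^sub>R e" by (simp add: a_def dec(3) e(2) scaleR_add_right)
    obtain m where m: "m \<in> U" "norm m = 1" "m \<bullet> 0 = 0"
      using exists_unit_orthogonal[OF U(1,3)] by blast
    obtain h where h: "h \<in> U" "norm h = 1" "a = norm a *\<^sub>R h"
    proof (cases "a = 0")
      case True
      then show thesis using m that by simp
    next
      case False
      then show thesis using a U(1) by (intro that[of "a /\<^sub>R norm a"]) (auto intro: subspace_mul)
    qed
    define r where "r = sqrt ((norm a)\<^sup>2 + (k * c)\<^sup>2)"
    show "x \<in> reflection_symmetries g"
    proof (cases "r = 0")
      case True
      then have "a = 0" "k * c = 0" by (simp_all add: r_def sum_power2_eq_zero_iff)
      then have "x = 0" unfolding x by (simp only: scaleR_zero_left add_0_left)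
      then show ?thesis by (simp add: reflection_symmetries_def reflection_zero)
    next
      case False
      have "(norm a / r)\<^sup>2 + (k * c / r)\<^sup>2 = 1"
        using False by (simp add: power_divide r_def flip: add_divide_distrib)
      then obtain t where "norm a / r = cos t" "k * c / r = sin t" using sincos_total_2pi by metis
      then have t: "norm a = r * cos t" "k * c = r * sin t" using False by (simp_all add: field_simps)
      have "x = (r * cos t) *\<^sub>R h + (r * sin t) *\<^sub>R e" unfolding x t(2)[symmetric] t(1)[symmetric] h(3)[symmetric] ..
      then have "x = r *\<^sub>R circle h e t" by (simp add: circle_def scaleR_add_right)
      then show ?thesis using reflection_symmetries_scaleR[OF all[OF h(1,2)]] by simp
    qed
  qed
qed

text \<open>Choose a subspace of greatest dimension: a symmetry neither in it nor orthogonal to it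
  would enlarge it.\<close>

lemma reflection_symmetries_saturated:
  fixes g :: "'a::euclidean_space \<Rightarrow> real"
  assumes g: "real_polynomial_function g"
    and U0: "subspace U0" "U0 \<subseteq> reflection_symmetries g" "dim U0 \<ge> 2"
  obtains U where "subspace U" "U0 \<subseteq> U" "U \<subseteq> reflection_symmetries g"
    "\<And>v u. v \<in> reflection_symmetries g \<Longrightarrow> u \<in> U \<Longrightarrow> v \<bullet> u \<noteq> 0 \<Longrightarrow> v \<in> U"
proof -
  let ?P = "\<lambda>U. subspace U \<and> U0 \<subseteq> U \<and> U \<subseteq> reflection_symmetries g"
  have "\<exists>U. ?P U \<and> (\<forall>W. ?P W \<longrightarrow> dim W \<le> dim U)"
  proof (rule ex_has_greatest_nat[of ?P U0 dim "DIM('a) + 1"])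
    show "?P U0" using U0 by blast
    show "\<forall>W. ?P W \<longrightarrow> dim W < DIM('a) + 1" using dim_subset_UNIV by (metis less_Suc_eq_le Suc_eq_plus1)
  qed
  then obtain U where U: "subspace U" "U0 \<subseteq> U" "U \<subseteq> reflection_symmetries g"
    and max: "\<And>W. ?P W \<Longrightarrow> dim W \<le> dim U" by blast
  have "v \<in> U" if v: "v \<in> reflection_symmetries g" "u \<in> U" "v \<bullet> u \<noteq> 0" for v u
  proof (rule ccontr)
    assume vU: "v \<notin> U"
    have "dim U \<ge> 2" using U0(3) dim_subset[OF U(2)] by simp
    then have "span (insert v U) \<subseteq> reflection_symmetries g"
      using reflection_symmetries_subspace_insert[OF g U(1,3) _ v(1) vU v(2,3)] by blast
    moreover have "U0 \<subseteq> span (insert v U)" using U(2) span_superset[of "insert v U"] by blast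
    ultimately have "dim (span (insert v U)) \<le> dim U" by (intro max) auto
    moreover have "v \<notin> span U" using vU U(1) span_eq_iff by blast
    then have "dim (insert v U) = dim U + 1"
      by (simp add: dim_insert)
    ultimately show False by simp
  qed
  with U show thesis by (rule that)
qed

lemma norm_invariant_of_reflections:
  assumes "reflection_symmetries g = UNIV" "norm a = norm b"
  shows "g a = g b"
proof -
  have "a - b \<in> reflection_symmetries g" using assms(1) by simp
  then have "g (reflection (a - b) a) = g a" by (simp add: reflection_symmetries_def)
  then show ?thesis by (simp add: reflection_swap[OF assms(2)])
qed

section \<open>Even and radial polynomials\<close>

lemma sum_lessThan_even_odd: "(\<Sum>i<2 * m. f i) = (\<Sum>j<m. f (2 * j) + f (2 * j + 1))"
  for f :: "nat \<Rightarrow> 'a::comm_monoid_add"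
  by (induction m) (simp_all add: add.assoc)

lemma even_polynomial_function:
  fixes h :: "real \<Rightarrow> real"
  assumes "real_polynomial_function h" "\<And>t. h (- t) = h t"
  obtains P where "\<And>t. h t = poly P (t\<^sup>2 / 2)"
proof -
  obtain a n where h: "h = (\<lambda>x. \<Sum>i\<le>n. a i * x ^ i)"
    using real_polynomial_function_imp_sum[OF assms(1)] by blast
  \<comment> \<open>Padding with zeros up to index \<open>2 * n + 1\<close> allows even and odd
    terms to be paired.\<close>
  define b where "b i = (if i \<le> n then a i else 0)" for i
  have h_even_odd: "h t = (\<Sum>j<Suc n. b (2 * j) * t ^ (2 * j) + b (2 * j + 1) * t ^ (2 * j + 1))" for t
  proof -
    have "h t = (\<Sum>i<2 * Suc n. b i * t ^ i)"
      unfolding h by (rule sum.mono_neutral_cong_left) (auto simp: b_def)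
    then show ?thesis unfolding sum_lessThan_even_odd .
  qed
  have "h t = poly (\<Sum>j<Suc n. monom (b (2 * j) * 2 ^ j) j) (t\<^sup>2 / 2)" for t
  proof -
    \<comment> \<open>Adding the values at \<open>t\<close> and \<open>- t\<close> cancels the odd
      terms without a comparison of coefficients.\<close>
    have "2 * h t = h t + h (- t)" using assms(2) by simp
    also have "\<dots> = (\<Sum>j<Suc n. 2 * (b (2 * j) * t ^ (2 * j)))"
      unfolding h_even_odd sum.distrib[symmetric] by (rule sum.cong) simp_all
    finally have "h t = (\<Sum>j<Suc n. b (2 * j) * t ^ (2 * j))"
      unfolding sum_distrib_left[symmetric] by simp
    also have "\<dots> = (\<Sum>j<Suc n. b (2 * j) * 2 ^ j * (t\<^sup>2 / 2) ^ j)"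
      by (rule sum.cong) (simp_all add: power_divide power_mult)
    finally show ?thesis by (simp add: poly_sum poly_monom)
  qed
  then show thesis by (rule that)
qed

lemma norm_invariant_polynomial:
  fixes g :: "'a::euclidean_space \<Rightarrow> real"
  assumes g: "real_polynomial_function g" and inv: "\<And>a b. norm a = norm b \<Longrightarrow> g a = g b"
  obtains P where "\<And>p. g p = poly P ((norm p)\<^sup>2 / 2)"
proof -
  obtain e :: 'a where e: "norm e = 1" using nonempty_Basis norm_Basis by blast
  have poly: "real_polynomial_function (\<lambda>t. g (t *\<^sub>R e))"
    by (intro polynomial_intros real_polynomial_function_subst[OF g])
  have even: "g ((- t) *\<^sub>R e) = g (t *\<^sub>R e)" for t
    by (rule inv) simp
  obtain P where P: "\<And>t. g (t *\<^sub>R e) = poly P (t\<^sup>2 / 2)"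
    by (fact even_polynomial_function[OF poly even])
  show thesis
  proof (rule that)
    fix p
    have "g p = g (norm p *\<^sub>R e)" by (rule inv) (simp add: e)
    then show "g p = poly P ((norm p)\<^sup>2 / 2)" by (simp add: P)
  qed
qed

section \<open>Momentum reflections from walls and edges\<close>

context polynomial_first_integral
begin

text \<open>One edge yields a whole subspace of reflection symmetries, of dimension at least two.
  Consecutive edges share a ball, so their vectors are not all orthogonal, and saturation collects
  every \<open>relative a b x\<close>. These span the momenta of total zero; one wall vector in each
  direction supplies the rest.\<close>

lemma polynomial_energy:
  assumes conn: "graph_connected (collision_graph \<rho> L \<Omega>)" and n: "CARD('n) \<ge> 2"
  obtains P where "\<And>q p. G (q, p) = poly P (kinetic_energy p)"
proof -
  define g where "g p = G (0, p)" for p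
  have Gg: "G (q, p) = g p" for q p
    unfolding g_def by (rule position_independence[OF conn n])
  have g: "real_polynomial_function g"
    unfolding g_def by (intro polynomial_intros real_polynomial_function_subst[OF G])
  let ?V = "reflection_symmetries g" and ?E = "collision_graph \<rho> L \<Omega>"
  have edge_neq: "a \<noteq> b" if "(a, b) \<in> ?E" for a b
    using that by (auto simp: collision_graph_def pair_collision_def)
  have other: "\<exists>b. b \<noteq> a" for a :: 'n
  proof (rule ccontr)
    assume "\<not> (\<exists>b. b \<noteq> a)"
    then have "UNIV = {a}" by blast
    then have "CARD('n) = card {a}" by simp
    then show False using n by simp
  qed
  have pair: "relative a b x \<in> ?V" if edge: "(a, b) \<in> ?E" for a b x
  proof (cases "x = 0")
    case True
    then show ?thesis by (simp add: relative_simps reflection_symmetries_def reflection_zero)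
  next
    case False
    note ab = edge_neq[OF edge]
    define m where "m = x /\<^sub>R norm x"
    have m: "norm m = 1" "x = norm x *\<^sub>R m" using False by (simp_all add: m_def)
    have mm: "m \<bullet> m = 1" using m(1) by (simp flip: power2_norm_eq_inner)
    have "relative a b m \<in> ?V"
      unfolding reflection_symmetries_def mem_Collect_eq
    proof
      fix p
      have "relative a b m \<bullet> relative a b m = 2"
        by (simp add: inner_relative relative_difference[OF ab] mm)
      then have "reflection (relative a b m) p = p - ((p $ a - p $ b) \<bullet> m) *\<^sub>R relative a b m"
        by (simp add: reflection_def inner_relative)
      \<comment> \<open>A convenient point of the cylinder: ball \<open>a\<close> at contact
        distance from the origin and all others at the origin. Overlaps do no harm because
        \<open>pair_invariance\<close> holds on the whole cylinder.\<close>
      moreover have "G (axis a ((2 * \<rho>) *\<^sub>R m), p - ((p $ a - p $ b) \<bullet> m) *\<^sub>R relative a b m) = G (axis a ((2 * \<rho>) *\<^sub>R m), p)"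
        by (rule pair_invariance[OF edge m(1)]) (use ab in \<open>simp add: axis_def\<close>)
      ultimately show "g (reflection (relative a b m) p) = g p" unfolding Gg by simp
    qed
    then have "norm x *\<^sub>R relative a b m \<in> ?V" by (rule reflection_symmetries_scaleR)
    also have "norm x *\<^sub>R relative a b m = relative a b x"
      using arg_cong[OF m(2), of "relative a b"] by (simp only: relative_simps)
    finally show ?thesis .
  qed
  have wall: "\<exists>i. axis i (axis k 1) \<in> ?V" for k
  proof -
    obtain i c where w: "\<And>z p. z $ i $ k = c \<Longrightarrow> G (z, p - (2 * p $ i $ k) *\<^sub>R axis i (axis k 1)) = G (z, p)"
      by (fact wall_invariance[of k])
    have "g (reflection (axis i (axis k 1)) p) = g p" for p
    proof -
      have "norm (axis i (axis k 1) :: real ^ 'd ^ 'n) = 1" by (simp add: norm_axis)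
      then have "reflection (axis i (axis k 1)) p = p - (2 * p $ i $ k) *\<^sub>R axis i (axis k 1)"
        by (simp add: reflection_unit inner_axis)
      moreover have "(axis i (axis k c) :: real ^ 'd ^ 'n) $ i $ k = c" by (simp add: axis_def)
      ultimately show ?thesis using w[of "axis i (axis k c)" p] unfolding Gg by simp
    qed
    then show ?thesis by (auto simp: reflection_symmetries_def)
  qed
  fix i0 :: 'n
  obtain j0 where edge0: "(i0, j0) \<in> ?E"
  proof -
    obtain b where "b \<noteq> i0" using other by blast
    moreover have "(i0, b) \<in> ?E\<^sup>*" using conn by (simp add: graph_connected_def)
    ultimately show thesis using that by (metis converse_rtranclE)
  qed
  have neq0: "i0 \<noteq> j0" by (rule edge_neq[OF edge0])
  let ?U0 = "range (relative i0 j0 :: real ^ 'd \<Rightarrow> real ^ 'd ^ 'n)"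
  have "subspace ?U0" using linear_subspace_image[OF linear_relative subspace_UNIV] by blast
  moreover have "?U0 \<subseteq> ?V" using pair[OF edge0] by blast
  moreover have "dim ?U0 \<ge> 2"
  proof -
    have "inj (relative i0 j0 :: real ^ 'd \<Rightarrow> real ^ 'd ^ 'n)"
    proof (rule injI)
      fix x y assume "relative i0 j0 x = relative i0 j0 y"
      then have "relative i0 j0 x $ i0 = relative i0 j0 y $ i0" by simp
      then show "x = y" using neq0 by (simp add: relative_nth)
    qed
    then have "dim ?U0 = dim (UNIV :: (real ^ 'd) set)"
      by (intro dim_image_eq[OF linear_relative]) auto
    then show ?thesis using d by simp
  qed
  ultimately obtain U where U: "subspace U" "?U0 \<subseteq> U" "U \<subseteq> ?V"
    and sat: "\<And>v u. v \<in> ?V \<Longrightarrow> u \<in> U \<Longrightarrow> v \<bullet> u \<noteq> 0 \<Longrightarrow> v \<in> U"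
    by (rule reflection_symmetries_saturated[OF g]) blast
  have rel: "relative i0 a x \<in> U" for a x
  proof -
    have "(i0, a) \<in> ?E\<^sup>*" using conn by (simp add: graph_connected_def)
    then have "\<forall>x. relative i0 a x \<in> U"
    proof (induction rule: rtrancl_induct)
      case base
      show ?case using subspace_0[OF U(1)] by (simp add: relative_def)
    next
      case (step a b)
      show ?case
      proof
        fix x
        have ab: "a \<noteq> b" by (rule edge_neq[OF step.hyps(2)])
        have "relative a b x \<in> U"
        proof (cases "x = 0")
          case True
          then show ?thesis using subspace_0[OF U(1)] by (simp add: relative_simps)
        next
          case False
          then have xx: "x \<bullet> x > 0" by simp
          \<comment> \<open>For \<open>a = i0\<close> the vector \<open>relative i0 a x\<close>
            vanishes, so the first edge takes its place.\<close>
          let ?u = "if a = i0 then relative i0 j0 x else relative i0 a x"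
          have "?u \<in> U" using U(2) step.IH by auto
          moreover have "relative a b x \<bullet> ?u \<noteq> 0"
            using ab neq0 xx by (auto simp: inner_relative relative_nth inner_diff_left inner_add_left)
          ultimately show ?thesis by (rule sat[OF pair[OF step.hyps(2)]])
        qed
        moreover have "relative i0 b x = relative i0 a x + relative a b x" by (simp add: relative_def)
        ultimately show "relative i0 b x \<in> U" using step.IH U(1) by (simp add: subspace_add)
      qed
    qed
    then show ?thesis by blast
  qed
  have rel': "relative a b x \<in> U" for a b x
  proof -
    have "relative a b x = relative i0 b x - relative i0 a x" by (simp add: relative_def)
    then show ?thesis using rel U(1) by (simp add: subspace_diff)
  qed
  have "axis a (axis k 1) \<in> U" for a k
  proof -
    obtain i where i: "axis i (axis k 1) \<in> ?V" using wall by blast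
    obtain b where b: "b \<noteq> i" using other by blast
    have "axis i (axis k 1) \<bullet> relative i b (axis k 1) = (1 :: real)"
      using b by (simp add: inner_axis' relative_nth)
    then have "axis i (axis k 1) \<in> U" by (intro sat[OF i rel'[of i b "axis k 1"]]) simp
    then have "axis i (axis k 1) - relative i a (axis k 1) \<in> U"
      using rel' U(1) by (intro subspace_diff)
    then show ?thesis by (simp add: relative_def)
  qed
  then have "(Basis :: (real ^ 'd ^ 'n) set) \<subseteq> U"
    by (auto simp: Basis_vec_def)
  then have "U = UNIV"
    using span_minimal[OF _ U(1)] by (metis span_Basis top.extremum_unique)
  then have "?V = UNIV" using U(3) by blast
  then obtain P where P: "\<And>p. g p = poly P ((norm p)\<^sup>2 / 2)"
    using norm_invariant_polynomial[OF g] norm_invariant_of_reflections[of g] by blast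
  have "kinetic_energy p = (norm p)\<^sup>2 / 2" for p :: "real ^ 'd ^ 'n"
    by (simp add: kinetic_energy_def power2_norm_eq_inner inner_vec_def[of p])
  then show thesis by (intro that[of P]) (simp only: Gg P)
qed

end

theorem theorem2:
  fixes \<rho> :: real and L :: "real ^ 'd"
    and \<Omega>\<^sub>\<gamma> :: "(real ^ 'd ^ 'n) set"
    and f :: "real ^ 'd ^ 'n \<Rightarrow> real ^ 'd ^ 'n \<Rightarrow> real"
  assumes "CARD('n) \<ge> 2" and "CARD('d) \<ge> 2"
    and "\<rho> > 0" and "\<forall>k. L $ k > 2 * \<rho>"
    and "\<Omega>\<^sub>\<gamma> \<in> components (config_space \<rho> L)"
    and "graph_connected (collision_graph \<rho> L \<Omega>\<^sub>\<gamma>)"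
    and "first_integral \<rho> L \<Omega>\<^sub>\<gamma> f"
    and "polynomial_in_momentum \<Omega>\<^sub>\<gamma> f"
  shows "\<exists>P :: real poly. \<forall>q\<in>\<Omega>\<^sub>\<gamma>. \<forall>p. f q p = poly P (kinetic_energy p)"
proof -
  have \<Omega>: "open \<Omega>\<^sub>\<gamma>" "connected \<Omega>\<^sub>\<gamma>" "\<Omega>\<^sub>\<gamma> \<noteq> {}"
    using assms(5) open_components[OF open_config_space] in_components_connected in_components_nonempty by blast+
  obtain G where Gf: "real_polynomial_function G" "\<And>q p. q \<in> \<Omega>\<^sub>\<gamma> \<Longrightarrow> f q p = G (q, p)"
    "\<And>q p t. G (q + t *\<^sub>R p, p) = G (q, p)"
    by (fact first_integral_polynomial[OF \<Omega> assms(7,8)])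
  interpret polynomial_first_integral \<rho> L \<Omega>\<^sub>\<gamma> f G
    using assms Gf by unfold_locales auto
  obtain P where "\<And>q p. G (q, p) = poly P (kinetic_energy p)"
    by (fact polynomial_energy[OF assms(6,1)])
  then show ?thesis using Gf(2) by (intro exI[of _ P]) simp
qed

end
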